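(* Let $D$ be a link diagram on a closed connected oriented surface $\Sigma$ of genus $g\ge1$ and let $\Omega=\{x_1,y_1,\dots,x_g,y_g\}$ be a symplectic basis for $\Sigma$. Then, after the change of variables $t\to q^{-2}$, $x_i\to x_i^{-1}$, $y_i\to y_i^{-1}$, the CSW polynomial coincides with the prismatic $U_q(\mathfrak{gl}(1|1))$ invariant of $\mathrm{Zh}_\Omega(D)$ up to units: $$\Delta_D^0(q^{-2},x_1^{-1},y_1^{-1},\dots,x_g^{-1},y_g^{-1})\;=\;u\cdot\widetilde Q^{1|1}_\Omega(\mathrm{Zh}_\Omega(D))$$ for some unit $u$ of $\mathbb Z[\langle q\rangle\times H_1(\Sigma;\mathbb Z)]$, where $H_1(\Sigma;\mathbb{Z})$ is written multiplicatively in the variables $x_i,y_i$.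
   Context: **Symplectic basis.** $\Omega$ consists of oriented simple closed curves on $\Sigma$ meeting only at a base point $\infty$, with $x_i\cdot y_j=\delta_{ij}$, $x_i\cdot x_j=y_i\cdot y_j=0$, and $\prod_{i=1}^g[x_i,y_i]=1$ the defining relation of $\pi_1(\Sigma,\infty)$, $[a,b]=a^{-1}b^{-1}ab$. Diagrams meet $\Omega$ transversely, never at a crossing and never at $\infty$. **CSW polynomial.** Let $\widetilde\Sigma\to\Sigma$ be the universal cover with group of covering transformations $\Gamma=\pi_1(\Sigma,\infty)$, and $G$ a fundamental region obtained by cutting $\Sigma$ along $\Omega$; a path crossing $x_i$ in the direction of $y_i$ (resp. $y_i$ in the direction of $x_i$) passes from $G$ to $G^{y_i}$ (resp. $G^{x_i}$). Lift $D$ to $\widetilde\Sigma$. If an arc $b$ of the lift is the image of an arc $a$ in $G$ under $\gamma\in\Gamma$, write $b=a^\gamma$. There are finitely many arcs $a_1,\dots,a_s$ in $G$ whose translates $a_i^\gamma$ are all the arcs of the lift. The Wirtinger relations at the crossings in $G$ are written as $r_1,\dots,r_s$ in the $a_i^\gamma$ (equal numbers of generators and relators): with over-arc $b$, incoming under-arc $a$, outgoing under-arc $c$, the relation is $c=b^{-1}ab$ at a positive crossing and $c=bab^{-1}$ at a negative crossing. Replace each $a_i^\gamma$ by $\gamma a_i\gamma^{-1}$, with $\gamma$ a word in $x_1,y_1,\dots,x_g,y_g$. Let $\partial/\partial a_j$ be the Fox derivatives on the free group on $a_1,\dots,a_s,x_1,y_1,\dots,x_g,y_g$ (so $\partial x_i/\partial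 a_j=\partial y_i/\partial a_j=0$), and let $\varphi$ be the ring map to $\mathbb Z[\mathbb Z\times H_1(\Sigma)]$ ($\mathbb Z=\langle t\rangle$) with $a_i\mapsto t$, $x_i\mapsto x_i$, $y_i\mapsto y_i$. Then $\Delta_D^0(t,x_1,y_1,\dots,x_g,y_g)=\det\bigl(\varphi(\partial r_i/\partial a_j)\bigr)_{1\le i,j\le s}$, well defined up to units of $\mathbb Z[\mathbb Z\times H_1(\Sigma)]$. **Homotopy Zh-construction.** Let $\check D$ be a virtual link diagram in the plane with the same Gauss diagram as $D$, coloured $\alpha$. For each intersection of an arc $c$ of $D$ with $z\in\Omega$, draw a small arc $b$ crossing over the corresponding arc $\check c$ of $\check D$ (in the order of the intersections along $c$): its colour is $x_i$ if $z=y_i$ and $y_i$ if $z=x_i$; the direction in which $b$ crosses $\check c$ is that in which $z$ crosses $c$ if $z=y_i$, and the opposite one if $z=x_i$. Join all arcs of a given colour, arbitrarily, into a single closed component, marking new intersections as virtual; if a colour is missing, add a disjoint unknot of that colour. The result is $\mathrm{Zh}_\Omega(D)$. **The functor $\widetilde Q^{1|1}_\Omega$.** Let $\mathbb F=\mathbb C(q,x_1,y_1,\dots,x_g,y_g)$ and let $V$ have $\mathbb F$-basis $v_1$ (even), $v_2$ (odd). Diagrams are read bottom to top; an upward $\alpha$-strand goes to $V$, a downward one to $V^*$, an $\Omega$-coloured strand to $\mathbb F$; juxtaposition goes to $\otimes$. Values (crossings of upward strands): - negative classical $\alpha$-crossing: $v_1\otimes v_1\mapsto q v_1\otimes v_1$,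 $v_1\otimes v_2\mapsto v_2\otimes v_1+(q-q^{-1})v_1\otimes v_2$, $v_2\otimes v_1\mapsto v_1\otimes v_2$, $v_2\otimes v_2\mapsto -q^{-1}v_2\otimes v_2$; - positive classical $\alpha$-crossing: $v_1\otimes v_1\mapsto q^{-1}v_1\otimes v_1$, $v_1\otimes v_2\mapsto v_2\otimes v_1$, $v_2\otimes v_1\mapsto v_1\otimes v_2+(q^{-1}-q)v_2\otimes v_1$, $v_2\otimes v_2\mapsto -q v_2\otimes v_2$; - virtual $\alpha$-crossing: $v_1\otimes v_1\mapsto v_1\otimes v_1$, $v_2\otimes v_1\mapsto q v_1\otimes v_2$, $v_1\otimes v_2\mapsto q^{-1}v_2\otimes v_1$, $v_2\otimes v_2\mapsto -v_2\otimes v_2$; - $\alpha$-cups: top ends (up, down): $1\mapsto v_1\otimes v_1^*+v_2\otimes v_2^*$; (down, up): $1\mapsto q^{-1}v_1^*\otimes v_1-q^{-1}v_2^*\otimes v_2$; $\alpha$-caps: bottom ends (down, up): $v_k^*\otimes v_k\mapsto1$; (up, down): $v_1\otimes v_1^*\mapsto q$, $v_2\otimes v_2^*\mapsto -q$ (caps vanish on mixed basis tensors); - classical crossing of a $z$-coloured over-strand ($z\in\Omega$) with an upward $\alpha$-strand: $v_1\mapsto v_1$, and $v_2\mapsto z v_2$ if the crossing is negative, $v_2\mapsto z^{-1}v_2$ if positive; - virtual crossings involving the $\Omega$-part and cups and caps of $\Omega$-coloured strands: identity maps. The value on a closed diagram is an element of $\mathbb F$, for $\mathrm{Zh}_\Omega(D)$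 well defined up to powers of $q$. *)

theory Defs
  imports
    "HOL-Library.Poly_Mapping"
    "HOL-Library.Multiset"
    "HOL-Computational_Algebra.Polynomial_Factorial"
    "Jordan_Normal_Form.Determinant"
begin

section \<open>Curves, variables and coefficient rings\<close>

text \<open>
  \<open>CX i\<close> and \<open>CY i\<close> are the curves \<open>x\<close>, \<open>y\<close> of index \<open>i + 1\<close> of the symplectic basis; the indices
  run over \<open>{..<g}\<close>.
\<close>

datatype curve = CX nat | CY nat

definition curves :: "nat \<Rightarrow> curve set" where
  "curves g = CX ` {..<g} \<union> CY ` {..<g}"

text \<open>
  \<open>VZ\<close> is the generator of the factor \<open>\<int>\<close>, written \<open>t\<close> for the CSW polynomial and \<open>q\<close> for the
  quantum invariant. The order on variables is only there to make polynomial rings integral domains.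
\<close>

datatype var = VZ | VC curve

fun var_code :: "var \<Rightarrow> nat" where
  "var_code VZ = 0"
| "var_code (VC (CX i)) = 2 * i + 1"
| "var_code (VC (CY i)) = 2 * i + 2"

lemma var_code_inj: "var_code a = var_code b \<Longrightarrow> a = b"
  by (cases a rule: var_code.cases; cases b rule: var_code.cases; simp; presburger)

instantiation var :: linorder
begin

definition less_eq_var :: "var \<Rightarrow> var \<Rightarrow> bool" where
  "a \<le> b \<longleftrightarrow> var_code a \<le> var_code b"

definition less_var :: "var \<Rightarrow> var \<Rightarrow> bool" where
  "a < b \<longleftrightarrow> var_code a < var_code b"

instance
  by standard (auto simp: less_eq_var_def less_var_def intro: var_code_inj)

end

text \<open>
  The group ring of \<open>\<int> \<times> H\<^sub>1(\<Sigma>)\<close>: the group is the free abelian group on the variables, written as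
  exponent vectors. The type has variables for all genera; \<open>laurent_ring g\<close> is the group ring in
  genus \<open>g\<close>.
\<close>

type_synonym laurent = "(var \<Rightarrow>\<^sub>0 int) \<Rightarrow>\<^sub>0 int"

definition laurent_ring :: "nat \<Rightarrow> laurent set" where
  "laurent_ring g = {p. \<forall>m\<in>Poly_Mapping.keys p. Poly_Mapping.keys m \<subseteq> insert VZ (VC ` curves g)}"

text \<open>The field \<open>\<complex>(q, x\<^sub>1, y\<^sub>1, \<dots>)\<close>.\<close>

type_synonym ratfun = "((var \<Rightarrow>\<^sub>0 nat) \<Rightarrow>\<^sub>0 complex) fract"

definition indet :: "var \<Rightarrow> ratfun" where
  "indet v = to_fract (Poly_Mapping.single (Poly_Mapping.single v 1) 1)"

abbreviation qq :: ratfun where "qq \<equiv> indet VZ"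

definition laurent_eval :: "(var \<Rightarrow> ratfun) \<Rightarrow> laurent \<Rightarrow> ratfun" where
  "laurent_eval \<sigma> p = (\<Sum>m\<in>Poly_Mapping.keys p.
     of_int (Poly_Mapping.lookup p m) *
     (\<Prod>v\<in>Poly_Mapping.keys m. \<sigma> v powi Poly_Mapping.lookup m v))"


section \<open>Sliced diagrams\<close>

text \<open>
  A diagram is a list of slices, read from bottom to top. A slice \<open>(i, t)\<close> is a tile \<open>t\<close> with \<open>i\<close>
  vertical strands on its left and arbitrarily many on its right.
\<close>

datatype dir = Up | Dn
datatype sign = Pos | Neg
datatype colour = Alpha | Om curve

type_synonym strand = "colour \<times> dir"

primrec opp :: "dir \<Rightarrow> dir" where
  "opp Up = Dn"
| "opp Dn = Up"

primrec flip :: "sign \<Rightarrow> sign" where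
  "flip Pos = Neg"
| "flip Neg = Pos"

text \<open>
  \<open>Cross s\<close>: classical crossing of sign \<open>s\<close> of two upward \<open>\<alpha>\<close>-strands; the over-strand is the one
  starting at the bottom left if \<open>s\<close> is positive, at the bottom right if \<open>s\<close> is negative.
  \<open>Virt a b\<close>: virtual crossing of the strands \<open>a\<close>, \<open>b\<close> (as met along the bottom).
  \<open>Pass z d l\<close>: a \<open>z\<close>-coloured strand of direction \<open>d\<close> crosses over an upward \<open>\<alpha>\<close>-strand; its
  bottom end is the left one iff \<open>l\<close>.
  \<open>Cup c d\<close>, \<open>Cap c d\<close>: the left end has direction \<open>d\<close>, the right end the opposite one.
  Classical crossings of other directions are drawn by turning an upward one with cups and caps.
\<close>

datatype tile =
    Cross sign
  | Virt strand strand
  | Pass curve dir bool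
  | Cup colour dir
  | Cap colour dir

type_synonym slice = "nat \<times> tile"

fun tile_bot :: "tile \<Rightarrow> strand list" where
  "tile_bot (Cross s) = [(Alpha, Up), (Alpha, Up)]"
| "tile_bot (Virt a b) = [a, b]"
| "tile_bot (Pass z d l) = (if l then [(Om z, d), (Alpha, Up)] else [(Alpha, Up), (Om z, d)])"
| "tile_bot (Cup c d) = []"
| "tile_bot (Cap c d) = [(c, d), (c, opp d)]"

fun tile_top :: "tile \<Rightarrow> strand list" where
  "tile_top (Cup c d) = [(c, d), (c, opp d)]"
| "tile_top (Cap c d) = []"
| "tile_top t = rev (tile_bot t)"

fun tile_ok :: "tile \<Rightarrow> bool" where
  "tile_ok (Virt a b) \<longleftrightarrow> (fst a = Alpha \<and> fst b = Alpha \<longrightarrow> snd a = Up \<and> snd b = Up)"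
| "tile_ok t \<longleftrightarrow> True"

text \<open>The colours of the basis curves that occur in a tile.\<close>

definition tile_curves :: "tile \<Rightarrow> curve set" where
  "tile_curves t = {z. \<exists>d. (Om z, d) \<in> set (tile_bot t) \<union> set (tile_top t)}"

text \<open>The sign of the crossing in a tile \<open>Pass z d l\<close>; it is positive iff \<open>z\<close> crosses from left to right.\<close>

definition pass_sign :: "dir \<Rightarrow> bool \<Rightarrow> sign" where
  "pass_sign d l = (if l \<longleftrightarrow> d = Up then Pos else Neg)"

definition fits :: "slice \<Rightarrow> strand list \<Rightarrow> bool" where
  "fits s L \<longleftrightarrow> tile_ok (snd s) \<and> fst s \<le> length L \<and>
     take (length (tile_bot (snd s))) (drop (fst s) L) = tile_bot (snd s)"

definition slice_step :: "slice \<Rightarrow> strand list \<Rightarrow> strand list" where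
  "slice_step s L =
     take (fst s) L @ tile_top (snd s) @ drop (fst s + length (tile_bot (snd s))) L"

fun tangle :: "strand list \<Rightarrow> slice list \<Rightarrow> strand list \<Rightarrow> bool" where
  "tangle L [] L' \<longleftrightarrow> L = L'"
| "tangle L (s # w) L' \<longleftrightarrow> fits s L \<and> tangle (slice_step s L) w L'"

definition level :: "strand list \<Rightarrow> slice list \<Rightarrow> nat \<Rightarrow> strand list" where
  "level L w k = fold slice_step (take k w) L"


section \<open>Gauss codes\<close>

text \<open>
  \<open>Over k s\<close>, \<open>Under k s\<close>: passing through the classical \<open>\<alpha>\<close>-crossing \<open>k\<close>, of sign \<open>s\<close>.
  \<open>Meet z s\<close>: for a diagram on the surface, crossing the curve \<open>z\<close> at a point where \<open>z\<close> meets the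
  diagram with intersection number \<open>s\<close>, positive iff \<open>z\<close> crosses from left to right; for a planar
  diagram, passing under a \<open>z\<close>-coloured strand, with \<open>s\<close> defined in the same way.
\<close>

datatype event = Over nat sign | Under nat sign | Meet curve sign

text \<open>A Gauss code has one cyclic word, cut at some point, for each component.\<close>

type_synonym code = "event list list"

text \<open>
  A point \<open>(k, j)\<close> is the strand at position \<open>j\<close> of level \<open>k\<close>. \<open>next_point\<close> follows the orientation;
  a strand running down into the bottom end \<open>j\<close> of the diagram reappears at the bottom end \<open>gl j\<close>.
  Inside a tile with ends \<open>i\<close> and \<open>i + 1\<close> the strand at \<open>j\<close> leaves at the other position \<open>i + 1 - (j - i)\<close>.
\<close>

type_synonym point = "nat \<times> nat"

fun next_point :: "strand list \<Rightarrow> (nat \<Rightarrow> nat) \<Rightarrow> slice list \<Rightarrow> point \<Rightarrow> point" where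
  "next_point L gl w (k, j) =
     (case snd (level L w k ! j) of
        Up \<Rightarrow>
          (let (i, t) = w ! k; b = length (tile_bot t); a = length (tile_top t) in
             if j < i then (k + 1, j)
             else if i + b \<le> j then (k + 1, j - b + a)
             else (if a = 0 then k else k + 1, i + 1 - (j - i)))
      | Dn \<Rightarrow>
          (if k = 0 then (0, gl j)
           else
             let (i, t) = w ! (k - 1); b = length (tile_bot t); a = length (tile_top t) in
               if j < i then (k - 1, j)
               else if i + a \<le> j then (k - 1, j - a + b)
               else (if b = 0 then k else k - 1, i + 1 - (j - i))))"

text \<open>
  The events on the way from a point to the next one; \<open>ev j\<close> are the events at the bottom end \<open>j\<close>.
  The slice number serves as the name of a crossing.
\<close>

fun passage :: "strand list \<Rightarrow> (nat \<Rightarrow> event list) \<Rightarrow> slice list \<Rightarrow> point \<Rightarrow> event list" where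
  "passage L ev w (k, j) =
     (case snd (level L w k ! j) of
        Up \<Rightarrow>
          (let (i, t) = w ! k in
             if j < i \<or> i + 2 \<le> j then []
             else
               (case t of
                  Cross s \<Rightarrow> [if (j = i) \<longleftrightarrow> (s = Pos) then Over k s else Under k s]
                | Pass z d l \<Rightarrow>
                    (if fst (level L w k ! j) = Alpha then [Meet z (pass_sign d l)] else [])
                | _ \<Rightarrow> []))
      | Dn \<Rightarrow> (if k = 0 then ev j else []))"

definition points :: "strand list \<Rightarrow> slice list \<Rightarrow> point list" where
  "points L w = concat (map (\<lambda>k. map (Pair k) [0..<length (level L w k)]) [0..<Suc (length w)])"

definition component_from :: "strand list \<Rightarrow> (nat \<Rightarrow> nat) \<Rightarrow> slice list \<Rightarrow> point \<Rightarrow> point list" where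
  "component_from L gl w p =
     p # takeWhile (\<lambda>r. r \<noteq> p)
           (map (\<lambda>n. (next_point L gl w ^^ n) p) [1..<length (points L w)])"

text \<open>One base point on each component: the first of its points in the list of all points.\<close>

definition base_points :: "strand list \<Rightarrow> (nat \<Rightarrow> nat) \<Rightarrow> slice list \<Rightarrow> point list" where
  "base_points L gl w =
     filter (\<lambda>p. find (\<lambda>r. r \<in> set (component_from L gl w p)) (points L w) = Some p) (points L w)"

definition base_points_of ::
    "colour \<Rightarrow> strand list \<Rightarrow> (nat \<Rightarrow> nat) \<Rightarrow> slice list \<Rightarrow> point list" where
  "base_points_of c L gl w =
     filter (\<lambda>(k, j). fst (level L w k ! j) = c) (base_points L gl w)"

definition gauss_code ::
    "strand list \<Rightarrow> (nat \<Rightarrow> nat) \<Rightarrow> (nat \<Rightarrow> event list) \<Rightarrow> slice list \<Rightarrow> code" where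
  "gauss_code L gl ev w =
     map (\<lambda>p. concat (map (passage L ev w) (component_from L gl w p)))
         (base_points_of Alpha L gl w)"

fun relabel :: "(nat \<Rightarrow> nat) \<Rightarrow> event \<Rightarrow> event" where
  "relabel f (Over k s) = Over (f k) s"
| "relabel f (Under k s) = Under (f k) s"
| "relabel f (Meet z s) = Meet z s"

text \<open>Equality of Gauss diagrams: the names of crossings, the order of components and the starting
  points on them are immaterial.\<close>

definition same_gauss :: "code \<Rightarrow> code \<Rightarrow> bool" where
  "same_gauss c c' \<longleftrightarrow>
     (\<exists>f. inj f \<and> rel_mset (\<lambda>u v. \<exists>n. v = rotate n (map (relabel f) u)) (mset c) (mset c'))"


section \<open>Link diagrams on a surface with a symplectic basis\<close>

text \<open>
  Cutting \<open>\<Sigma>\<close> along \<open>\<Omega>\<close> gives a \<open>4g\<close>-gon \<open>G\<close> whose counterclockwise boundary word is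
  \<open>\<Prod>\<^sub>i x\<^sub>i\<^sup>-\<^sup>1 y\<^sub>i\<^sup>-\<^sup>1 x\<^sub>i y\<^sub>i\<close>; counterclockwise because \<open>x\<^sub>i \<cdot> y\<^sub>i = 1\<close>, where \<open>a \<cdot> b = 1\<close> means that
  \<open>(a, b)\<close> is a positive frame, i.e. \<open>a\<close> crosses \<open>b\<close> from left to right. \<open>G\<close> is drawn as a half
  plane above a horizontal line that carries, from left to right, its \<open>4g\<close> sides. A link diagram
  transverse to \<open>\<Omega>\<close> is thereby a tangle diagram in \<open>G\<close> whose ends lie on the sides and match under
  the gluing.

  \<open>meets D z\<close> lists the signs \<open>z \<cdot> D\<close> of the intersections in their order along the curve \<open>z\<close>. The side
  \<open>z\<close> has \<open>G\<close> on its left, so a strand with sign \<open>Pos\<close> enters \<open>G\<close> there (upwards), and leaves \<open>G\<close>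
  through the side inverse to \<open>z\<close>, along which the order is reversed.
\<close>

record surface_diagram =
  meets :: "curve \<Rightarrow> sign list"
  body :: "slice list"

text \<open>An end \<open>(z, f, n)\<close> is the \<open>n\<close>-th intersection with \<open>z\<close>, on the side \<open>z\<close> if \<open>f\<close> and on the inverse
  side otherwise.\<close>

type_synonym side_end = "curve \<times> bool \<times> nat"

definition side :: "surface_diagram \<Rightarrow> curve \<Rightarrow> bool \<Rightarrow> side_end list" where
  "side D z f =
     (let es = map (\<lambda>n. (z, f, n)) [0..<length (meets D z)] in if f then es else rev es)"

definition polygon_ends :: "nat \<Rightarrow> surface_diagram \<Rightarrow> side_end list" where
  "polygon_ends g D = concat (map (\<lambda>i.
     side D (CX i) False @ side D (CY i) False @ side D (CX i) True @ side D (CY i) True) [0..<g])"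

fun end_strand :: "surface_diagram \<Rightarrow> side_end \<Rightarrow> strand" where
  "end_strand D (z, f, n) = (Alpha, if f \<longleftrightarrow> meets D z ! n = Pos then Up else Dn)"

definition polygon_bottom :: "nat \<Rightarrow> surface_diagram \<Rightarrow> strand list" where
  "polygon_bottom g D = map (end_strand D) (polygon_ends g D)"

fun opposite_end :: "side_end \<Rightarrow> side_end" where
  "opposite_end (z, f, n) = (z, \<not> f, n)"

definition polygon_glue :: "nat \<Rightarrow> surface_diagram \<Rightarrow> nat \<Rightarrow> nat" where
  "polygon_glue g D j =
     length (takeWhile (\<lambda>e. e \<noteq> opposite_end (polygon_ends g D ! j)) (polygon_ends g D))"

definition polygon_event :: "nat \<Rightarrow> surface_diagram \<Rightarrow> nat \<Rightarrow> event list" where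
  "polygon_event g D j = (case polygon_ends g D ! j of (z, f, n) \<Rightarrow> [Meet z (meets D z ! n)])"

fun classical_tile :: "tile \<Rightarrow> bool" where
  "classical_tile (Cross s) \<longleftrightarrow> True"
| "classical_tile (Cup c d) \<longleftrightarrow> c = Alpha"
| "classical_tile (Cap c d) \<longleftrightarrow> c = Alpha"
| "classical_tile t \<longleftrightarrow> False"

definition surface_link_diagram :: "nat \<Rightarrow> surface_diagram \<Rightarrow> bool" where
  "surface_link_diagram g D \<longleftrightarrow>
     tangle (polygon_bottom g D) (body D) [] \<and> (\<forall>s\<in>set (body D). classical_tile (snd s))"

definition surface_code :: "nat \<Rightarrow> surface_diagram \<Rightarrow> code" where
  "surface_code g D =
     gauss_code (polygon_bottom g D) (polygon_glue g D) (polygon_event g D) (body D)"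


section \<open>The CSW polynomial\<close>

text \<open>
  Generators: the arcs \<open>a\<^sub>1, \<dots>, a\<^sub>s\<close>, named by the component and the position in its code at which the
  arc starts, and the generators of \<open>\<Gamma>\<close>: \<open>Loop z\<close> is the covering transformation \<open>z\<close>, taking \<open>G\<close> to
  \<open>G\<^bsup>z\<^esup>\<close>. A word is a list of generators (\<open>Pos\<close>) and inverses of generators (\<open>Neg\<close>); it
  need not be reduced and stands for an element of the free group.
\<close>

datatype gen = Arc "nat \<times> nat" | Loop curve

type_synonym word = "(gen \<times> sign) list"

definition inv_word :: "word \<Rightarrow> word" where
  "inv_word w = rev (map (\<lambda>(h, s). (h, flip s)) w)"

text \<open>
  The translation of \<open>G\<close> effected by an event. A path crosses \<open>x\<^sub>i\<close> in the direction of \<open>y\<^sub>i\<close> iff the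
  intersection number of \<open>x\<^sub>i\<close> with it is \<open>+1\<close>, and \<open>y\<^sub>i\<close> in the direction of \<open>x\<^sub>i\<close> iff that of \<open>y\<^sub>i\<close>
  with it is \<open>-1\<close>.
\<close>

fun deck_word :: "event \<Rightarrow> word" where
  "deck_word (Meet (CX i) s) = [(Loop (CY i), s)]"
| "deck_word (Meet (CY i) s) = [(Loop (CX i), flip s)]"
| "deck_word e = []"

fun is_under :: "event \<Rightarrow> bool" where
  "is_under (Under k s) \<longleftrightarrow> True"
| "is_under e \<longleftrightarrow> False"

definition unders :: "event list \<Rightarrow> nat list" where
  "unders u = filter (\<lambda>p. is_under (u ! p)) [0..<length u]"

text \<open>
  The spot \<open>(i, p)\<close> is the place just before the event \<open>p\<close> of component \<open>i\<close>. Each arc is lifted so that it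
  starts in \<open>G\<close>. If \<open>\<delta>\<close> is the word of the intersections with \<open>\<Omega>\<close> between the start of the arc \<open>a\<close>
  and the spot, then \<open>a\<close> has reached the region \<open>\<delta> G\<close>, so that the arc of the lift which lies in \<open>G\<close> at
  this spot is the translate of \<open>a\<close> by \<open>\<delta>\<^sup>-\<^sup>1\<close>, written \<open>\<delta>\<^sup>-\<^sup>1 a \<delta>\<close>.
  A component that never passes under is one arc, cut at the start of its code.
\<close>

definition arc_back :: "event list \<Rightarrow> nat \<Rightarrow> event list" where
  "arc_back u p =
     (if unders u = [] then rev (take p u)
      else takeWhile (\<lambda>e. \<not> is_under e) (rev (rotate p u)))"

fun local_arc :: "code \<Rightarrow> nat \<times> nat \<Rightarrow> word" where
  "local_arc c (i, p) =
     (let u = c ! i; b = arc_back u p; \<delta> = concat (map deck_word (rev b)) in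
        inv_word \<delta> @ [(Arc (i, (p + length u - length b) mod length u), Pos)] @ \<delta>)"

definition over_spot :: "code \<Rightarrow> nat \<Rightarrow> nat \<times> nat" where
  "over_spot c k =
     (THE (i, p). i < length c \<and> p < length (c ! i) \<and> (\<exists>s. c ! i ! p = Over k s))"

text \<open>The relator of \<open>c = b\<^sup>-\<^sup>1 a b\<close> resp. \<open>c = b a b\<^sup>-\<^sup>1\<close> at the under-passage \<open>(i, p)\<close>.\<close>

definition wirtinger :: "code \<Rightarrow> nat \<Rightarrow> nat \<Rightarrow> word" where
  "wirtinger c i p =
     (case c ! i ! p of
        Under k s \<Rightarrow>
          (let a = local_arc c (i, p);
               b = local_arc c (over_spot c k);
               d = local_arc c (i, Suc p mod length (c ! i)) in
             (if s = Pos then inv_word b @ a @ b else b @ a @ inv_word b) @ inv_word d)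
      | _ \<Rightarrow> [])"

text \<open>
  A component that never passes under contributes one generator and no crossing relation. Its lift
  is invariant under the translation \<open>\<delta>\<close> along the component, so \<open>a\<close> and its translate by \<open>\<delta>\<^sup>-\<^sup>1\<close> are the
  same arc of the lift; the relator says so.
\<close>

definition closing :: "code \<Rightarrow> nat \<Rightarrow> word" where
  "closing c i = local_arc c (i, length (c ! i)) @ inv_word (local_arc c (i, 0))"

definition arc_list :: "code \<Rightarrow> (nat \<times> nat) list" where
  "arc_list c = concat (map (\<lambda>i.
     if unders (c ! i) = [] then [(i, 0)]
     else map (\<lambda>p. (i, Suc p mod length (c ! i))) (unders (c ! i))) [0..<length c])"

definition relator_list :: "code \<Rightarrow> word list" where
  "relator_list c = concat (map (\<lambda>i.
     if unders (c ! i) = [] then [closing c i]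
     else map (wirtinger c i) (unders (c ! i))) [0..<length c])"

text \<open>Fox derivatives, with values in formal integral combinations of words.\<close>

fun fox :: "gen \<Rightarrow> word \<Rightarrow> word \<Rightarrow>\<^sub>0 int" where
  "fox h [] = 0"
| "fox h ((h', Pos) # w) =
     (if h' = h then frag_of [] else 0) + frag_extend (\<lambda>v. frag_of ((h', Pos) # v)) (fox h w)"
| "fox h ((h', Neg) # w) =
     (if h' = h then - frag_of [(h', Neg)] else 0) +
     frag_extend (\<lambda>v. frag_of ((h', Neg) # v)) (fox h w)"

fun gen_var :: "gen \<Rightarrow> var" where
  "gen_var (Arc a) = VZ"
| "gen_var (Loop z) = VC z"

fun word_exponent :: "word \<Rightarrow> var \<Rightarrow>\<^sub>0 int" where
  "word_exponent [] = 0"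
| "word_exponent ((h, s) # w) =
     Poly_Mapping.single (gen_var h) (if s = Pos then 1 else -1) + word_exponent w"

text \<open>The ring homomorphism \<open>\<phi>\<close> induced by the group homomorphism \<^const>\<open>word_exponent\<close>.\<close>

definition phi :: "(word \<Rightarrow>\<^sub>0 int) \<Rightarrow> laurent" where
  "phi = frag_extend (\<lambda>w. frag_of (word_exponent w))"

definition csw_of_code :: "code \<Rightarrow> laurent" where
  "csw_of_code c =
     (let s = length (arc_list c) in
        det (mat s s (\<lambda>(i, j). phi (fox (Arc (arc_list c ! j)) (relator_list c ! i)))))"

definition csw_polynomial :: "nat \<Rightarrow> surface_diagram \<Rightarrow> laurent" where
  "csw_polynomial g D = csw_of_code (surface_code g D)"


section \<open>The homotopy Zh-construction\<close>

definition planar_code :: "slice list \<Rightarrow> code" where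
  "planar_code Z = gauss_code [] id (\<lambda>_. []) Z"

text \<open>
  An intersection with \<open>x\<^sub>i\<close> becomes an over-crossing by a \<open>y\<^sub>i\<close>-coloured arc in the opposite direction,
  one with \<open>y\<^sub>i\<close> an over-crossing by an \<open>x\<^sub>i\<close>-coloured arc in the same direction.
\<close>

fun zh_event :: "event \<Rightarrow> event" where
  "zh_event (Meet (CX i) s) = Meet (CY i) (flip s)"
| "zh_event (Meet (CY i) s) = Meet (CX i) s"
| "zh_event e = e"

definition zh_code :: "code \<Rightarrow> code" where
  "zh_code c = map (map zh_event) c"

text \<open>
  \<open>zh_diagram g D Z\<close>: the closed planar diagram \<open>Z\<close> is one of the possible results of the construction.
  The \<open>\<alpha>\<close>-part of \<open>Z\<close> has the Gauss diagram of \<open>D\<close> with the prescribed over-crossings by coloured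
  arcs inserted; there is one closed component of each colour; all other crossings with
  coloured components are virtual, since \<open>Cross\<close> and \<open>Pass\<close> are the only classical tiles; and a component
  whose colour has no arcs is disjoint from the rest and embedded.
\<close>

definition zh_diagram :: "nat \<Rightarrow> surface_diagram \<Rightarrow> slice list \<Rightarrow> bool" where
  "zh_diagram g D Z \<longleftrightarrow>
     tangle [] Z [] \<and>
     (\<forall>s\<in>set Z. tile_curves (snd s) \<subseteq> curves g) \<and>
     same_gauss (zh_code (surface_code g D)) (planar_code Z) \<and>
     (\<forall>z\<in>curves g. length (base_points_of (Om z) [] id Z) = 1) \<and>
     (\<forall>z\<in>curves g.
        (\<forall>u\<in>set (zh_code (surface_code g D)). \<forall>s. Meet z s \<notin> set u) \<longrightarrow>
        (\<forall>(i, t)\<in>set Z. tile_bot t \<noteq> [] \<and> tile_top t \<noteq> [] \<longrightarrow> z \<notin> tile_curves t))"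


section \<open>The prismatic invariant\<close>

text \<open>
  \<open>E1\<close>, \<open>E2\<close> stand for \<open>v\<^sub>1\<close>, \<open>v\<^sub>2\<close> at an upward \<open>\<alpha>\<close>-strand and for the dual basis at a downward one, \<open>E0\<close>
  for the basis element \<open>1\<close> of the ground field at an \<open>\<Omega>\<close>-coloured strand. A vector of a tensor product is a
  combination of lists of these. All elementary maps are even, so that no signs arise from
  tensoring them with identity maps.
\<close>

datatype bas = E0 | E1 | E2

type_synonym tensor = "bas list \<Rightarrow>\<^sub>0 ratfun"

fun cross_map :: "sign \<Rightarrow> bas \<Rightarrow> bas \<Rightarrow> tensor" where
  "cross_map Neg E1 E1 = Poly_Mapping.single [E1, E1] qq"
| "cross_map Neg E1 E2 =
     Poly_Mapping.single [E2, E1] 1 + Poly_Mapping.single [E1, E2] (qq - inverse qq)"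
| "cross_map Neg E2 E1 = Poly_Mapping.single [E1, E2] 1"
| "cross_map Neg E2 E2 = Poly_Mapping.single [E2, E2] (- inverse qq)"
| "cross_map Pos E1 E1 = Poly_Mapping.single [E1, E1] (inverse qq)"
| "cross_map Pos E1 E2 = Poly_Mapping.single [E2, E1] 1"
| "cross_map Pos E2 E1 =
     Poly_Mapping.single [E1, E2] 1 + Poly_Mapping.single [E2, E1] (inverse qq - qq)"
| "cross_map Pos E2 E2 = Poly_Mapping.single [E2, E2] (- qq)"
| "cross_map _ _ _ = 0"

fun virt_map :: "bas \<Rightarrow> bas \<Rightarrow> tensor" where
  "virt_map E1 E1 = Poly_Mapping.single [E1, E1] 1"
| "virt_map E2 E1 = Poly_Mapping.single [E1, E2] qq"
| "virt_map E1 E2 = Poly_Mapping.single [E2, E1] (inverse qq)"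
| "virt_map E2 E2 = Poly_Mapping.single [E2, E2] (- 1)"
| "virt_map _ _ = 0"

definition pass_factor :: "curve \<Rightarrow> sign \<Rightarrow> bas \<Rightarrow> ratfun" where
  "pass_factor z s a =
     (if a = E2 then (if s = Neg then indet (VC z) else inverse (indet (VC z))) else 1)"

fun cup_map :: "colour \<Rightarrow> dir \<Rightarrow> tensor" where
  "cup_map Alpha Up = Poly_Mapping.single [E1, E1] 1 + Poly_Mapping.single [E2, E2] 1"
| "cup_map Alpha Dn =
     Poly_Mapping.single [E1, E1] (inverse qq) + Poly_Mapping.single [E2, E2] (- inverse qq)"
| "cup_map (Om z) d = Poly_Mapping.single [E0, E0] 1"

fun cap_value :: "colour \<Rightarrow> dir \<Rightarrow> bas \<Rightarrow> bas \<Rightarrow> ratfun" where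
  "cap_value Alpha Dn a b = (if a = b then 1 else 0)"
| "cap_value Alpha Up a b = (if a = b then (if a = E1 then qq else - qq) else 0)"
| "cap_value (Om z) d a b = 1"

fun tile_map :: "tile \<Rightarrow> bas list \<Rightarrow> tensor" where
  "tile_map (Cross s) [a, b] = cross_map s a b"
| "tile_map (Virt x y) [a, b] =
     (if fst x = Alpha \<and> fst y = Alpha then virt_map a b else Poly_Mapping.single [b, a] 1)"
| "tile_map (Pass z d l) [a, b] =
     Poly_Mapping.single [b, a] (pass_factor z (pass_sign d l) (if l then b else a))"
| "tile_map (Cup c d) [] = cup_map c d"
| "tile_map (Cap c d) [a, b] = Poly_Mapping.single [] (cap_value c d a b)"
| "tile_map _ _ = 0"

text \<open>The linear extension of \<open>id \<otimes> tile_map t \<otimes> id\<close>.\<close>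

definition slice_map :: "slice \<Rightarrow> tensor \<Rightarrow> tensor" where
  "slice_map s v =
     (let (i, t) = s; m = length (tile_bot t) in
        \<Sum>bs\<in>Poly_Mapping.keys v. \<Sum>cs\<in>Poly_Mapping.keys (tile_map t (take m (drop i bs))).
          Poly_Mapping.single (take i bs @ cs @ drop (i + m) bs)
            (Poly_Mapping.lookup v bs *
             Poly_Mapping.lookup (tile_map t (take m (drop i bs))) cs))"

definition prismatic_value :: "slice list \<Rightarrow> ratfun" where
  "prismatic_value Z = Poly_Mapping.lookup (fold slice_map Z (Poly_Mapping.single [] 1)) []"

end

theory Submission
  imports Defs
begin

text \<open>
  Both invariants are determinants of the same Alexander matrix.

  For the prismatic invariant, exchange the roles of occupied (\<open>E2\<close>) and empty (\<open>E1\<close>) on the downward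
  strands. All crossings satisfy the free fermion condition, so that after every slice the tensor is
  decomposable: its coefficients are, up to a power of \<open>q\<close> and signs, the minors of one matrix whose
  rows are the cups and whose columns are the caps met so far and the strands of the current level.
  A cup adds a row, a cap turns two columns into one, a crossing acts on two columns by a Burau matrix
  with \<open>t = q\<^sup>-\<^sup>2\<close>. The final determinant is a Schur complement in the matrix \<open>1 - T\<close> indexed by all points
  on \<open>\<alpha>\<close>-strands, where \<open>T\<close> moves one step along the orientation, or jumps from an over-crossing to the
  strand that leaves the crossing below. Eliminating the points without an event leaves a matrix that
  depends only on the Gauss code.

  On the other side, Fox derivatives of the Wirtinger relators give the Schur complement of the same
  matrix for the code of the surface diagram in which only the beginnings of arcs are kept. The
  resulting unit is \<open>\<plusminus>q\<^sup>k\<close>.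
\<close>

section \<open>Determinants indexed by lists\<close>

text \<open>Three index sets are to be compared: cups and caps, all points of the diagram, and the
  arcs of a Gauss code. They come in unrelated orders, so determinants are indexed by lists of
  labels and compared up to sign. The comparisons rest on \<open>list_det_reduce\<close>, with
  multipliers known in closed form: the columns that the tensor carries up the diagram in one case,
  the Fox derivatives of the local arcs in the other. The substitution is dictated locally. Fox
  calculus gives the under-strand at a positive crossing the weight
  \<open>t\<^sup>-\<^sup>1\<close>, the crossing map gives \<open>q\<^sup>2\<close>, whence
  \<open>t = q\<^sup>-\<^sup>2\<close>. An intersection with a basis curve enters the Fox matrix
  through the inverse of a covering transformation and the tensor through the factor of a coloured
  over-strand; these agree once the curve variables are inverted. A component without events makes
  both invariants vanish but leaves no trace in a determinant built from the code, so it is treated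
  apart. That \<open>over_spot\<close> is well defined for the surface code is read off from the
  planar diagram, where crossings are named by slices.\<close>

definition eq_sign :: "'a::comm_ring_1 \<Rightarrow> 'a \<Rightarrow> bool" (infix "\<simeq>" 50) where
  "a \<simeq> b \<longleftrightarrow> a = b \<or> a = - b"

lemma eq_sign_refl [simp]: "a \<simeq> a"
  by (simp add: eq_sign_def)

lemma eq_sign_sym: "a \<simeq> b \<Longrightarrow> b \<simeq> a"
  by (auto simp: eq_sign_def)

lemma eq_sign_trans [trans]: "a \<simeq> b \<Longrightarrow> b \<simeq> c \<Longrightarrow> a \<simeq> c"
  by (auto simp: eq_sign_def)

lemma eq_sign_mult: "a \<simeq> b \<Longrightarrow> c \<simeq> d \<Longrightarrow> a * c \<simeq> b * d"
  by (auto simp: eq_sign_def)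

lemma eq_sign_prod_list: "(\<And>x. x \<in> set xs \<Longrightarrow> x \<simeq> 1) \<Longrightarrow> prod_list xs \<simeq> 1"
proof (induction xs)
  case (Cons x xs)
  then have "x * prod_list xs \<simeq> 1 * 1"
    by (intro eq_sign_mult) auto
  then show ?case by simp
qed simp

text \<open>Rows and columns carry labels of two independent types, so that they can be permuted and
  renamed separately. The row list alone fixes the size, hence the recurring premise
  \<open>length cs = length rs\<close>.\<close>

definition list_det :: "'r list \<Rightarrow> 'c list \<Rightarrow> ('r \<Rightarrow> 'c \<Rightarrow> 'a::comm_ring_1) \<Rightarrow> 'a" where
  "list_det rs cs f = det (mat (length rs) (length rs) (\<lambda>(i, j). f (rs ! i) (cs ! j)))"

lemma list_det_cong:
  assumes "length cs = length rs" and "\<And>r c. r \<in> set rs \<Longrightarrow> c \<in> set cs \<Longrightarrow> f r c = f' r c"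
  shows "list_det rs cs f = list_det rs cs f'"
  unfolding list_det_def using assms by (intro arg_cong[of _ _ det] cong_mat) auto

lemma list_det_map:
  "length cs = length rs \<Longrightarrow>
    list_det (map \<phi> rs) (map \<psi> cs) f = list_det rs cs (\<lambda>r c. f (\<phi> r) (\<psi> c))"
  unfolding list_det_def by (intro arg_cong[of _ _ det]) (auto intro!: eq_matI)

lemma list_det_swap:
  assumes "length cs = length rs"
  shows "list_det rs cs f = list_det cs rs (\<lambda>c r. f r c)"
proof -
  have "list_det cs rs (\<lambda>c r. f r c) =
      det (transpose_mat (mat (length rs) (length rs) (\<lambda>(i, j). f (rs ! i) (cs ! j))))"
    unfolding list_det_def using assms by (intro arg_cong[of _ _ det]) (auto intro!: eq_matI)
  also have "\<dots> = list_det rs cs f"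
    unfolding list_det_def by (rule det_transpose[of _ "length rs"]) auto
  finally show ?thesis by simp
qed

lemma signof_eq_sign: "signof p \<simeq> (1::'a::comm_ring_1)"
  by (auto simp: eq_sign_def sign_def)

lemma list_det_perm_rows:
  assumes "mset rs = mset rs'"
  shows "list_det rs cs f \<simeq> list_det rs' cs f"
proof -
  obtain p where p: "p permutes {..<length rs'}" "permute_list p rs' = rs"
    using assms by (metis mset_eq_permutation)
  have len: "length rs = length rs'" using assms by (metis size_mset)
  let ?n = "length rs'"
  let ?A = "mat ?n ?n (\<lambda>(i, j). f (rs' ! i) (cs ! j))"
  have p': "p permutes {0..<?n}" using p(1) by (simp add: lessThan_atLeast0)
  have lt: "p i < ?n" if "i < ?n" for i
    using permutes_in_image[OF p(1), of i] that by auto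
  have nth: "rs ! i = rs' ! p i" if "i < ?n" for i
    using p that by (metis permute_list_nth)
  have "list_det rs cs f = det (mat ?n ?n (\<lambda>(i, j). ?A $$ (p i, j)))"
    unfolding list_det_def len
    by (intro arg_cong[of _ _ det] eq_matI) (auto simp: nth lt)
  also have "\<dots> = signof p * det ?A"
    by (rule det_permute_rows[OF _ p']) auto
  also have "\<dots> \<simeq> 1 * det ?A"
    by (intro eq_sign_mult signof_eq_sign eq_sign_refl)
  finally show ?thesis by (simp add: list_det_def)
qed

lemma list_det_perm_cols:
  assumes "mset cs = mset cs'" "length cs = length rs"
  shows "list_det rs cs f \<simeq> list_det rs cs' f"
proof -
  have "length cs' = length rs" using assms by (metis size_mset)
  then show ?thesis
    using list_det_perm_rows[OF assms(1), of rs "\<lambda>c r. f r c"] assms(2)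
    by (simp only: list_det_swap[of cs rs] list_det_swap[of cs' rs])
qed

lemma list_det_perm:
  assumes "mset rs = mset rs'" "mset cs = mset cs'" "length cs = length rs"
  shows "list_det rs cs f \<simeq> list_det rs' cs' f"
proof -
  have "length cs = length rs'" using assms by (metis size_mset)
  from list_det_perm_cols[OF assms(2) this]
  show ?thesis using list_det_perm_rows[OF assms(1)] by (rule eq_sign_trans[rotated])
qed

text \<open>Sorting the columns by \<open>rank\<close>, and the rows \<open>\<gamma> u\<close> along
  with them, makes the matrix upper triangular. The premise \<open>tri\<close> covers equal ranks in
  both orders, so the way the sort breaks ties is immaterial.\<close>

lemma list_det_triangular:
  fixes rank :: "'c \<Rightarrow> nat" and f :: "'r \<Rightarrow> 'c \<Rightarrow> 'a::comm_ring_1"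
  assumes "distinct cs"
    and diag: "\<And>u. u \<in> set cs \<Longrightarrow> f (\<gamma> u) u \<simeq> 1"
    and tri: "\<And>u v. u \<in> set cs \<Longrightarrow> v \<in> set cs \<Longrightarrow> u \<noteq> v \<Longrightarrow> rank u \<le> rank v \<Longrightarrow> f (\<gamma> v) u = 0"
  shows "list_det (map \<gamma> cs) cs f \<simeq> 1"
proof -
  let ?cs = "sort_key rank cs"
  let ?n = "length cs"
  let ?A = "mat ?n ?n (\<lambda>(i, j). f (map \<gamma> ?cs ! i) (?cs ! j))"
  have d: "distinct ?cs" using assms(1) by simp
  have "list_det (map \<gamma> cs) cs f \<simeq> list_det (map \<gamma> ?cs) ?cs f"
    by (intro list_det_perm) auto
  also have "list_det (map \<gamma> ?cs) ?cs f = det ?A"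
    by (simp add: list_det_def)
  also have "det ?A = prod_list (diag_mat ?A)"
  proof (rule det_upper_triangular)
    show "?A \<in> carrier_mat ?n ?n" by simp
    show "upper_triangular ?A"
    proof (rule upper_triangularI)
      fix i j assume "j < i" "i < dim_row ?A"
      then have ij: "j < i" "i < ?n" by auto
      have "rank (?cs ! j) \<le> rank (?cs ! i)"
        using ij sorted_nth_mono[of "map rank ?cs" j i] by simp
      moreover have "?cs ! j \<noteq> ?cs ! i" using d ij by (simp add: nth_eq_iff_index_eq)
      moreover have "?cs ! j \<in> set cs" "?cs ! i \<in> set cs"
        using ij by (metis length_sort nth_mem order.strict_trans set_sort)+
      ultimately have "f (\<gamma> (?cs ! i)) (?cs ! j) = 0" by (intro tri) auto
      then show "?A $$ (i, j) = 0" using ij by simp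
    qed
  qed
  also have "\<dots> \<simeq> 1"
  proof (rule eq_sign_prod_list)
    fix x assume "x \<in> set (diag_mat ?A)"
    then obtain i where i: "i < ?n" "x = f (\<gamma> (?cs ! i)) (?cs ! i)"
      by (auto simp: diag_mat_def)
    have "?cs ! i \<in> set cs" using i(1) by (metis length_sort nth_mem set_sort)
    then show "x \<simeq> 1" using diag i by simp
  qed
  finally show ?thesis .
qed

text \<open>
  Gaussian elimination of the columns \<open>C2\<close>: the block with rows \<open>\<gamma> ` C2\<close> is unitriangular, and
  adding multiples of these rows, with coefficients \<open>G\<close>, to the rows \<open>R1\<close> clears the columns \<open>C2\<close>.
\<close>

lemma list_det_reduce:
  fixes rank :: "'c \<Rightarrow> nat" and f :: "'r \<Rightarrow> 'c \<Rightarrow> 'a::idom"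
  assumes "distinct C2" "distinct (map \<gamma> C2)" "length C1 = length R1"
    and diag: "\<And>u. u \<in> set C2 \<Longrightarrow> f (\<gamma> u) u \<simeq> 1"
    and tri: "\<And>u v. u \<in> set C2 \<Longrightarrow> v \<in> set C2 \<Longrightarrow> u \<noteq> v \<Longrightarrow> rank u \<le> rank v \<Longrightarrow> f (\<gamma> v) u = 0"
    and h: "\<And>r u. r \<in> set R1 \<Longrightarrow> u \<in> set C1 \<Longrightarrow>
              f r u + (\<Sum>p\<in>\<gamma> ` set C2. G r p * f p u) = h r u"
    and z: "\<And>r u. r \<in> set R1 \<Longrightarrow> u \<in> set C2 \<Longrightarrow>
              f r u + (\<Sum>p\<in>\<gamma> ` set C2. G r p * f p u) = 0"
  shows "list_det (R1 @ map \<gamma> C2) (C1 @ C2) f \<simeq> list_det R1 C1 h"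
proof -
  let ?R2 = "map \<gamma> C2"
  define n m where "n = length R1" and "m = length C2"
  define F where "F rs cs = mat (length rs) (length cs) (\<lambda>(i, j). f (rs ! i) (cs ! j))" for rs cs
  let ?G = "mat n m (\<lambda>(i, j). G (R1 ! i) (?R2 ! j))"
  let ?P = "four_block_mat (1\<^sub>m n) ?G (0\<^sub>m m n) (1\<^sub>m m)"
  let ?M = "four_block_mat (F R1 C1) (F R1 C2) (F ?R2 C1) (F ?R2 C2)"
  let ?H = "mat n n (\<lambda>(i, j). h (R1 ! i) (C1 ! j))"
  have len: "length C1 = n" "length R1 = n" "length ?R2 = m" "length C2 = m"
    using assms by (auto simp: n_def m_def)
  have carr: "F R1 C1 \<in> carrier_mat n n" "F R1 C2 \<in> carrier_mat n m"
    "F ?R2 C1 \<in> carrier_mat m n" "F ?R2 C2 \<in> carrier_mat m m"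
    by (auto simp: F_def len)
  have full: "list_det (R1 @ ?R2) (C1 @ C2) f = det ?M"
    unfolding list_det_def
    by (intro arg_cong[of _ _ det] eq_matI) (auto simp: F_def len nth_append)
  have detP: "det ?P = 1"
    by (subst det_four_block_mat_lower_left_zero[of _ n _ m]) auto
  have row: "(?G * F ?R2 cs) $$ (i, j) =
      (\<Sum>p\<in>\<gamma> ` set C2. G (R1 ! i) p * f p (cs ! j))" if "i < n" "j < length cs" for i j cs
  proof -
    have "(?G * F ?R2 cs) $$ (i, j) = (\<Sum>k = 0..<m. G (R1 ! i) (?R2 ! k) * f (?R2 ! k) (cs ! j))"
      using that len by (simp add: scalar_prod_def F_def)
    also have "\<dots> = sum_list (map (\<lambda>p. G (R1 ! i) p * f p (cs ! j)) ?R2)"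
      using len by (subst sum_list_sum_nth) (auto intro!: sum.cong)
    also have "\<dots> = (\<Sum>p\<in>set ?R2. G (R1 ! i) p * f p (cs ! j))"
      using assms(2) by (rule sum_list_distinct_conv_sum_set)
    finally show ?thesis by simp
  qed
  have top1: "F R1 C1 + ?G * F ?R2 C1 = ?H"
  proof (rule eq_matI)
    fix i j assume "i < dim_row ?H" "j < dim_col ?H"
    then have ij: "i < n" "j < n" by auto
    then have mem: "R1 ! i \<in> set R1" "C1 ! j \<in> set C1" using len by (metis nth_mem)+
    have "(?G * F ?R2 C1) $$ (i, j) = (\<Sum>p\<in>\<gamma> ` set C2. G (R1 ! i) p * f p (C1 ! j))"
      using ij len by (intro row) auto
    then show "(F R1 C1 + ?G * F ?R2 C1) $$ (i, j) = ?H $$ (i, j)"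
      using ij h[OF mem] len by (simp add: F_def del: index_mult_mat(1))
  qed (auto simp: F_def len)
  have top2: "F R1 C2 + ?G * F ?R2 C2 = 0\<^sub>m n m"
  proof (rule eq_matI)
    fix i j assume "i < dim_row (0\<^sub>m n m)" "j < dim_col (0\<^sub>m n m)"
    then have ij: "i < n" "j < m" by auto
    then have mem: "R1 ! i \<in> set R1" "C2 ! j \<in> set C2" using len by (metis nth_mem)+
    have "(?G * F ?R2 C2) $$ (i, j) = (\<Sum>p\<in>\<gamma> ` set C2. G (R1 ! i) p * f p (C2 ! j))"
      using ij len by (intro row) auto
    then show "(F R1 C2 + ?G * F ?R2 C2) $$ (i, j) = (0\<^sub>m n m) $$ (i, j)"
      using ij z[OF mem] len by (simp add: F_def del: index_mult_mat(1))
  qed (auto simp: F_def len)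
  have "?P * ?M = four_block_mat (1\<^sub>m n * F R1 C1 + ?G * F ?R2 C1) (1\<^sub>m n * F R1 C2 + ?G * F ?R2 C2)
      (0\<^sub>m m n * F R1 C1 + 1\<^sub>m m * F ?R2 C1) (0\<^sub>m m n * F R1 C2 + 1\<^sub>m m * F ?R2 C2)"
    by (rule mult_four_block_mat[OF _ _ _ _ carr]) auto
  also have "\<dots> = four_block_mat ?H (0\<^sub>m n m) (F ?R2 C1) (F ?R2 C2)"
    using carr by (simp add: top1 top2)
  finally have prod: "?P * ?M = four_block_mat ?H (0\<^sub>m n m) (F ?R2 C1) (F ?R2 C2)" .
  have "det ?P * det ?M = det (?P * ?M)"
    by (rule det_mult[symmetric, of _ "n + m"]) (use carr in auto)
  also have "\<dots> = det ?H * det (F ?R2 C2)"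
    unfolding prod by (rule det_four_block_mat_upper_right_zero[OF _ refl carr(3,4)]) auto
  finally have "det ?P * det ?M = det ?H * det (F ?R2 C2)" .
  moreover have "det (F ?R2 C2) \<simeq> 1"
    using list_det_triangular[of C2 f \<gamma> rank, OF assms(1) diag tri] by (simp add: list_det_def F_def)
  moreover have "det ?H = list_det R1 C1 h" by (simp add: list_det_def n_def)
  ultimately have "det ?M = list_det R1 C1 h * det (F ?R2 C2)" "det (F ?R2 C2) \<simeq> 1"
    using detP by auto
  then have "det ?M \<simeq> list_det R1 C1 h * 1"
    by (metis eq_sign_mult eq_sign_refl)
  then show ?thesis using full by simp
qed

section \<open>Determinants as alternating functions of a list of columns\<close>

definition col_det :: "'r list \<Rightarrow> ('r \<Rightarrow> 'a::comm_ring_1) list \<Rightarrow> 'a" where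
  "col_det rs K = list_det rs K (\<lambda>r c. c r)"

text \<open>Laplace expansion along the column \<open>x\<close>: its cofactors do not see
  \<open>x\<close>, so they can be computed with the zero column in its place.\<close>

lemma col_det_column_linear:
  fixes A B :: "('r \<Rightarrow> 'a::comm_ring_1) list"
  assumes "length rs = Suc (length A + length B)"
  obtains \<kappa> where "\<And>x. col_det rs (A @ x # B) = (\<Sum>i<length rs. x (rs ! i) * \<kappa> i)"
proof -
  let ?n = "length rs"
  let ?M = "\<lambda>x. mat ?n ?n (\<lambda>(i, j). ((A @ x # B) ! j) (rs ! i))"
  have lt: "length A < ?n" using assms by simp
  have cof: "cofactor (?M x) i (length A) = cofactor (?M y) i (length A)" for x y i
    unfolding cofactor_def mat_delete_def
    by (intro arg_cong[of _ _ "\<lambda>u. _ * det u"] cong_mat) (auto simp: nth_append nth_Cons')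
  have "col_det rs (A @ x # B) =
      (\<Sum>i<?n. x (rs ! i) * cofactor (?M (\<lambda>_. 0)) i (length A))" for x
    unfolding col_det_def list_det_def
    by (subst laplace_expansion_column[OF _ lt]) (auto intro!: sum.cong arg_cong2[of _ _ _ _ "(*)"] cof simp: lt)
  then show ?thesis by (rule that)
qed

lemma col_det_add_scale:
  assumes "length rs = Suc (length A + length B)"
  shows "col_det rs (A @ (\<lambda>r. a * x r + b * y r) # B) =
    a * col_det rs (A @ x # B) + b * col_det rs (A @ y # B)"
proof -
  obtain \<kappa> where "\<And>x. col_det rs (A @ x # B) = (\<Sum>i<length rs. x (rs ! i) * \<kappa> i)"
    using col_det_column_linear[OF assms] by blast
  then show ?thesis
    by (simp add: sum_distrib_left sum.distrib[symmetric] algebra_simps)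
qed

lemma col_det_scale:
  assumes "length rs = Suc (length A + length B)"
  shows "col_det rs (A @ (\<lambda>r. a * x r) # B) = a * col_det rs (A @ x # B)"
  using col_det_add_scale[OF assms, of a x 0 x] by simp

lemma col_det_equal:
  assumes "length rs = Suc (Suc (length A + length B))"
  shows "col_det rs (A @ x # x # B) = 0"
  unfolding col_det_def list_det_def
  by (rule det_identical_columns[of _ "length rs" "length A" "Suc (length A)"])
     (use assms in \<open>auto simp: col_def nth_append\<close>)

text \<open>By bilinearity only the two mixed terms survive, and they differ by a sign. The factor
  will be the two-particle weight of a crossing.\<close>

lemma col_det_combine:
  assumes "length rs = Suc (Suc (length A + length B))"
  shows "col_det rs (A @ (\<lambda>r. a * x r + b * y r) # (\<lambda>r. c * x r + d * y r) # B) =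
    (a * d - b * c) * col_det rs (A @ x # y # B)"
proof -
  have left: "col_det rs (A @ (\<lambda>r. a * x r + b * y r) # z # B) =
      a * col_det rs (A @ x # z # B) + b * col_det rs (A @ y # z # B)" for a b x y z
    using assms by (intro col_det_add_scale) auto
  have right: "col_det rs (A @ z # (\<lambda>r. a * x r + b * y r) # B) =
      a * col_det rs (A @ z # x # B) + b * col_det rs (A @ z # y # B)" for a b x y z
    using col_det_add_scale[of rs "A @ [z]" B] assms by simp
  \<comment> \<open>Polarisation: a repeated column \<open>x + y\<close> turns vanishing on equal
    columns into antisymmetry.\<close>
  have "0 = col_det rs (A @ (\<lambda>r. 1 * x r + 1 * y r) # (\<lambda>r. 1 * x r + 1 * y r) # B)"
    using assms by (intro col_det_equal[symmetric]) auto
  also have "\<dots> = col_det rs (A @ x # y # B) + col_det rs (A @ y # x # B)"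
    unfolding left right by (simp add: col_det_equal assms)
  finally have "col_det rs (A @ y # x # B) = - col_det rs (A @ x # y # B)"
    by (simp add: eq_neg_iff_add_eq_0 add.commute)
  then show ?thesis
    unfolding left right by (simp add: col_det_equal assms algebra_simps)
qed

lemma col_det_move:
  assumes "length rs = Suc (length K + length A + length B)"
  shows "col_det rs (K @ A @ x # B) = (- 1) ^ length A * col_det rs (K @ x # A @ B)"
  using assms
proof (induction A arbitrary: K)
  case (Cons a A)
  have "col_det rs (K @ (a # A) @ x # B) = col_det rs ((K @ [a]) @ A @ x # B)" by simp
  also have "\<dots> = (- 1) ^ length A * col_det rs ((K @ [a]) @ x # A @ B)"
    using Cons.prems by (intro Cons.IH) simp
  \<comment> \<open>The block with entries 0, 1, 1, 0 is a transposition, of determinant -1.\<close>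
  also have "col_det rs ((K @ [a]) @ x # A @ B) = - col_det rs (K @ x # a # A @ B)"
    using col_det_combine[of rs K "A @ B" 0 x 1 a 1 0] Cons.prems by simp
  finally show ?case by simp
qed simp

lemma col_det_scale_all:
  assumes "length rs = length K + length A + length B"
  shows "col_det rs (K @ map (\<lambda>x r. a * x r) A @ B) = a ^ length A * col_det rs (K @ A @ B)"
  using assms
proof (induction A arbitrary: K)
  case (Cons x A)
  have "col_det rs (K @ map (\<lambda>x r. a * x r) (x # A) @ B) =
      a * col_det rs ((K @ [x]) @ map (\<lambda>x r. a * x r) A @ B)"
    using Cons.prems col_det_scale[of rs K "map (\<lambda>x r. a * x r) A @ B"] by simp
  also have "\<dots> = a * (a ^ length A * col_det rs ((K @ [x]) @ A @ B))"
    using Cons.prems by (subst Cons.IH) auto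
  finally show ?case by simp
qed simp

text \<open>Laplace expansion along the new last row, on which every column but \<open>x\<close>
  vanishes. This is how a cup enlarges the determinant.\<close>

lemma col_det_new_row:
  fixes A B :: "('r \<Rightarrow> 'a::comm_ring_1) list"
  assumes "length rs = length A + length B"
    and zero: "\<And>y. y \<in> set (A @ B) \<Longrightarrow> y r0 = 0"
  shows "col_det (rs @ [r0]) (A @ x # B) =
    (- 1) ^ (length rs + length A) * x r0 * col_det rs (A @ B)"
proof -
  let ?n = "length rs"
  let ?M = "mat (Suc ?n) (Suc ?n) (\<lambda>(i, j). ((A @ x # B) ! j) ((rs @ [r0]) ! i))"
  have "det ?M = (\<Sum>j<Suc ?n. ?M $$ (?n, j) * cofactor ?M ?n j)"
    by (rule laplace_expansion_row) auto
  also have "\<dots> = (\<Sum>j<Suc ?n. if j = length A then x r0 * cofactor ?M ?n j else 0)"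
  proof (rule sum.cong[OF refl])
    fix j assume "j \<in> {..<Suc ?n}"
    then have j: "j < Suc ?n" by simp
    have "((A @ x # B) ! j) r0 = 0" if "j \<noteq> length A"
    proof -
      have "(A @ x # B) ! j \<in> set (A @ B)"
        using that j assms(1) by (auto simp: nth_append nth_Cons' intro!: nth_mem)
      then show ?thesis by (rule zero)
    qed
    moreover have "((A @ x # B) ! length A) = x" by simp
    ultimately show "?M $$ (?n, j) * cofactor ?M ?n j =
        (if j = length A then x r0 * cofactor ?M ?n j else 0)"
      using j by (auto simp: nth_append)
  qed
  also have "\<dots> = x r0 * cofactor ?M ?n (length A)"
    using assms(1) by simp
  also have "mat_delete ?M ?n (length A) = mat ?n ?n (\<lambda>(i, j). ((A @ B) ! j) (rs ! i))"
    unfolding mat_delete_def by (intro eq_matI) (auto simp: nth_append nth_Cons' assms(1))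
  then have "cofactor ?M ?n (length A) = (- 1) ^ (?n + length A) * col_det rs (A @ B)"
    by (simp add: cofactor_def col_det_def list_det_def)
  finally show ?thesis by (simp add: col_det_def list_det_def)
qed

section \<open>Tensors with determinantal coefficients\<close>

text \<open>With the two states exchanged on downward strands, each term of a cup has exactly one
  occupied end, and so has each nonzero term of a cap: cups create one particle, caps absorb one.
  Coloured strands carry a one-dimensional space and never a particle.\<close>

fun occupied :: "strand \<Rightarrow> bas \<Rightarrow> bool" where
  "occupied (Alpha, Up) b \<longleftrightarrow> b = E2"
| "occupied (Alpha, Dn) b \<longleftrightarrow> b = E1"
| "occupied (Om z, d) b \<longleftrightarrow> False"

fun basis_of :: "strand \<Rightarrow> bas set" where
  "basis_of (Alpha, d) = {E1, E2}"
| "basis_of (Om z, d) = {E0}"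

definition basis :: "strand list \<Rightarrow> bas list set" where
  "basis L = listset (map basis_of L)"

lemma basis_Nil [simp]: "basis [] = {[]}"
  by (simp add: basis_def)

lemma basis_Cons: "basis (s # L) = (\<lambda>(b, bs). b # bs) ` (basis_of s \<times> basis L)"
  by (auto simp: basis_def set_Cons_def)

lemma finite_basis_of [simp]: "finite (basis_of s)"
  by (cases s rule: basis_of.cases) auto

lemma finite_basis [simp]: "finite (basis L)"
  by (induction L) (auto simp: basis_Cons)

lemma length_basis: "bs \<in> basis L \<Longrightarrow> length bs = length L"
  by (induction L arbitrary: bs) (auto simp: basis_Cons)

lemma basis_append:
  "length b1 = length L1 \<Longrightarrow> b1 @ b2 \<in> basis (L1 @ L2) \<longleftrightarrow> b1 \<in> basis L1 \<and> b2 \<in> basis L2"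
  by (induction L1 b1 rule: list_induct2') (auto simp: basis_Cons image_iff)

lemma basis_appendE:
  assumes "bs \<in> basis (L1 @ L2)"
  obtains b1 b2 where "bs = b1 @ b2" "b1 \<in> basis L1" "b2 \<in> basis L2"
proof -
  have len: "length bs = length L1 + length L2" using length_basis[OF assms] by simp
  have "take (length L1) bs @ drop (length L1) bs \<in> basis (L1 @ L2)" using assms by simp
  then have "take (length L1) bs \<in> basis L1 \<and> drop (length L1) bs \<in> basis L2"
    by (subst (asm) basis_append) (auto simp: len)
  then show ?thesis using that[of "take (length L1) bs" "drop (length L1) bs"] by simp
qed

lemma basis_append3E:
  assumes "bs \<in> basis (L1 @ L2 @ L3)"
  obtains b1 b2 b3 where "bs = b1 @ b2 @ b3" "b1 \<in> basis L1" "b2 \<in> basis L2" "b3 \<in> basis L3"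
  using assms by (elim basis_appendE) blast

fun select :: "strand list \<Rightarrow> 'x list \<Rightarrow> bas list \<Rightarrow> 'x list" where
  "select (s # L) (x # S) (b # bs) = (if occupied s b then x # select L S bs else select L S bs)"
| "select _ _ _ = []"

lemma select_append:
  "length S1 = length L1 \<Longrightarrow> length b1 = length L1 \<Longrightarrow>
    select (L1 @ L2) (S1 @ S2) (b1 @ b2) = select L1 S1 b1 @ select L2 S2 b2"
  by (induction L1 S1 b1 rule: select.induct) auto

lemma select_map: "select L (map f S) bs = map f (select L S bs)"
  by (induction L S bs rule: select.induct) auto

lemma set_select: "set (select L S bs) \<subseteq> set S"
  by (induction L S bs rule: select.induct) auto

text \<open>The columns \<open>K\<close> of the caps met so far enter every minor; of
  \<open>S\<close>, which has one column for each strand, the occupied ones enter. The size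
  condition expresses conservation of particles and keeps \<open>col_det\<close> a genuine
  determinant, since \<open>list_det\<close> takes its size from the rows only.\<close>

definition coefficient ::
    "strand list \<Rightarrow> nat list \<Rightarrow> (nat \<Rightarrow> ratfun) list \<Rightarrow> (nat \<Rightarrow> ratfun) list \<Rightarrow> ratfun \<Rightarrow> bas list \<Rightarrow> ratfun"
  where "coefficient L rs K S c bs =
    (if length K + length (select L S bs) = length rs then c * col_det rs (K @ select L S bs) else 0)"

definition det_state ::
    "strand list \<Rightarrow> tensor \<Rightarrow> nat list \<Rightarrow> (nat \<Rightarrow> ratfun) list \<Rightarrow> (nat \<Rightarrow> ratfun) list \<Rightarrow> ratfun \<Rightarrow> bool"
  where "det_state L v rs K S c \<longleftrightarrow> length S = length L \<and>
    (\<forall>bs. Poly_Mapping.lookup v bs = (if bs \<in> basis L then coefficient L rs K S c bs else 0))"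

lemma tile_map_basis:
  assumes "tile_ok t" "bt \<in> basis (tile_bot t)" "cs \<in> Poly_Mapping.keys (tile_map t bt)"
  shows "cs \<in> basis (tile_top t)"
proof -
  have k: "cs \<in> Poly_Mapping.keys (Poly_Mapping.single x a) \<Longrightarrow> cs = x" for x and a :: ratfun
    by (simp split: if_splits)
  have k2: "cs \<in> Poly_Mapping.keys (Poly_Mapping.single x a + Poly_Mapping.single y b) \<Longrightarrow> cs = x \<or> cs = y"
    for x y and a b :: ratfun
    using keys_add[of "Poly_Mapping.single x a" "Poly_Mapping.single y b"] by (auto split: if_splits)
  have al: "bas = E1 \<or> bas = E2" if "bas \<in> basis_of (Alpha, d)" for bas d
    using that by simp
  show ?thesis
  proof (cases t)
    case (Cross s)
    then show ?thesis using assms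
      by (cases s) (auto simp: basis_Cons dest!: k k2 split: if_splits)
  next
    case (Virt a b)
    obtain ca da cb db where [simp]: "a = (ca, da)" "b = (cb, db)" by fastforce
    show ?thesis using assms Virt
      by (cases ca; cases cb) (auto simp: basis_Cons dest!: k k2 split: if_splits)
  next
    case (Pass z d l)
    then show ?thesis using assms by (auto simp: basis_Cons dest!: k k2 split: if_splits)
  next
    case (Cup c d)
    then show ?thesis using assms by (cases c; cases d) (auto simp: basis_Cons dest!: k k2 split: if_splits)
  next
    case (Cap c d)
    then show ?thesis using assms by (cases c; cases d) (auto simp: basis_Cons dest!: k k2 split: if_splits)
  qed
qed

section \<open>The action of a slice on the coefficients of a tensor\<close>

lemma lookup_slice_map:
  "Poly_Mapping.lookup (slice_map (i, t) v) bs' =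
    (\<Sum>bs\<in>Poly_Mapping.keys v.
      \<Sum>cs\<in>Poly_Mapping.keys (tile_map t (take (length (tile_bot t)) (drop i bs))).
        (Poly_Mapping.lookup v bs *
           Poly_Mapping.lookup (tile_map t (take (length (tile_bot t)) (drop i bs))) cs
         when take i bs @ cs @ drop (i + length (tile_bot t)) bs = bs'))"
  by (simp add: slice_map_def Let_def lookup_sum lookup_single)

text \<open>A slice leaves the labels outside its tile alone, so only inputs
  \<open>b1 @ bt @ b2\<close> with the same outer parts contribute. All words in the basis of a
  given list of strands have equal length, which lets the three parts be compared one by
  one.\<close>

lemma lookup_slice_map_block:
  assumes ok: "tile_ok t" and keys: "Poly_Mapping.keys v \<subseteq> basis (L1 @ tile_bot t @ L2)"
    and b: "b1 \<in> basis L1" "b2 \<in> basis L2" "bt' \<in> basis (tile_top t)"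
  shows "Poly_Mapping.lookup (slice_map (length L1, t) v) (b1 @ bt' @ b2) =
    (\<Sum>bt\<in>basis (tile_bot t). Poly_Mapping.lookup v (b1 @ bt @ b2) * Poly_Mapping.lookup (tile_map t bt) bt')"
proof -
  let ?i = "length L1" and ?m = "length (tile_bot t)"
  let ?F = "\<lambda>bs. Poly_Mapping.lookup v bs * Poly_Mapping.lookup (tile_map t (take ?m (drop ?i bs))) bt'"
  let ?X = "(\<lambda>bt. b1 @ bt @ b2) ` basis (tile_bot t)"
  have lb: "length b1 = ?i" using b(1) by (rule length_basis)
  have inner: "(\<Sum>cs\<in>Poly_Mapping.keys (tile_map t (take ?m (drop ?i bs))).
        (Poly_Mapping.lookup v bs * Poly_Mapping.lookup (tile_map t (take ?m (drop ?i bs))) cs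
         when take ?i bs @ cs @ drop (?i + ?m) bs = b1 @ bt' @ b2)) = (if bs \<in> ?X then ?F bs else 0)"
    if "bs \<in> Poly_Mapping.keys v" for bs
  proof -
    have "bs \<in> basis (L1 @ tile_bot t @ L2)" using that keys by auto
    then obtain c1 bt c2 where bs: "bs = c1 @ bt @ c2" "c1 \<in> basis L1" "bt \<in> basis (tile_bot t)" "c2 \<in> basis L2"
      by (rule basis_append3E)
    have l: "length c1 = ?i" "length bt = ?m" using bs length_basis by auto
    have eq: "take ?i bs @ cs @ drop (?i + ?m) bs = b1 @ bt' @ b2 \<longleftrightarrow> c1 = b1 \<and> cs = bt' \<and> c2 = b2"
      if "cs \<in> Poly_Mapping.keys (tile_map t bt)" for cs
    proof -
      have "cs \<in> basis (tile_top t)" using tile_map_basis[OF ok bs(3) that] .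
      then have "length cs = length bt'" using b(3) length_basis by metis
      then show ?thesis using l lb by (simp add: bs(1))
    qed
    have mem: "bs \<in> ?X \<longleftrightarrow> c1 = b1 \<and> c2 = b2"
      using bs l lb by (auto simp: image_iff length_basis)
    have "(\<Sum>cs\<in>Poly_Mapping.keys (tile_map t (take ?m (drop ?i bs))).
        (Poly_Mapping.lookup v bs * Poly_Mapping.lookup (tile_map t (take ?m (drop ?i bs))) cs
         when take ?i bs @ cs @ drop (?i + ?m) bs = b1 @ bt' @ b2)) =
       (\<Sum>cs\<in>Poly_Mapping.keys (tile_map t bt). if cs = bt' then
         (if c1 = b1 \<and> c2 = b2 then Poly_Mapping.lookup v bs * Poly_Mapping.lookup (tile_map t bt) bt' else 0) else 0)"
      using l eq by (intro sum.cong) (auto simp: bs(1) when_def)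
    also have "\<dots> = (if bs \<in> ?X then ?F bs else 0)"
      using l unfolding mem by (auto simp: bs(1) in_keys_iff)
    finally show ?thesis .
  qed
  have "Poly_Mapping.lookup (slice_map (?i, t) v) (b1 @ bt' @ b2) =
      (\<Sum>bs\<in>Poly_Mapping.keys v. if bs \<in> ?X then ?F bs else 0)"
    unfolding lookup_slice_map by (rule sum.cong[OF refl inner])
  also have "\<dots> = (\<Sum>bs\<in>?X. ?F bs)"
    by (subst sum.inter_restrict[symmetric]) (auto intro!: sum.mono_neutral_left simp: in_keys_iff)
  also have "\<dots> = (\<Sum>bt\<in>basis (tile_bot t). ?F (b1 @ bt @ b2))"
    by (subst sum.reindex) (auto simp: inj_on_def)
  also have "\<dots> = (\<Sum>bt\<in>basis (tile_bot t). Poly_Mapping.lookup v (b1 @ bt @ b2) * Poly_Mapping.lookup (tile_map t bt) bt')"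
    using lb by (intro sum.cong) (auto simp: length_basis)
  finally show ?thesis .
qed

lemma lookup_slice_map_outside:
  assumes ok: "tile_ok t" and keys: "Poly_Mapping.keys v \<subseteq> basis (L1 @ tile_bot t @ L2)"
    and "bs' \<notin> basis (L1 @ tile_top t @ L2)"
  shows "Poly_Mapping.lookup (slice_map (length L1, t) v) bs' = 0"
proof -
  have "take (length L1) bs @ cs @ drop (length L1 + length (tile_bot t)) bs \<in> basis (L1 @ tile_top t @ L2)"
    if "bs \<in> Poly_Mapping.keys v"
      "cs \<in> Poly_Mapping.keys (tile_map t (take (length (tile_bot t)) (drop (length L1) bs)))" for bs cs
  proof -
    have "bs \<in> basis (L1 @ tile_bot t @ L2)" using that keys by auto
    then obtain c1 bt c2 where bs: "bs = c1 @ bt @ c2" "c1 \<in> basis L1" "bt \<in> basis (tile_bot t)" "c2 \<in> basis L2"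
      by (rule basis_append3E)
    have l: "length c1 = length L1" "length bt = length (tile_bot t)" using bs length_basis by auto
    have cs: "cs \<in> basis (tile_top t)"
      using that(2) l by (intro tile_map_basis[OF ok bs(3)]) (simp add: bs(1))
    then show ?thesis using l bs by (simp add: basis_append length_basis)
  qed
  then show ?thesis
    unfolding lookup_slice_map using assms(3) by (intro sum.neutral ballI) (auto simp: when_def)
qed

definition tile_sum ::
    "strand list \<Rightarrow> tile \<Rightarrow> strand list \<Rightarrow> nat list \<Rightarrow> (nat \<Rightarrow> ratfun) list \<Rightarrow> (nat \<Rightarrow> ratfun) list \<Rightarrow>
      ratfun \<Rightarrow> bas list \<Rightarrow> bas list \<Rightarrow> bas list \<Rightarrow> ratfun"
  where "tile_sum L1 t L2 rs K S c b1 bt' b2 =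
    (\<Sum>bt\<in>basis (tile_bot t). coefficient (L1 @ tile_bot t @ L2) rs K S c (b1 @ bt @ b2) *
      Poly_Mapping.lookup (tile_map t bt) bt')"

text \<open>Reduces the effect of a slice to an identity for its tile, with the labels
  \<open>b1\<close>, \<open>b2\<close> of the strands beside it as parameters.\<close>

lemma det_state_step:
  assumes "det_state (L1 @ tile_bot t @ L2) v rs K S c" "tile_ok t"
    and "length S' = length (L1 @ tile_top t @ L2)"
    and "\<And>b1 bt' b2. b1 \<in> basis L1 \<Longrightarrow> b2 \<in> basis L2 \<Longrightarrow> bt' \<in> basis (tile_top t) \<Longrightarrow>
      tile_sum L1 t L2 rs K S c b1 bt' b2 =
        coefficient (L1 @ tile_top t @ L2) rs' K' S' c' (b1 @ bt' @ b2)"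
  shows "det_state (L1 @ tile_top t @ L2) (slice_map (length L1, t) v) rs' K' S' c'"
proof -
  have keys: "Poly_Mapping.keys v \<subseteq> basis (L1 @ tile_bot t @ L2)"
    using assms(1) by (auto simp: det_state_def in_keys_iff split: if_splits)
  show ?thesis
    unfolding det_state_def
  proof (intro conjI allI assms(3))
    fix bs'
    show "Poly_Mapping.lookup (slice_map (length L1, t) v) bs' =
      (if bs' \<in> basis (L1 @ tile_top t @ L2) then coefficient (L1 @ tile_top t @ L2) rs' K' S' c' bs' else 0)"
    proof (cases "bs' \<in> basis (L1 @ tile_top t @ L2)")
      case True
      then obtain b1 bt' b2 where b: "bs' = b1 @ bt' @ b2" "b1 \<in> basis L1" "bt' \<in> basis (tile_top t)" "b2 \<in> basis L2"
        by (rule basis_append3E)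
      have "Poly_Mapping.lookup (slice_map (length L1, t) v) bs' =
        (\<Sum>bt\<in>basis (tile_bot t). Poly_Mapping.lookup v (b1 @ bt @ b2) * Poly_Mapping.lookup (tile_map t bt) bt')"
        unfolding b(1) by (rule lookup_slice_map_block[OF assms(2) keys b(2,4,3)])
      also have "\<dots> = tile_sum L1 t L2 rs K S c b1 bt' b2"
        unfolding tile_sum_def
        using assms(1) b by (intro sum.cong) (auto simp: det_state_def basis_append length_basis)
      finally show ?thesis using True assms(4) b by simp
    next
      case False
      then show ?thesis using lookup_slice_map_outside[OF assms(2) keys] by simp
    qed
  qed
qed

lemma coefficient_append:
  assumes "b1 \<in> basis L1" "bm \<in> basis M" "length S1 = length L1" "length SM = length M"
  shows "coefficient (L1 @ M @ L2) rs K (S1 @ SM @ S2) c (b1 @ bm @ b2) =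
    (if length K + length (select L1 S1 b1) + length (select M SM bm) + length (select L2 S2 b2) = length rs
     then c * col_det rs (K @ select L1 S1 b1 @ select M SM bm @ select L2 S2 b2) else 0)"
  using assms by (auto simp: coefficient_def select_append length_basis add.assoc)

lemma basis_pair: "basis [(Alpha, d), (Alpha, d')] = {[E1, E1], [E1, E2], [E2, E1], [E2, E2]}"
  by (auto simp: basis_Cons)

lemma coefficient_pair:
  assumes "length b1 = length L1" "length S1 = length L1"
  shows "coefficient (L1 @ s # s' # L2) rs K (S1 @ x # y # S2) c (b1 @ p # q # b2) =
    (if length K + length (select L1 S1 b1) + length (select [s, s'] [x, y] [p, q]) + length (select L2 S2 b2) = length rs
     then c * col_det rs (K @ select L1 S1 b1 @ select [s, s'] [x, y] [p, q] @ select L2 S2 b2) else 0)"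
  using assms by (auto simp: coefficient_def select_append add.assoc)

text \<open>The premises \<open>W\<close> are the free fermion condition: relative to the weight
  \<open>w\<close> of the empty pair, one particle moves by a 2 by 2 matrix and two particles by its
  determinant. Linearity in one column gives the one-particle coefficients,
  \<open>col_det_combine\<close> the two-particle one.\<close>

lemma det_state_free_fermion:
  assumes "det_state (L1 @ tile_bot t @ L2) v rs K (S1 @ [x, y] @ S2) c" "tile_ok t"
    and L: "tile_bot t = [(Alpha, Up), (Alpha, Up)]" "tile_top t = [(Alpha, Up), (Alpha, Up)]"
    and len: "length S1 = length L1" "length S2 = length L2"
    and W: "tile_map t [E1, E1] = Poly_Mapping.single [E1, E1] w"
      "tile_map t [E1, E2] = Poly_Mapping.single [E2, E1] (w * q) + Poly_Mapping.single [E1, E2] (w * q')"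
      "tile_map t [E2, E1] = Poly_Mapping.single [E1, E2] (w * p') + Poly_Mapping.single [E2, E1] (w * p)"
      "tile_map t [E2, E2] = Poly_Mapping.single [E2, E2] (w * (p * q' - q * p'))"
  shows "det_state (L1 @ tile_top t @ L2) (slice_map (length L1, t) v) rs K
    (S1 @ [\<lambda>r. p * x r + q * y r, \<lambda>r. p' * x r + q' * y r] @ S2) (c * w)"
    (is "det_state _ _ _ _ ?S' _")
proof (rule det_state_step[OF assms(1,2)])
  show "length ?S' = length (L1 @ tile_top t @ L2)" using len L by simp
  fix b1 bt' b2
  assume b: "b1 \<in> basis L1" "b2 \<in> basis L2" "bt' \<in> basis (tile_top t)"
  note co = coefficient_pair[OF length_basis[OF b(1)] len(1)]
  let ?A = "select L1 S1 b1" and ?B = "select L2 S2 b2"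
  have one: "col_det rs (K @ ?A @ (\<lambda>r. p * x r + q * y r) # ?B) =
      p * col_det rs (K @ ?A @ x # ?B) + q * col_det rs (K @ ?A @ y # ?B)"
    if "length K + length ?A + 1 + length ?B = length rs" for p q
    using that col_det_add_scale[of rs "K @ ?A" ?B p x q y] by simp
  have two: "col_det rs (K @ ?A @ (\<lambda>r. p * x r + q * y r) # (\<lambda>r. p' * x r + q' * y r) # ?B) =
      (p * q' - q * p') * col_det rs (K @ ?A @ x # y # ?B)"
    if "length K + length ?A + 2 + length ?B = length rs" for p q p' q'
    using that col_det_combine[of rs "K @ ?A" ?B p x q y p' q'] by simp
  from b(3) consider "bt' = [E1, E1]" | "bt' = [E1, E2]" | "bt' = [E2, E1]" | "bt' = [E2, E2]"
    by (auto simp: L basis_pair)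
  then show "tile_sum L1 t L2 rs K (S1 @ [x, y] @ S2) c b1 bt' b2 =
        coefficient (L1 @ tile_top t @ L2) rs K ?S' (c * w) (b1 @ bt' @ b2)"
    by cases (simp_all add: tile_sum_def L co basis_pair W lookup_add lookup_single one two algebra_simps)
qed

text \<open>At least one of the strands is coloured, so at most one of the two columns is ever
  selected. Hence both may be given the factor \<open>\<phi>\<close>, whichever side the
  \<alpha>-strand is on.\<close>

lemma det_state_past_coloured:
  assumes "det_state (L1 @ tile_bot t @ L2) v rs K (S1 @ [x, y] @ S2) c" "tile_ok t"
    and L: "tile_bot t = [s, s']" "tile_top t = [s', s]" "fst s \<noteq> Alpha \<or> fst s' \<noteq> Alpha"
    and len: "length S1 = length L1" "length S2 = length L2"
    and W: "\<And>p q. p \<in> basis_of s \<Longrightarrow> q \<in> basis_of s' \<Longrightarrow>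
      tile_map t [p, q] = Poly_Mapping.single [q, p] (if occupied s p \<or> occupied s' q then \<phi> else 1)"
  shows "det_state (L1 @ tile_top t @ L2) (slice_map (length L1, t) v) rs K
    (S1 @ [\<lambda>r. \<phi> * y r, \<lambda>r. \<phi> * x r] @ S2) c" (is "det_state _ _ _ _ ?S' _")
proof (rule det_state_step[OF assms(1,2)])
  show "length ?S' = length (L1 @ tile_top t @ L2)" using len L by simp
  fix b1 bt' b2
  assume b: "b1 \<in> basis L1" "b2 \<in> basis L2" "bt' \<in> basis (tile_top t)"
  note co = coefficient_pair[OF length_basis[OF b(1)] len(1)]
  let ?A = "select L1 S1 b1" and ?B = "select L2 S2 b2"
  have one: "col_det rs (K @ ?A @ (\<lambda>r. \<phi> * z r) # ?B) = \<phi> * col_det rs (K @ ?A @ z # ?B)"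
    if "length K + length ?A + 1 + length ?B = length rs" for z
    using that col_det_scale[of rs "K @ ?A" ?B \<phi> z] by simp
  obtain p q where pq: "bt' = [q, p]" "p \<in> basis_of s" "q \<in> basis_of s'"
    using b(3) by (auto simp: L basis_Cons)
  have "\<not> (occupied s p \<and> occupied s' q)"
    using L(3) by (cases s; cases s'; cases "fst s"; cases "fst s'") auto
  then have "coefficient (L1 @ tile_bot t @ L2) rs K (S1 @ [x, y] @ S2) c (b1 @ [p, q] @ b2) *
      (if occupied s p \<or> occupied s' q then \<phi> else 1) =
      coefficient (L1 @ tile_top t @ L2) rs K ?S' c (b1 @ bt' @ b2)"
    using pq by (simp add: L co basis_Cons image_iff one)
  moreover have "tile_sum L1 t L2 rs K (S1 @ [x, y] @ S2) c b1 bt' b2 =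
     (\<Sum>bt\<in>basis (tile_bot t). if bt = [p, q] then
        coefficient (L1 @ tile_bot t @ L2) rs K (S1 @ [x, y] @ S2) c (b1 @ [p, q] @ b2) *
        (if occupied s p \<or> occupied s' q then \<phi> else 1) else 0)"
    unfolding tile_sum_def
  proof (rule sum.cong[OF refl])
    fix bt assume "bt \<in> basis (tile_bot t)"
    then obtain p' q' where bt: "bt = [p', q']" "p' \<in> basis_of s" "q' \<in> basis_of s'"
      by (auto simp: L basis_Cons)
    have "Poly_Mapping.lookup (tile_map t bt) bt' =
        (if bt = [p, q] then if occupied s p \<or> occupied s' q then \<phi> else 1 else 0)"
      using bt pq by (cases "p' = p \<and> q' = q") (auto simp: W lookup_single when_def)
    then show "coefficient (L1 @ tile_bot t @ L2) rs K (S1 @ [x, y] @ S2) c (b1 @ bt @ b2) *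
          Poly_Mapping.lookup (tile_map t bt) bt' = (if bt = [p, q] then
        coefficient (L1 @ tile_bot t @ L2) rs K (S1 @ [x, y] @ S2) c (b1 @ [p, q] @ b2) *
        (if occupied s p \<or> occupied s' q then \<phi> else 1) else 0)"
      by (cases "bt = [p, q]") simp_all
  qed
  moreover have "[p, q] \<in> basis (tile_bot t)" using pq by (simp add: L basis_Cons image_iff)
  ultimately show "tile_sum L1 t L2 rs K (S1 @ [x, y] @ S2) c b1 bt' b2 =
        coefficient (L1 @ tile_top t @ L2) rs K ?S' c (b1 @ bt' @ b2)"
    by simp
qed

text \<open>The ends of the cup are never occupied, so the columns \<open>SM\<close> that fill their
  places do not enter any minor.\<close>

lemma det_state_coloured_cup:
  assumes "det_state (L1 @ tile_bot t @ L2) v rs K (S1 @ S2) c" "t = Cup (Om z) d"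
    and len: "length S1 = length L1" "length S2 = length L2" "length SM = 2"
  shows "det_state (L1 @ tile_top t @ L2) (slice_map (length L1, t) v) rs K (S1 @ SM @ S2) c"
proof (rule det_state_step[OF assms(1)])
  show "length (S1 @ SM @ S2) = length (L1 @ tile_top t @ L2)" using assms by simp
  fix b1 bt' b2
  assume b: "b1 \<in> basis L1" "b2 \<in> basis L2" "bt' \<in> basis (tile_top t)"
  obtain x y where SM: "SM = [x, y]" using len(3) by (auto simp: length_Suc_conv numeral_2_eq_2)
  show "tile_sum L1 t L2 rs K (S1 @ S2) c b1 bt' b2 =
        coefficient (L1 @ tile_top t @ L2) rs K (S1 @ SM @ S2) c (b1 @ bt' @ b2)"
    using b(3) coefficient_append[OF b(1) _ len(1), of "[]" "[]" "[]"]
      coefficient_append[OF b(1) _ len(1), of "[E0, E0]" "[(Om z, d), (Om z, opp d)]" "[x, y]"]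
    by (auto simp: tile_sum_def assms(2) basis_Cons SM)
qed (simp add: assms)

lemma det_state_coloured_cap:
  assumes "det_state (L1 @ tile_bot t @ L2) v rs K (S1 @ [x, y] @ S2) c" "t = Cap (Om z) d"
    and len: "length S1 = length L1" "length S2 = length L2"
  shows "det_state (L1 @ tile_top t @ L2) (slice_map (length L1, t) v) rs K (S1 @ S2) c"
proof (rule det_state_step[OF assms(1)])
  show "length (S1 @ S2) = length (L1 @ tile_top t @ L2)" using assms by simp
  fix b1 bt' b2
  assume b: "b1 \<in> basis L1" "b2 \<in> basis L2" "bt' \<in> basis (tile_top t)"
  show "tile_sum L1 t L2 rs K (S1 @ [x, y] @ S2) c b1 bt' b2 =
        coefficient (L1 @ tile_top t @ L2) rs K (S1 @ S2) c (b1 @ bt' @ b2)"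
    using b(3) coefficient_append[OF b(1) _ len(1), of "[]" "[]" "[]"]
      coefficient_append[OF b(1) _ len(1), of "[E0, E0]" "[(Om z, d), (Om z, opp d)]" "[x, y]"]
    by (auto simp: tile_sum_def assms(2) basis_Cons)
qed (simp add: assms)

lemma col_det_zero_row:
  fixes M :: "('r \<Rightarrow> 'a::comm_ring_1) list"
  assumes "r \<in> set rs" "\<And>x. x \<in> set M \<Longrightarrow> x r = 0" "length M = length rs"
  shows "col_det rs M = 0"
proof -
  obtain i where i: "i < length rs" "rs ! i = r" using assms(1) by (auto simp: in_set_conv_nth)
  show ?thesis
    unfolding col_det_def list_det_def
    by (subst laplace_expansion_row[OF _ i(1)])
       (use i assms(2)[OF nth_mem] assms(3) in \<open>auto intro!: sum.neutral\<close>)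
qed

abbreviation neg_columns :: "('r \<Rightarrow> 'a::comm_ring_1) list \<Rightarrow> ('r \<Rightarrow> 'a) list" where
  "neg_columns S \<equiv> map (\<lambda>x r. - x r) S"

text \<open>In each term one end is occupied, with a column supported on the new row
  \<open>r0\<close>. Expansion along that row gives a sign for every selected column on the left;
  negating the columns \<open>S1\<close> absorbs it, however many are selected. The scalar
  \<open>\<nu>\<close> will be matched with \<open>scales\<close>.\<close>

lemma det_state_cup:
  assumes "det_state (L1 @ tile_bot t @ L2) v rs K (S1 @ S2) c" "t = Cup Alpha d"
    and len: "length S1 = length L1" "length S2 = length L2"
    and zero: "\<And>x. x \<in> set (K @ S1 @ S2) \<Longrightarrow> x r0 = 0"
    and "\<nu> \<noteq> 0" and e: "e = (\<lambda>r. if r = r0 then \<nu> else 0)"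
  shows "det_state (L1 @ tile_top t @ L2) (slice_map (length L1, t) v) (rs @ [r0]) K
     (neg_columns S1 @ (if d = Up then [e, e] else [e, \<lambda>r. - e r]) @ S2)
     ((- 1) ^ (length rs + length K) * (c * (if d = Up then 1 else inverse qq) / \<nu>))"
    (is "det_state _ _ _ _ (_ @ ?SM @ _) _")
proof (rule det_state_step[OF assms(1)])
  show "length (neg_columns S1 @ ?SM @ S2) = length (L1 @ tile_top t @ L2)" using assms by simp
  fix b1 bt' b2
  assume b: "b1 \<in> basis L1" "b2 \<in> basis L2" "bt' \<in> basis (tile_top t)"
  let ?A = "select L1 S1 b1" and ?B = "select L2 S2 b2"
  let ?A' = "neg_columns ?A"
  have lenA: "length (neg_columns S1) = length L1" using len by simp
  have lenM: "length ?SM = length (tile_top t)" by (simp add: assms(2))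
  have z: "y r0 = 0" if "y \<in> set (K @ ?A' @ ?B)" for y
    using that zero set_select[of L1 S1 b1] set_select[of L2 S2 b2] by auto
  have new: "col_det (rs @ [r0]) (K @ ?A' @ (\<lambda>r. if r = r0 then \<mu> else 0) # ?B) =
      (- 1) ^ (length rs + length K) * (\<mu> * col_det rs (K @ ?A @ ?B))"
    if "length K + length ?A + length ?B = length rs" for \<mu>
  proof -
    have "col_det (rs @ [r0]) ((K @ ?A') @ (\<lambda>r. if r = r0 then \<mu> else 0) # ?B) =
      (- 1) ^ (length rs + length (K @ ?A')) * (\<lambda>r. if r = r0 then \<mu> else 0) r0 * col_det rs ((K @ ?A') @ ?B)"
      using that z by (intro col_det_new_row) auto
    then show ?thesis
      using that col_det_scale_all[of rs K ?A ?B "- 1"]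
      by (simp add: power_add)
  qed
  have none: "col_det (rs @ [r0]) (K @ ?A' @ ?B) = 0"
    if "length K + length ?A + length ?B = Suc (length rs)"
    using that z by (intro col_det_zero_row[of r0]) auto
  have both: "col_det (rs @ [r0]) (K @ ?A' @ e # (\<lambda>r. \<mu> * e r) # ?B) = 0"
    if "length K + length ?A + 2 + length ?B = Suc (length rs)" for \<mu>
    using that col_det_combine[of "rs @ [r0]" "K @ ?A'" ?B 1 e 0 e \<mu> 0] by simp
  have both1: "col_det (rs @ [r0]) (K @ ?A' @ e # e # ?B) = 0"
    if "length K + length ?A + 2 + length ?B = Suc (length rs)"
    using both[of 1] that by simp
  have both2: "col_det (rs @ [r0]) (K @ ?A' @ e # (\<lambda>r. - e r) # ?B) = 0"
    if "length K + length ?A + 2 + length ?B = Suc (length rs)"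
    using both[of "- 1"] that by simp
  have e_neg: "(\<lambda>r. - e r) = (\<lambda>r. if r = r0 then - \<nu> else 0)" by (auto simp: e)
  have old: "coefficient (L1 @ L2) rs K (S1 @ S2) c (b1 @ b2) =
      (if length K + length ?A + length ?B = length rs then c * col_det rs (K @ ?A @ ?B) else 0)"
    using coefficient_append[OF b(1) _ len(1), of "[]" "[]" "[]"] by simp
  note co = coefficient_append[OF b(1,3) lenA lenM, unfolded select_map]
  have sg: "(- 1) ^ n * (- 1) ^ n = (1::ratfun)" for n :: nat
    by (simp add: power_mult_distrib[symmetric])
  have sg': "(- 1) ^ n * (x * ((- 1) ^ n * y)) = x * y" for n :: nat and x y :: ratfun
  proof -
    have "(- 1) ^ n * (x * ((- 1) ^ n * y)) = ((- 1) ^ n * (- 1) ^ n) * (x * y)"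
      by (simp only: mult_ac)
    then show ?thesis by (simp only: sg mult_1)
  qed
  show "tile_sum L1 t L2 rs K (S1 @ S2) c b1 bt' b2 =
        coefficient (L1 @ tile_top t @ L2) (rs @ [r0]) K (neg_columns S1 @ ?SM @ S2)
          ((- 1) ^ (length rs + length K) * (c * (if d = Up then 1 else inverse qq) / \<nu>)) (b1 @ bt' @ b2)"
  proof -
    have d: "d = Up \<or> d = Dn" by (cases d) simp_all
    from b(3) have "bt' = [E1, E1] \<or> bt' = [E1, E2] \<or> bt' = [E2, E1] \<or> bt' = [E2, E2]"
      by (auto simp: assms(2) basis_pair)
    with d show ?thesis
      unfolding co
      by (elim disjE) (simp_all add: tile_sum_def assms(2) old lookup_add lookup_single new[of \<nu>, folded e]
        new[of "- \<nu>", folded e_neg] none both1 both2 mult.assoc sg' \<open>\<nu> \<noteq> 0\<close>)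
  qed
qed (simp add: assms)

text \<open>One end is occupied in each nonzero term, so the terms add up to one determinant with a
  combination of \<open>x\<close> and \<open>y\<close> in their place. This column moves to the end
  of \<open>K\<close>; the sign for passing the selected columns of \<open>S1\<close> is absorbed by
  negating them.\<close>

lemma det_state_cap:
  assumes "det_state (L1 @ tile_bot t @ L2) v rs K (S1 @ [x, y] @ S2) c" "t = Cap Alpha d"
    and len: "length S1 = length L1" "length S2 = length L2"
    and "\<mu> \<noteq> 0"
    and xy: "\<And>r. (if d = Up then y r - x r else x r + y r) = \<mu> * k r"
  shows "det_state (L1 @ tile_top t @ L2) (slice_map (length L1, t) v) rs (K @ [k])
     (neg_columns S1 @ S2) (c * (if d = Up then qq else 1) * \<mu>)"
proof (rule det_state_step[OF assms(1)])
  show "length (neg_columns S1 @ S2) = length (L1 @ tile_top t @ L2)" using assms by simp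
  fix b1 bt' b2
  assume b: "b1 \<in> basis L1" "b2 \<in> basis L2" "bt' \<in> basis (tile_top t)"
  let ?A = "select L1 S1 b1" and ?B = "select L2 S2 b2"
  let ?A' = "neg_columns ?A"
  have lenA: "length (neg_columns S1) = length L1" using len by simp
  have new: "\<mu> * col_det rs (K @ k # ?A' @ ?B) =
      (if d = Up then col_det rs (K @ ?A @ y # ?B) - col_det rs (K @ ?A @ x # ?B)
       else col_det rs (K @ ?A @ x # ?B) + col_det rs (K @ ?A @ y # ?B))"
    if "length K + 1 + length ?A + length ?B = length rs"
  proof -
    have "\<mu> * col_det rs (K @ k # ?A' @ ?B) = \<mu> * ((- 1) ^ length ?A * col_det rs (K @ k # ?A @ ?B))"
      using that col_det_scale_all[of rs "K @ [k]" ?A ?B "- 1"] by simp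
    also have "\<dots> = \<mu> * col_det rs (K @ ?A @ k # ?B)"
      using that by (subst col_det_move) auto
    also have "\<dots> = col_det rs ((K @ ?A) @ (\<lambda>r. \<mu> * k r) # ?B)"
      using that by (subst col_det_scale) auto
    also have "(\<lambda>r. \<mu> * k r) = (\<lambda>r. (if d = Up then - 1 else 1) * x r + 1 * y r)"
      using xy by (auto simp: fun_eq_iff)
    also have "col_det rs ((K @ ?A) @ (\<lambda>r. (if d = Up then - 1 else 1) * x r + 1 * y r) # ?B) =
      (if d = Up then - 1 else 1) * col_det rs ((K @ ?A) @ x # ?B) + 1 * col_det rs ((K @ ?A) @ y # ?B)"
      using that by (intro col_det_add_scale) auto
    finally show ?thesis by simp
  qed
  have new': "col_det rs (K @ k # ?A' @ ?B) =
      (if d = Up then col_det rs (K @ ?A @ y # ?B) - col_det rs (K @ ?A @ x # ?B)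
       else col_det rs (K @ ?A @ x # ?B) + col_det rs (K @ ?A @ y # ?B)) / \<mu>"
    if "length K + 1 + length ?A + length ?B = length rs"
    unfolding new[OF that, symmetric] using \<open>\<mu> \<noteq> 0\<close> by simp
  have bt': "bt' = []" using b(3) by (simp add: assms(2))
  have co2: "coefficient (L1 @ L2) rs (K @ [k]) (neg_columns S1 @ S2) c' (b1 @ b2) =
      (if length K + 1 + length ?A + length ?B = length rs then c' * col_det rs (K @ k # ?A' @ ?B) else 0)" for c'
    using coefficient_append[OF b(1) _ lenA, of "[]" "[]" "[]"] by (simp add: select_map)
  note co = coefficient_pair[OF length_basis[OF b(1)] len(1)]
  show "tile_sum L1 t L2 rs K (S1 @ [x, y] @ S2) c b1 bt' b2 =
        coefficient (L1 @ tile_top t @ L2) rs (K @ [k]) (neg_columns S1 @ S2)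
          (c * (if d = Up then qq else 1) * \<mu>) (b1 @ bt' @ b2)"
    using \<open>\<mu> \<noteq> 0\<close>
    by (cases d; simp add: tile_sum_def bt' assms(2) co co2 basis_pair new' right_diff_distrib distrib_left; simp add: field_simps)
qed (simp add: assms)

section \<open>Units and the rescaling of columns by heights\<close>

lemma indet_nonzero [simp]: "indet v \<noteq> 0"
proof -
  have "Poly_Mapping.single (Poly_Mapping.single v (Suc 0)) (1::complex) \<noteq> 0"
    by (metis lookup_single_eq lookup_zero zero_neq_one)
  then show ?thesis by (simp add: indet_def)
qed

definition q_unit :: "ratfun \<Rightarrow> bool" where
  "q_unit c \<longleftrightarrow> (\<exists>k. c \<simeq> qq powi k)"

lemma q_unit_powi [simp]: "q_unit (qq powi k)"
  using eq_sign_refl q_unit_def by blast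

lemma q_unit_mult: "q_unit a \<Longrightarrow> q_unit b \<Longrightarrow> q_unit (a * b)"
  unfolding q_unit_def by (metis eq_sign_mult indet_nonzero power_int_add)

lemma q_unit_uminus: "q_unit a \<Longrightarrow> q_unit (- a)"
  by (auto simp: q_unit_def eq_sign_def)

lemma q_unit_inverse: "q_unit a \<Longrightarrow> q_unit (inverse a)"
  unfolding q_unit_def eq_sign_def by (metis inverse_minus_eq power_int_minus)

lemma q_unit_1 [simp]: "q_unit 1"
  using q_unit_powi[of 0] by simp

lemma q_unit_qq [simp]: "q_unit qq"
  using q_unit_powi[of 1] by simp

lemma q_unit_sign [simp]: "q_unit ((- 1) ^ n)"
  by (cases "even n") (auto intro: q_unit_uminus)

lemma q_unit_nonzero: "q_unit a \<Longrightarrow> a \<noteq> 0"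
  by (auto simp: q_unit_def eq_sign_def)

text \<open>The height of a region is the number of upward minus the number of downward
  \<alpha>-strands to its left. A tile does not change the heights beside it
  (\<open>sum_height_top\<close>), so powers of \<open>q\<close> determined by heights form a
  consistent rescaling.\<close>

fun height :: "strand \<Rightarrow> int" where
  "height (Alpha, Up) = 1"
| "height (Alpha, Dn) = - 1"
| "height (Om z, d) = 0"

abbreviation downs :: "strand list \<Rightarrow> nat" where
  "downs L \<equiv> count_list L (Alpha, Dn)"

text \<open>
  The powers of \<open>q\<close> turn the matrices of the tiles into Burau matrices with \<open>t = q\<^sup>-\<^sup>2\<close> and remove \<open>q\<close>
  from the virtual crossings; the signs come from moving a new row or column past the selected
  columns on its left.
\<close>

fun scales :: "int \<Rightarrow> strand list \<Rightarrow> ratfun list" where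
  "scales h [] = []"
| "scales h (s # L) =
     (if fst s = Alpha then (- 1) ^ downs L * qq powi (if snd s = Dn then h - 1 else h) else 0)
       # scales (h + height s) L"

lemma length_scales [simp]: "length (scales h L) = length L"
  by (induction L arbitrary: h) auto

lemma scales_append:
  "scales h (L1 @ L2) = map (\<lambda>\<eta>. (- 1) ^ downs L2 * \<eta>) (scales h L1) @ scales (h + sum_list (map height L1)) L2"
  by (induction L1 arbitrary: h) (auto simp: power_add algebra_simps)

text \<open>In \<open>scales\<close> an \<alpha>-strand gets as exponent the smaller of the heights
  of the two regions beside it, so that both ends of a cup or cap carry the same power of
  \<open>q\<close>, while two neighbouring upward strands differ by one factor
  \<open>q\<close>.\<close>

definition scaled :: "int \<Rightarrow> strand list \<Rightarrow> (nat \<Rightarrow> ratfun) list \<Rightarrow> (nat \<Rightarrow> ratfun) list" where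
  "scaled h L C = map2 (\<lambda>\<eta> x r. \<eta> * x r) (scales h L) C"

lemma length_scaled [simp]: "length (scaled h L C) = min (length L) (length C)"
  by (simp add: scaled_def)

lemma scaled_Nil [simp]: "scaled h [] C = []"
  by (simp add: scaled_def)

lemma scaled_Cons [simp]: "scaled h (s # L) (x # C) =
    (\<lambda>r. (if fst s = Alpha then (- 1) ^ downs L * qq powi (if snd s = Dn then h - 1 else h) else 0) * x r)
      # scaled (h + height s) L C"
  by (simp add: scaled_def)

lemma scaled_append:
  "length C1 = length L1 \<Longrightarrow> scaled h (L1 @ L2) (C1 @ C2) =
    map (\<lambda>x r. (- 1) ^ downs L2 * x r) (scaled h L1 C1) @ scaled (h + sum_list (map height L1)) L2 C2"
  by (simp add: scaled_def scales_append zip_append zip_map1 case_prod_unfold mult.assoc)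

lemma set_scaled_zero: "x \<in> set (scaled h L C) \<Longrightarrow> (\<And>y. y \<in> set C \<Longrightarrow> y r = 0) \<Longrightarrow> x r = 0"
  by (auto simp: scaled_def dest!: set_zip_rightD)

text \<open>The matrices of the tiles in rescaled form. At a crossing the column of the over-strand
  passes unchanged. In a cup the downward end gets \<open>1\<close> and the upward end
  \<open>-1\<close>, on whichever side it lies; the new row is named by the slice number
  \<open>k\<close>. The last clause also serves caps, whose columns leave the list.\<close>

fun column_step :: "nat \<Rightarrow> tile \<Rightarrow> (nat \<Rightarrow> ratfun) list \<Rightarrow> (nat \<Rightarrow> ratfun) list" where
  "column_step k (Cross Pos) [x, y] = [\<lambda>r. (1 - qq powi 2) * x r + qq powi 2 * y r, x]"
| "column_step k (Cross Neg) [x, y] = [y, \<lambda>r. qq powi (- 2) * x r + (1 - qq powi (- 2)) * y r]"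
| "column_step k (Virt a b) [x, y] = [y, x]"
| "column_step k (Pass z d l) [x, y] =
     [\<lambda>r. pass_factor z (pass_sign d l) E2 * y r, \<lambda>r. pass_factor z (pass_sign d l) E2 * x r]"
| "column_step k (Cup c d) [] =
     (if d = Up then [\<lambda>r. if r = k then - 1 else 0, \<lambda>r. if r = k then 1 else 0]
      else [\<lambda>r. if r = k then 1 else 0, \<lambda>r. if r = k then - 1 else 0])"
| "column_step k _ _ = []"

definition is_cup :: "tile \<Rightarrow> bool" where "is_cup t \<longleftrightarrow> (\<exists>d. t = Cup Alpha d)"
definition is_cap :: "tile \<Rightarrow> bool" where "is_cap t \<longleftrightarrow> (\<exists>d. t = Cap Alpha d)"

lemma sum_height_top: "sum_list (map height (tile_top t)) = sum_list (map height (tile_bot t))"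
proof (cases t)
  case (Cup c d)
  then show ?thesis by (cases c; cases d) auto
next
  case (Cap c d)
  then show ?thesis by (cases c; cases d) auto
qed (simp_all add: add.commute)

lemma qq_shift: "qq powi (h + 1) = qq * qq powi h" "qq powi (1 + h) = qq * qq powi h"
  "qq powi (h - 1) = inverse qq * qq powi h"
  by (simp_all add: power_int_add power_int_diff field_simps)

text \<open>The rescaling is compatible with every tile: by conservation of height nothing changes
  on the right of it, and on the left at most a common sign does. The remaining scalars are
  collected in a unit.\<close>

lemma det_state_scaled_step:
  assumes st: "det_state (L1 @ tile_bot t @ L2) v rs K (scaled 0 (L1 @ tile_bot t @ L2) (C1 @ Ct @ C2)) c"
    and ok: "tile_ok t" and c: "q_unit c"
    and len: "length C1 = length L1" "length Ct = length (tile_bot t)" "length C2 = length L2"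
    and zero: "\<forall>x\<in>set (K @ C1 @ C2). x k = 0"
  shows "\<exists>c'. q_unit c' \<and> det_state (L1 @ tile_top t @ L2) (slice_map (length L1, t) v)
    (if is_cup t then rs @ [k] else rs) (if is_cap t then K @ [\<lambda>r. (Ct ! 0) r + (Ct ! 1) r] else K)
    (scaled 0 (L1 @ tile_top t @ L2) (C1 @ column_step k t Ct @ C2)) c'"
proof -
  define h where "h = sum_list (map height L1)"
  define m where "m = downs L2"
  define S1 where "S1 = map (\<lambda>x r. (- 1) ^ downs (tile_bot t @ L2) * x r) (scaled 0 L1 C1)"
  define S2 where "S2 = scaled (h + sum_list (map height (tile_bot t))) L2 C2"
  have lS: "length S1 = length L1" "length S2 = length L2" using len by (simp_all add: S1_def S2_def)
  have split: "scaled 0 (L1 @ M @ L2) (C1 @ CM @ C2) =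
      map (\<lambda>x r. (- 1) ^ downs (M @ L2) * x r) (scaled 0 L1 C1) @
      map (\<lambda>x r. (- 1) ^ m * x r) (scaled h M CM) @ S2"
    if "length CM = length M" "sum_list (map height M) = sum_list (map height (tile_bot t))" for M CM
    using len that by (simp add: scaled_append h_def m_def S2_def add.assoc)
  have same: "scaled 0 (L1 @ M @ L2) (C1 @ CM @ C2) =
      S1 @ map (\<lambda>x r. (- 1) ^ m * x r) (scaled h M CM) @ S2"
    if "length CM = length M" "sum_list (map height M) = sum_list (map height (tile_bot t))"
      "downs M = downs (tile_bot t)" for M CM
    unfolding split[OF that(1,2)] using that(3) by (simp add: S1_def)
  \<comment> \<open>An \<alpha>-cup creates and an \<alpha>-cap destroys one downward strand. The
    sign that both force on the columns to the left is therefore the one built into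
    \<open>scales\<close>.\<close>
  have flip: "scaled 0 (L1 @ M @ L2) (C1 @ CM @ C2) =
      neg_columns S1 @ map (\<lambda>x r. (- 1) ^ m * x r) (scaled h M CM) @ S2"
    if "length CM = length M" "sum_list (map height M) = sum_list (map height (tile_bot t))"
      "downs M + downs (tile_bot t) = 1" for M CM
  proof -
    have "(- 1) ^ downs M = (- 1::ratfun) * (- 1) ^ downs (tile_bot t)"
      using that(3) by (cases "downs (tile_bot t)") auto
    then show ?thesis
      unfolding split[OF that(1,2)] by (simp add: S1_def power_add)
  qed
  have st': "det_state (L1 @ tile_bot t @ L2) v rs K
      (S1 @ map (\<lambda>x r. (- 1) ^ m * x r) (scaled h (tile_bot t) Ct) @ S2) c"
    using st by (simp add: same len)
  have pair: "\<exists>x y. Ct = [x, y]" if "length (tile_bot t) = 2"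
    using len(2) that by (auto simp: length_Suc_conv numeral_2_eq_2)
  let ?D = "det_state (L1 @ tile_top t @ L2) (slice_map (length L1, t) v)"
  let ?S' = "scaled 0 (L1 @ tile_top t @ L2) (C1 @ column_step k t Ct @ C2)"
  let ?q = "(- 1) ^ m * qq powi h"
  let ?mid = "map (\<lambda>x r. (- 1) ^ m * x r) (scaled h (tile_top t) (column_step k t Ct))"
  have tgt: "?S' = S1 @ ?mid @ S2"
    if "downs (tile_top t) = downs (tile_bot t)" "length (column_step k t Ct) = length (tile_top t)"
    using that by (intro same) (simp_all add: sum_height_top)
  have tgt': "?S' = neg_columns S1 @ ?mid @ S2"
    if "downs (tile_top t) + downs (tile_bot t) = 1" "length (column_step k t Ct) = length (tile_top t)"
    using that by (intro flip) (simp_all add: sum_height_top)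
  show ?thesis
  proof (cases t)
    case (Cross s)
    then obtain x y where Ct: "Ct = [x, y]" using pair by auto
    have nc: "\<not> is_cup t" "\<not> is_cap t" using Cross by (auto simp: is_cup_def is_cap_def)
    have tgtC: "?S' = S1 @ ?mid @ S2"
      by (rule tgt) (cases s; simp add: Cross Ct)+
    show ?thesis
    proof (cases s)
      case Pos
      \<comment> \<open>The columns before the tile are \<open>?q * x\<close> and
        \<open>?q * qq * y\<close>, the right strand lying one step higher. The other coefficients
        are the weights in \<open>cross_map Pos\<close> divided by the weight
        \<open>inverse qq\<close> of the empty pair.\<close>
      have "?D rs K
        (S1 @ [\<lambda>r. (1 - qq powi 2) * (?q * x r) + qq * (?q * qq * y r),
               \<lambda>r. qq * (?q * x r) + 0 * (?q * qq * y r)] @ S2) (c * inverse qq)"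
        by (rule det_state_free_fermion[OF _ ok])
          (use st' Cross Pos Ct lS in \<open>simp_all add: qq_shift mult_ac power2_eq_square field_simps\<close>)
      also have "[\<lambda>r. (1 - qq powi 2) * (?q * x r) + qq * (?q * qq * y r),
               \<lambda>r. qq * (?q * x r) + 0 * (?q * qq * y r)] = ?mid"
        using Cross Pos Ct by (simp add: qq_shift power2_eq_square algebra_simps)
      finally show ?thesis unfolding tgtC using c nc by (auto intro!: exI[of _ "c * inverse qq"] q_unit_mult q_unit_inverse)
    next
      case Neg
      have w: "qq - inverse qq = qq * (1 - qq powi (- 2))"
        by (simp add: power_int_minus field_simps power2_eq_square)
      have w': "qq * (inverse qq * inverse qq) = inverse qq" by (simp add: mult.assoc[symmetric])
      have "?D rs K
        (S1 @ [\<lambda>r. 0 * (?q * x r) + inverse qq * (?q * qq * y r),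
               \<lambda>r. inverse qq * (?q * x r) + (1 - qq powi (- 2)) * (?q * qq * y r)] @ S2) (c * qq)"
        by (rule det_state_free_fermion[OF _ ok])
          (use st' Cross Neg Ct lS in \<open>simp_all add: qq_shift mult_ac w w'\<close>)
      also have "[\<lambda>r. 0 * (?q * x r) + inverse qq * (?q * qq * y r),
               \<lambda>r. inverse qq * (?q * x r) + (1 - qq powi (- 2)) * (?q * qq * y r)] = ?mid"
        using Cross Neg Ct by (simp add: qq_shift power2_eq_square field_simps power_int_minus)
      finally show ?thesis unfolding tgtC using c nc by (auto intro!: exI[of _ "c * qq"] q_unit_mult)
    qed
  next
    case (Virt a b)
    then obtain x y where Ct: "Ct = [x, y]" using pair by auto
    have nc: "\<not> is_cup t" "\<not> is_cap t" using Virt by (auto simp: is_cup_def is_cap_def)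
    have tgtV: "?S' = S1 @ ?mid @ S2"
      by (rule tgt) (simp_all add: Virt Ct)
    show ?thesis
    proof (cases "fst a = Alpha \<and> fst b = Alpha")
      case True
      then have ab: "a = (Alpha, Up)" "b = (Alpha, Up)" using ok Virt by (cases a; cases b; simp)+
      \<comment> \<open>The weights \<open>qq\<close> and \<open>inverse qq\<close> of the virtual
        crossing are undone by the difference of heights: the rescaled columns are simply
        exchanged.\<close>
      have "?D rs K
        (S1 @ [\<lambda>r. 0 * (?q * x r) + inverse qq * (?q * qq * y r),
               \<lambda>r. qq * (?q * x r) + 0 * (?q * qq * y r)] @ S2) (c * 1)"
        by (rule det_state_free_fermion[OF _ ok])
          (use st' Virt ab Ct lS in \<open>simp_all add: qq_shift mult_ac\<close>)
      also have "[\<lambda>r. 0 * (?q * x r) + inverse qq * (?q * qq * y r),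
               \<lambda>r. qq * (?q * x r) + 0 * (?q * qq * y r)] = ?mid"
        using Virt ab Ct by (simp add: qq_shift field_simps)
      finally show ?thesis unfolding tgtV using c nc by auto
    next
      case False
      let ?S = "map (\<lambda>x r. (- 1) ^ m * x r) (scaled h [a, b] [x, y])"
      have "?D rs K
        (S1 @ [\<lambda>r. 1 * (?S ! 1) r, \<lambda>r. 1 * (?S ! 0) r] @ S2) c"
        by (rule det_state_past_coloured[OF _ ok, where s = a and s' = b])
          (use st' Virt False Ct lS in \<open>auto\<close>)
      also have "[\<lambda>r. 1 * (?S ! 1) r, \<lambda>r. 1 * (?S ! 0) r] = ?mid"
        using False by (cases a rule: height.cases; cases b rule: height.cases) (simp_all add: Virt Ct)
      finally show ?thesis unfolding tgtV using c nc by auto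
    qed
  next
    case (Pass z d l)
    then obtain x y where Ct: "Ct = [x, y]" using pair by (cases l) auto
    have nc: "\<not> is_cup t" "\<not> is_cap t" using Pass by (auto simp: is_cup_def is_cap_def)
    obtain a b where ab: "tile_bot t = [a, b]" "tile_top t = [b, a]" "fst a \<noteq> Alpha \<or> fst b \<noteq> Alpha"
      using Pass by (cases l) auto
    have tgtP: "?S' = S1 @ ?mid @ S2"
      by (rule tgt) (simp_all add: Pass Ct)
    let ?\<phi> = "pass_factor z (pass_sign d l) E2"
    let ?S = "map (\<lambda>x r. (- 1) ^ m * x r) (scaled h [a, b] [x, y])"
    have "?D rs K
      (S1 @ [\<lambda>r. ?\<phi> * (?S ! 1) r, \<lambda>r. ?\<phi> * (?S ! 0) r] @ S2) c"
    proof (rule det_state_past_coloured[OF _ ok ab])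
      fix p q assume "p \<in> basis_of a" "q \<in> basis_of b"
      then show "tile_map t [p, q] =
          Poly_Mapping.single [q, p] (if occupied a p \<or> occupied b q then ?\<phi> else 1)"
        using ab(1) Pass by (cases l) (auto simp: pass_factor_def)
    qed (use st' ab Ct lS in auto)
    also have "[\<lambda>r. ?\<phi> * (?S ! 1) r, \<lambda>r. ?\<phi> * (?S ! 0) r] = ?mid"
      using ab Pass Ct by (cases l) (auto simp: mult_ac)
    finally show ?thesis unfolding tgtP using c nc by auto
  next
    case (Cup col d)
    have Ct: "Ct = []" using len(2) Cup by simp
    have z: "x k = 0" if "x \<in> set (K @ S1 @ S2)" for x
      using that zero by (auto simp: S1_def S2_def dest!: set_scaled_zero[where r = k])
    show ?thesis
    proof (cases col)
      case (Om w)
      have nc: "\<not> is_cup t" "\<not> is_cap t" using Cup Om by (auto simp: is_cup_def is_cap_def)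
      have tgtC: "?S' = S1 @ ?mid @ S2"
        by (rule tgt) (simp_all add: Cup Om Ct)
      have "?D rs K (S1 @ ?mid @ S2) c"
        by (rule det_state_coloured_cup) (use st' lS in \<open>simp_all add: Cup Om Ct\<close>)
      then show ?thesis unfolding tgtC using c nc by auto
    next
      case Alpha
      have nc: "is_cup t" "\<not> is_cap t" using Cup Alpha by (auto simp: is_cup_def is_cap_def)
      have tgtC: "?S' = neg_columns S1 @ ?mid @ S2"
        by (rule tgt') (cases d; simp add: Cup Alpha Ct)+
      define \<nu> where "\<nu> = (- 1) ^ m * qq powi (if d = Up then h else h - 1)"
      define e where "e = (\<lambda>r. if r = k then \<nu> else 0)"
      let ?c' = "(- 1) ^ (length rs + length K) * (c * (if d = Up then 1 else inverse qq) / \<nu>)"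
      have \<nu>: "q_unit \<nu>" by (simp add: \<nu>_def q_unit_mult)
      have "?D (rs @ [k]) K
        (neg_columns S1 @ (if d = Up then [e, e] else [e, \<lambda>r. - e r]) @ S2) ?c'"
        by (rule det_state_cup[OF _ _ lS z])
          (use st' q_unit_nonzero[OF \<nu>] in \<open>simp_all add: Cup Alpha Ct e_def\<close>)
      also have "(if d = Up then [e, e] else [e, \<lambda>r. - e r]) = ?mid"
        by (cases d) (auto simp: Cup Alpha Ct e_def \<nu>_def qq_shift)
      finally have "?D (rs @ [k]) K
        (neg_columns S1 @ ?mid @ S2) ?c'" .
      moreover have "q_unit ?c'"
        unfolding divide_inverse using c \<nu> by (auto intro!: q_unit_mult q_unit_inverse)
      ultimately show ?thesis unfolding tgtC using nc by auto
    qed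
  next
    case (Cap col d)
    then obtain x y where Ct: "Ct = [x, y]" using pair by auto
    show ?thesis
    proof (cases col)
      case (Om w)
      have nc: "\<not> is_cup t" "\<not> is_cap t" using Cap Om by (auto simp: is_cup_def is_cap_def)
      have tgtC: "?S' = S1 @ ?mid @ S2"
        by (rule tgt) (simp_all add: Cap Om Ct)
      have "?D rs K (S1 @ S2) c"
        by (rule det_state_coloured_cap[where t = t]) (use st' lS in \<open>auto simp: Cap Om Ct\<close>)
      then show ?thesis unfolding tgtC using c nc by (auto simp: Cap Om)
    next
      case Alpha
      have nc: "\<not> is_cup t" "is_cap t" using Cap Alpha by (auto simp: is_cup_def is_cap_def)
      have tgtC: "?S' = neg_columns S1 @ ?mid @ S2"
        by (rule tgt') (cases d; simp add: Cap Alpha Ct)+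
      define \<mu> where "\<mu> = (- 1) ^ m * qq powi (if d = Up then h else h - 1)"
      have \<mu>: "q_unit \<mu>" by (simp add: \<mu>_def q_unit_mult)
      let ?S = "map (\<lambda>x r. (- 1) ^ m * x r) (scaled h (tile_bot t) [x, y])"
      have S: "?S = [?S ! 0, ?S ! 1]" by (simp add: Cap Alpha)
      have "?D rs (K @ [\<lambda>r. x r + y r])
        (neg_columns S1 @ S2) (c * (if d = Up then qq else 1) * \<mu>)"
      proof (rule det_state_cap[OF _ _ lS q_unit_nonzero[OF \<mu>]])
        show "det_state (L1 @ tile_bot t @ L2) v rs K (S1 @ [?S ! 0, ?S ! 1] @ S2) c"
          using st' unfolding Ct S[symmetric] .
        show "t = Cap Alpha d" by (simp add: Cap Alpha)
        \<comment> \<open>The relative sign of the two ends in \<open>scales\<close> turns both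
          contractions into the sum \<open>x + y\<close>.\<close>
        show "(if d = Up then (?S ! 1) r - (?S ! 0) r else (?S ! 0) r + (?S ! 1) r) = \<mu> * (x r + y r)" for r
          by (cases d) (auto simp: Cap Alpha \<mu>_def qq_shift algebra_simps)
      qed
      moreover have "q_unit (c * (if d = Up then qq else 1) * \<mu>)"
        using c \<mu> by (auto intro!: q_unit_mult)
      ultimately show ?thesis unfolding tgtC using nc by (auto simp: Cap Alpha Ct)
    qed
  qed
qed


section \<open>The state at each level of a closed diagram\<close>

lemma tangle_level:
  assumes "tangle L w L'"
  shows "k < length w \<Longrightarrow> fits (w ! k) (level L w k)" "level L w (length w) = L'"
proof -
  have "(\<forall>k<length w. fits (w ! k) (level L w k)) \<and> level L w (length w) = L'"
    using assms
  proof (induction w arbitrary: L)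
    case (Cons s w)
    have step: "level L (s # w) (Suc k) = level (slice_step s L) w k" for k
      by (simp add: level_def)
    show ?case
    proof (intro conjI allI impI)
      fix k assume "k < length (s # w)"
      then show "fits ((s # w) ! k) (level L (s # w) k)"
        using Cons by (cases k) (auto simp: step level_def[of _ _ 0])
    next
      show "level L (s # w) (length (s # w)) = L'"
        using Cons by (simp add: step)
    qed
  qed (simp add: level_def)
  then show "k < length w \<Longrightarrow> fits (w ! k) (level L w k)" "level L w (length w) = L'" by auto
qed

lemma level_Suc: "k < length w \<Longrightarrow> level L w (Suc k) = slice_step (w ! k) (level L w k)"
  by (simp add: level_def take_Suc_conv_app_nth)

lemma fitsE:
  assumes "fits (i, t) L"
  obtains L1 L2 where "L = L1 @ tile_bot t @ L2" "i = length L1" "slice_step (i, t) L = L1 @ tile_top t @ L2"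
    "tile_ok t"
proof -
  let ?m = "length (tile_bot t)"
  have "take ?m (drop i L) = tile_bot t" using assms by (simp add: fits_def)
  then have L: "L = take i L @ tile_bot t @ drop (i + ?m) L"
    by (metis append_take_drop_id drop_drop add.commute)
  have "i = length (take i L)" using assms by (simp add: fits_def)
  then show ?thesis using that[OF L] assms by (simp add: slice_step_def fits_def)
qed

lemma slice_split:
  assumes "tangle [] w L'" "k < length w" "w ! k = (i, t)"
  obtains L1 L2 where "level [] w k = L1 @ tile_bot t @ L2" "level [] w (Suc k) = L1 @ tile_top t @ L2"
    "i = length L1" "tile_ok t"
proof -
  have "fits (i, t) (level [] w k)" using tangle_level(1)[OF assms(1,2)] assms(3) by simp
  then show ?thesis
    using that level_Suc[OF assms(2), of "[]"] assms(3) by (elim fitsE) auto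
qed

fun next_columns :: "nat \<Rightarrow> slice \<Rightarrow> (nat \<Rightarrow> ratfun) list \<Rightarrow> (nat \<Rightarrow> ratfun) list" where
  "next_columns k (i, t) C =
    take i C @ column_step k t (take (length (tile_bot t)) (drop i C)) @ drop (i + length (tile_bot t)) C"

primrec columns :: "slice list \<Rightarrow> nat \<Rightarrow> (nat \<Rightarrow> ratfun) list" where
  "columns w 0 = []"
| "columns w (Suc k) = next_columns k (w ! k) (columns w k)"

text \<open>Names for the rows of the final determinant; \<open>cap_slices\<close> provides those of
  its columns.\<close>

definition cup_slices :: "slice list \<Rightarrow> nat \<Rightarrow> nat list" where
  "cup_slices w k = filter (\<lambda>j. is_cup (snd (w ! j))) [0..<k]"

definition cap_slices :: "slice list \<Rightarrow> nat \<Rightarrow> nat list" where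
  "cap_slices w k = filter (\<lambda>j. is_cap (snd (w ! j))) [0..<k]"

definition cap_column :: "slice list \<Rightarrow> nat \<Rightarrow> nat \<Rightarrow> ratfun" where
  "cap_column w j = (\<lambda>r. (columns w j ! fst (w ! j)) r + (columns w j ! Suc (fst (w ! j))) r)"

lemma column_step_properties:
  assumes "length Ct = length (tile_bot t)"
  shows "length (column_step k t Ct) = length (tile_top t)"
    and "\<forall>y\<in>set Ct. y r = 0 \<Longrightarrow> k < r \<Longrightarrow> \<forall>x\<in>set (column_step k t Ct). x r = 0"
proof -
  have pair: "\<exists>x y. Ct = [x, y]" if "length (tile_bot t) = 2"
    using assms that by (auto simp: length_Suc_conv numeral_2_eq_2)
  have "length (column_step k t Ct) = length (tile_top t) \<and>
    ((\<forall>y\<in>set Ct. y r = 0) \<longrightarrow> k < r \<longrightarrow> (\<forall>x\<in>set (column_step k t Ct). x r = 0))"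
  proof (cases t)
    case (Cross s)
    then show ?thesis using pair by (cases s) auto
  next
    case (Cup c d)
    then show ?thesis using assms by auto
  next
    case (Cap c d)
    then show ?thesis using pair by auto
  qed (use pair in auto)
  then show "length (column_step k t Ct) = length (tile_top t)"
    and "\<forall>y\<in>set Ct. y r = 0 \<Longrightarrow> k < r \<Longrightarrow> \<forall>x\<in>set (column_step k t Ct). x r = 0" by auto
qed

text \<open>Row \<open>r\<close> is born at the cup in slice \<open>r\<close>, so a column of level
  \<open>k\<close> is supported on earlier rows. The expansion along the row of the next cup needs
  this.\<close>

lemma columns_level:
  assumes "tangle [] w L'" "k \<le> length w"
  shows "length (columns w k) = length (level [] w k) \<and> (\<forall>x\<in>set (columns w k). \<forall>r\<ge>k. x r = 0)"
  using assms(2)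
proof (induction k)
  case 0
  then show ?case by (simp add: level_def)
next
  case (Suc k)
  let ?C = "columns w k"
  have len: "length ?C = length (level [] w k)" and z: "\<forall>x\<in>set ?C. \<forall>r\<ge>k. x r = 0"
    using Suc by auto
  obtain i t where wk: "w ! k = (i, t)" by fastforce
  have "k < length w" using Suc.prems by simp
  then obtain L1 L2 where L: "level [] w k = L1 @ tile_bot t @ L2" "i = length L1"
      "level [] w (Suc k) = L1 @ tile_top t @ L2" "tile_ok t"
    using slice_split[OF assms(1) _ wk] by metis
  let ?Ct = "take (length (tile_bot t)) (drop i ?C)"
  have lC: "length ?Ct = length (tile_bot t)" using len L by simp
  have "\<forall>y\<in>set ?Ct. y r = 0" if "r \<ge> k" for r
    using z that by (meson in_set_dropD in_set_takeD)
  then have "\<forall>x\<in>set (column_step k t ?Ct). \<forall>r\<ge>Suc k. x r = 0"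
    using column_step_properties(2)[OF lC] by (metis Suc_le_eq less_imp_le)
  moreover have "\<forall>x\<in>set (take i ?C) \<union> set (drop (i + length (tile_bot t)) ?C). \<forall>r\<ge>Suc k. x r = 0"
    using z by (meson UnE Suc_leD in_set_dropD in_set_takeD)
  ultimately show ?case
    using len L wk column_step_properties(1)[OF lC] by auto
qed

lemma det_state_level:
  assumes "tangle [] w L'" "k \<le> length w"
  shows "\<exists>c. q_unit c \<and> det_state (level [] w k) (fold slice_map (take k w) (Poly_Mapping.single [] 1))
    (cup_slices w k) (map (cap_column w) (cap_slices w k)) (scaled 0 (level [] w k) (columns w k)) c"
  using assms(2)
proof (induction k)
  case 0
  have "det_state [] (Poly_Mapping.single [] 1) [] [] [] 1"
    by (auto simp: det_state_def coefficient_def lookup_single col_det_def list_det_def when_def)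
  then show ?case by (auto simp: level_def cup_slices_def cap_slices_def intro!: exI[of _ 1])
next
  case (Suc k)
  let ?C = "columns w k" and ?K = "map (cap_column w) (cap_slices w k)"
  obtain c where c: "q_unit c" and st: "det_state (level [] w k)
      (fold slice_map (take k w) (Poly_Mapping.single [] 1))
      (cup_slices w k) ?K (scaled 0 (level [] w k) ?C) c"
    using Suc by auto
  have len: "length ?C = length (level [] w k)" and z: "\<forall>x\<in>set ?C. \<forall>r\<ge>k. x r = 0"
    using columns_level[OF assms(1), of k] Suc.prems by auto
  obtain i t where wk: "w ! k = (i, t)" by fastforce
  have "k < length w" using Suc.prems by simp
  then obtain L1 L2 where L: "level [] w k = L1 @ tile_bot t @ L2" "i = length L1"
      "level [] w (Suc k) = L1 @ tile_top t @ L2" "tile_ok t"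
    using slice_split[OF assms(1) _ wk] by metis
  let ?m = "length (tile_bot t)"
  define C1 Ct C2 where "C1 = take i ?C" and "Ct = take ?m (drop i ?C)" and "C2 = drop (i + ?m) ?C"
  have C: "?C = C1 @ Ct @ C2"
    unfolding C1_def Ct_def C2_def by (metis append_take_drop_id drop_drop add.commute)
  have lC: "length C1 = length L1" "length Ct = length (tile_bot t)" "length C2 = length L2"
    using len L by (simp_all add: C1_def Ct_def C2_def)
  have next_C: "columns w (Suc k) = C1 @ column_step k t Ct @ C2"
    by (simp add: wk C1_def Ct_def C2_def)
  \<comment> \<open>The column of a cap in slice \<open>j\<close> is made of columns of level
    \<open>j\<close>, so it vanishes on all rows from \<open>j\<close> on.\<close>
  have "x k = 0" if x: "x \<in> set ?K" for x
  proof -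
    obtain j where j: "j < k" "is_cap (snd (w ! j))" "x = cap_column w j"
      using x by (auto simp: cap_slices_def)
    obtain i' d where wj: "w ! j = (i', Cap Alpha d)" using j(2) by (cases "w ! j") (auto simp: is_cap_def)
    have "j < length w" using Suc.prems j(1) by simp
    then obtain M1 M2 where M: "level [] w j = M1 @ tile_bot (Cap Alpha d) @ M2" "i' = length M1"
      using slice_split[OF assms(1) _ wj] by metis
    have cj: "length (columns w j) = length (level [] w j)" "\<forall>x\<in>set (columns w j). \<forall>r\<ge>j. x r = 0"
      using columns_level[OF assms(1), of j] Suc.prems j(1) by auto
    have "columns w j ! i' \<in> set (columns w j)" "columns w j ! Suc i' \<in> set (columns w j)"
      using cj(1) M by simp_all
    then have "(columns w j ! i') k = 0" "(columns w j ! Suc i') k = 0"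
      using cj(2) less_imp_le[OF j(1)] by blast+
    then show ?thesis using wj by (simp add: j(3) cap_column_def)
  qed
  then have zero: "\<forall>x\<in>set (?K @ C1 @ C2). x k = 0"
    using z C by auto
  obtain c' where c': "q_unit c'" "det_state (L1 @ tile_top t @ L2)
      (slice_map (length L1, t) (fold slice_map (take k w) (Poly_Mapping.single [] 1)))
      (if is_cup t then cup_slices w k @ [k] else cup_slices w k)
      (if is_cap t then ?K @ [\<lambda>r. (Ct ! 0) r + (Ct ! 1) r] else ?K)
      (scaled 0 (L1 @ tile_top t @ L2) (C1 @ column_step k t Ct @ C2)) c'"
    using det_state_scaled_step[OF st[unfolded L(1) C] L(4) c lC, where k = k, OF zero] by blast
  have "cap_column w k = (\<lambda>r. (Ct ! 0) r + (Ct ! 1) r)" if "is_cap t"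
    using that lC len L by (auto simp: cap_column_def C wk nth_append is_cap_def)
  then have "(if is_cap t then ?K @ [\<lambda>r. (Ct ! 0) r + (Ct ! 1) r] else ?K) =
      map (cap_column w) (cap_slices w (Suc k))"
    by (simp add: cap_slices_def wk)
  moreover have "(if is_cup t then cup_slices w k @ [k] else cup_slices w k) = cup_slices w (Suc k)"
    by (simp add: cup_slices_def wk)
  moreover have "fold slice_map (take (Suc k) w) v = slice_map (length L1, t) (fold slice_map (take k w) v)" for v
    using Suc.prems wk L(2) by (simp add: take_Suc_conv_app_nth)
  ultimately show ?case
    unfolding next_C L(3) using c' by auto
qed

text \<open>An \<alpha>-cup adds two \<alpha>-strands, an \<alpha>-cap removes two, and other tiles
  keep their number. At the top level this makes the final matrix square.\<close>

lemma length_cup_cap_slices: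
  assumes "tangle [] w L'" "k \<le> length w"
  shows "length (filter (\<lambda>s. fst s = Alpha) (level [] w k)) + 2 * length (cap_slices w k) =
    2 * length (cup_slices w k)"
  using assms(2)
proof (induction k)
  case 0
  then show ?case by (simp add: level_def cup_slices_def cap_slices_def)
next
  case (Suc k)
  obtain i t where wk: "w ! k = (i, t)" by fastforce
  have "k < length w" using Suc.prems by simp
  then obtain L1 L2 where L: "level [] w k = L1 @ tile_bot t @ L2" "i = length L1"
      "level [] w (Suc k) = L1 @ tile_top t @ L2" "tile_ok t"
    using slice_split[OF assms(1) _ wk] by metis
  have "length (filter (\<lambda>s. fst s = Alpha) (tile_top t)) + (if is_cap t then 2 else 0) =
      length (filter (\<lambda>s. fst s = Alpha) (tile_bot t)) + (if is_cup t then 2 else 0)"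
    by (cases t) (auto simp: is_cup_def is_cap_def)
  then show ?case
    using Suc L by (auto simp: cup_slices_def cap_slices_def wk split: if_splits)
qed

text \<open>No strand is left at the top level, so the empty word is the only basis element and the
  full determinant the only minor.\<close>

theorem prismatic_value_col_det:
  assumes "tangle [] w []"
  shows "\<exists>c. q_unit c \<and> prismatic_value w =
    c * col_det (cup_slices w (length w)) (map (cap_column w) (cap_slices w (length w)))"
    and "length (cap_slices w (length w)) = length (cup_slices w (length w))"
proof -
  have end_level: "level [] w (length w) = []" using tangle_level(2)[OF assms] .
  show len: "length (cap_slices w (length w)) = length (cup_slices w (length w))"
    using length_cup_cap_slices[OF assms, of "length w"] end_level by simp
  obtain c where "q_unit c" "det_state [] (fold slice_map w (Poly_Mapping.single [] 1))
      (cup_slices w (length w)) (map (cap_column w) (cap_slices w (length w))) [] c"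
    using det_state_level[OF assms, of "length w"] end_level by auto
  then show "\<exists>c. q_unit c \<and> prismatic_value w =
    c * col_det (cup_slices w (length w)) (map (cap_column w) (cap_slices w (length w)))"
    using len by (auto simp: prismatic_value_def det_state_def coefficient_def)
qed

section \<open>Tracing the strands\<close>

locale closed_diagram =
  fixes w :: "slice list"
  assumes closed: "tangle [] w []"
begin

abbreviation "lev \<equiv> level [] w"
abbreviation "nx \<equiv> next_point [] id w"

definition strand_at :: "point \<Rightarrow> strand" where "strand_at p = lev (fst p) ! snd p"

abbreviation "up p \<equiv> snd (strand_at p) = Up"

definition alpha_points :: "point list" where
  "alpha_points = filter (\<lambda>p. fst (strand_at p) = Alpha) (points [] w)"

text \<open>With \<open>down_move\<close>, the two branches of \<open>next_point\<close> as motions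
  that ignore the orientation. Passing through a slice is undone by the opposite motion, turning at
  a cap or cup by the same one; the injectivity of \<open>nx\<close> rests on this.\<close>

fun up_move :: "point \<Rightarrow> point" where
  "up_move (k, j) =
    (let (i, t) = w ! k; b = length (tile_bot t); a = length (tile_top t) in
       if j < i then (k + 1, j)
       else if i + b \<le> j then (k + 1, j - b + a)
       else (if a = 0 then k else k + 1, i + 1 - (j - i)))"

fun down_move :: "point \<Rightarrow> point" where
  "down_move (k, j) =
    (let (i, t) = w ! (k - 1); b = length (tile_bot t); a = length (tile_top t) in
       if j < i then (k - 1, j)
       else if i + a \<le> j then (k - 1, j - a + b)
       else (if b = 0 then k else k - 1, i + 1 - (j - i)))"

lemma lev_0 [simp]: "lev 0 = []"
  by (simp add: level_def)

lemma lev_end [simp]: "lev (length w) = []"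
  using tangle_level(2)[OF closed] .

definition is_point :: "point \<Rightarrow> bool" where
  "is_point p \<longleftrightarrow> fst p \<le> length w \<and> snd p < length (lev (fst p))"

lemma set_points: "set (points [] w) = {p. is_point p}"
  unfolding points_def is_point_def by (auto simp: image_iff less_Suc_eq_le simp del: upt_Suc)

lemma distinct_points: "distinct (points [] w)"
proof -
  have "distinct (concat (map (\<lambda>k. map (Pair k) [0..<length (lev k)]) ks))" if "distinct ks" for ks
    using that by (induction ks) (auto simp: distinct_map inj_on_def)
  then show ?thesis unfolding points_def by (simp del: upt_Suc)
qed

lemmas slice_split = slice_split[OF closed]

lemma pair_index: "i \<le> j \<Longrightarrow> j < i + 2 \<Longrightarrow> j = i \<or> j = Suc (i::nat)"
  by auto

lemma tile_lengths:
  "length (tile_bot t) = 2 \<and> length (tile_top t) = 2 \<and> tile_top t = rev (tile_bot t) \<or>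
   (\<exists>c d. t = Cup c d) \<or> (\<exists>c d. t = Cap c d)"
  by (cases t) auto

lemma up_move:
  assumes "k < length w" "j < length (lev k)" "w ! k = (i, t)"
  shows "(\<exists>j'. up_move (k, j) = (Suc k, j') \<and> j' < length (lev (Suc k)) \<and> lev (Suc k) ! j' = lev k ! j \<and>
      down_move (Suc k, j') = (k, j)) \<or>
    (\<exists>c d. t = Cap c d \<and> (j = i \<and> up_move (k, j) = (k, Suc i) \<or> j = Suc i \<and> up_move (k, j) = (k, i)) \<and>
      Suc i < length (lev k) \<and> lev k ! i = (c, d) \<and> lev k ! Suc i = (c, opp d))"
proof -
  obtain L1 L2 where L: "lev k = L1 @ tile_bot t @ L2" "lev (Suc k) = L1 @ tile_top t @ L2"
    "i = length L1" using slice_split[OF assms(1,3)] by metis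
  consider "j < i" | "i + length (tile_bot t) \<le> j" | "i \<le> j" "j < i + length (tile_bot t)" by linarith
  then show ?thesis
  proof cases
    case 1
    then show ?thesis using L assms by (auto simp: nth_append)
  next
    case 2
    then obtain m where "j = i + length (tile_bot t) + m" using le_Suc_ex by blast
    then show ?thesis using L assms by (auto simp: nth_append Let_def)
  next
    case 3
    from tile_lengths[of t] consider
      "length (tile_bot t) = 2" "length (tile_top t) = 2" "tile_top t = rev (tile_bot t)" |
      c d where "t = Cup c d" | c d where "t = Cap c d" by blast
    then show ?thesis
    proof cases
      case a: 1
      obtain x y where xy: "tile_bot t = [x, y]" using a(1) by (auto simp: length_Suc_conv numeral_2_eq_2)
      then show ?thesis using 3 a L assms pair_index[of i j]
        by (auto simp: nth_append)
    next
      case b: 2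
      then show ?thesis using 3 by simp
    next
      case c: 3
      then show ?thesis using 3 L assms pair_index[of i j] by (auto simp: nth_append)
    qed
  qed
qed

lemma down_move:
  assumes "k < length w" "j < length (lev (Suc k))" "w ! k = (i, t)"
  shows "(\<exists>j'. down_move (Suc k, j) = (k, j') \<and> j' < length (lev k) \<and> lev k ! j' = lev (Suc k) ! j \<and>
      up_move (k, j') = (Suc k, j)) \<or>
    (\<exists>c d. t = Cup c d \<and> (j = i \<and> down_move (Suc k, j) = (Suc k, Suc i) \<or>
        j = Suc i \<and> down_move (Suc k, j) = (Suc k, i)) \<and>
      Suc i < length (lev (Suc k)) \<and> lev (Suc k) ! i = (c, d) \<and> lev (Suc k) ! Suc i = (c, opp d))"
proof -
  obtain L1 L2 where L: "lev k = L1 @ tile_bot t @ L2" "lev (Suc k) = L1 @ tile_top t @ L2"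
    "i = length L1" using slice_split[OF assms(1,3)] by metis
  consider "j < i" | "i + length (tile_top t) \<le> j" | "i \<le> j" "j < i + length (tile_top t)" by linarith
  then show ?thesis
  proof cases
    case 1
    then show ?thesis using L assms by (auto simp: nth_append)
  next
    case 2
    then obtain m where "j = i + length (tile_top t) + m" using le_Suc_ex by blast
    then show ?thesis using L assms by (auto simp: nth_append Let_def)
  next
    case 3
    from tile_lengths[of t] consider
      "length (tile_bot t) = 2" "length (tile_top t) = 2" "tile_top t = rev (tile_bot t)" |
      c d where "t = Cup c d" | c d where "t = Cap c d" by blast
    then show ?thesis
    proof cases
      case a: 1
      obtain x y where xy: "tile_bot t = [x, y]" using a(1) by (auto simp: length_Suc_conv numeral_2_eq_2)
      then show ?thesis using 3 a L assms pair_index[of i j]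
        by (auto simp: nth_append)
    next
      case b: 2
      then show ?thesis using 3 L assms pair_index[of i j] by (auto simp: nth_append)
    next
      case c: 3
      then show ?thesis using 3 by simp
    qed
  qed
qed

lemma nx_up: "up p \<Longrightarrow> nx p = up_move p"
  by (cases p) (simp add: strand_at_def)

lemma nx_down: "\<not> up p \<Longrightarrow> is_point p \<Longrightarrow> nx p = down_move p"
  by (cases p; cases "snd (strand_at p)"; cases "fst p") (auto simp: strand_at_def is_point_def)

definition prev_point :: "point \<Rightarrow> point" where
  "prev_point p = (if up p then down_move p else up_move p)"

text \<open>The bottom and top levels are empty, so every point has a slice below and a slice above
  it.\<close>

lemma point_levels:
  assumes "is_point p"
  shows "fst p < length w" "\<exists>k. fst p = Suc k \<and> k < length w"
proof -
  have "lev (fst p) \<noteq> []" using assms by (auto simp: is_point_def)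
  then have "fst p \<noteq> length w" "fst p \<noteq> 0" by (metis lev_end, metis lev_0)
  then show "fst p < length w" "\<exists>k. fst p = Suc k \<and> k < length w"
    using assms by (cases "fst p"; auto simp: is_point_def)+
qed

text \<open>The two cases of each conclusion are motion through a slice and turning back at a cap or cup.\<close>

lemma nx_cases:
  assumes "is_point p"
  shows "is_point (nx p)" (is ?A) and "fst (strand_at (nx p)) = fst (strand_at p)" (is ?B)
    and "prev_point (nx p) = p" (is ?C)
    and "up p \<Longrightarrow> up (nx p) \<and> fst (nx p) = Suc (fst p) \<or>
      \<not> up (nx p) \<and> fst (nx p) = fst p \<and> (\<exists>i d. w ! fst p = (i, Cap (fst (strand_at p)) d) \<and>
         snd p = (if d = Up then i else Suc i) \<and> snd (nx p) = (if d = Up then Suc i else i))" (is "_ \<Longrightarrow> ?U")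
    and "\<not> up p \<Longrightarrow> \<not> up (nx p) \<and> fst p = Suc (fst (nx p)) \<or>
      up (nx p) \<and> fst (nx p) = fst p \<and> (\<exists>i d. w ! (fst p - 1) = (i, Cup (fst (strand_at p)) d) \<and>
         snd p = (if d = Up then Suc i else i) \<and> snd (nx p) = (if d = Up then i else Suc i))" (is "_ \<Longrightarrow> ?N")
proof -
  obtain k j where p: "p = (k, j)" by fastforce
  have pt: "k < length w" "j < length (lev k)" using point_levels(1)[OF assms] assms by (auto simp: p is_point_def)
  have "?A \<and> ?B \<and> ?C \<and> (up p \<longrightarrow> ?U) \<and> (\<not> up p \<longrightarrow> ?N)"
  proof (cases "up p")
    case True
    obtain i t where wk: "w ! k = (i, t)" by fastforce
    have nx: "nx p = up_move (k, j)" using nx_up[OF True] p by simp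
    from up_move[OF pt wk] show ?thesis
    proof (elim disjE exE conjE)
      fix j' assume "up_move (k, j) = (Suc k, j')" "j' < length (lev (Suc k))"
        "lev (Suc k) ! j' = lev k ! j" "down_move (Suc k, j') = (k, j)"
      then show ?thesis using True pt unfolding nx
        by (simp add: p strand_at_def is_point_def prev_point_def del: up_move.simps down_move.simps)
    next
      fix c d assume *: "t = Cap c d" "j = i" "up_move (k, j) = (k, Suc i)" "Suc i < length (lev k)"
        "lev k ! i = (c, d)" "lev k ! Suc i = (c, opp d)"
      moreover have "up_move (k, Suc i) = (k, i)" using wk *(1) by simp
      ultimately show ?thesis using True pt wk unfolding nx
        by (simp add: p strand_at_def is_point_def prev_point_def del: up_move.simps down_move.simps)
    next
      fix c d assume *: "t = Cap c d" "j = Suc i" "up_move (k, j) = (k, i)" "Suc i < length (lev k)"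
        "lev k ! i = (c, d)" "lev k ! Suc i = (c, opp d)"
      moreover have "up_move (k, i) = (k, Suc i)" using wk *(1) by simp
      ultimately show ?thesis using True pt wk unfolding nx
        by (cases d) (simp_all add: p strand_at_def is_point_def prev_point_def del: up_move.simps down_move.simps)
    qed
  next
    case False
    obtain k' where k: "k = Suc k'" "k' < length w" using point_levels(2)[OF assms] p by auto
    obtain i t where wk: "w ! k' = (i, t)" by fastforce
    have nx: "nx p = down_move (Suc k', j)" using nx_down[OF False assms] p k by simp
    have "j < length (lev (Suc k'))" using pt k by simp
    from down_move[OF k(2) this wk] show ?thesis
    proof (elim disjE exE conjE)
      fix j' assume "down_move (Suc k', j) = (k', j')" "j' < length (lev k')"
        "lev k' ! j' = lev (Suc k') ! j" "up_move (k', j') = (Suc k', j)"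
      then show ?thesis using False k unfolding nx
        by (simp add: p strand_at_def is_point_def prev_point_def del: up_move.simps down_move.simps)
    next
      fix c d assume *: "t = Cup c d" "j = i" "down_move (Suc k', j) = (Suc k', Suc i)" "Suc i < length (lev (Suc k'))"
        "lev (Suc k') ! i = (c, d)" "lev (Suc k') ! Suc i = (c, opp d)"
      moreover have "down_move (Suc k', Suc i) = (Suc k', i)" using wk *(1) by simp
      ultimately show ?thesis using False k wk unfolding nx
        by (cases d) (simp_all add: p strand_at_def is_point_def prev_point_def del: up_move.simps down_move.simps)
    next
      fix c d assume *: "t = Cup c d" "j = Suc i" "down_move (Suc k', j) = (Suc k', i)" "Suc i < length (lev (Suc k'))"
        "lev (Suc k') ! i = (c, d)" "lev (Suc k') ! Suc i = (c, opp d)"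
      moreover have "down_move (Suc k', i) = (Suc k', Suc i)" using wk *(1) by simp
      ultimately show ?thesis using False k wk unfolding nx
        by (cases d) (simp_all add: p strand_at_def is_point_def prev_point_def del: up_move.simps down_move.simps)
    qed
  qed
  then show ?A ?B ?C "up p \<Longrightarrow> ?U" "\<not> up p \<Longrightarrow> ?N"
    by auto
qed

end

section \<open>The Alexander matrix on the points of a diagram\<close>

fun event_weight :: "event option \<Rightarrow> ratfun" where
  "event_weight (Some (Under k Pos)) = qq powi 2"
| "event_weight (Some (Under k Neg)) = qq powi (- 2)"
| "event_weight (Some (Meet z s)) = pass_factor z s E2"
| "event_weight _ = 1"

text \<open>With \<open>event_weight\<close> this gives the Burau relation: beyond an under-crossing
  of weight \<open>w\<close> the column is \<open>w\<close> times the old one plus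
  \<open>1 - w\<close> times that of the over-strand. Only the names of crossings link the two
  passages, so the matrix makes sense for abstract words.\<close>

fun jump :: "event option \<Rightarrow> event option \<Rightarrow> ratfun" where
  "jump (Some (Over k s)) (Some (Under k' s')) = (if k = k' then 1 - event_weight (Some (Under k' s')) else 0)"
| "jump _ _ = 0"

text \<open>
  The Alexander matrix \<open>1 - T\<close> of a closed strand whose places carry events; the column of a place is
  labelled by its predecessor, so that \<open>R\<close> is the graph of the successor map.
\<close>

definition transfer :: "('v \<times> 'v) set \<Rightarrow> ('v \<Rightarrow> event option) \<Rightarrow> 'v \<Rightarrow> 'v \<Rightarrow> ratfun" where
  "transfer R ev p u = of_bool ((u, p) \<in> R) - (if p = u then event_weight (ev p) else 0) - jump (ev p) (ev u)"

context closed_diagram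
begin

definition event_at :: "point \<Rightarrow> event option" where
  "event_at p = (case passage [] (\<lambda>_. []) w p of [] \<Rightarrow> None | e # _ \<Rightarrow> Some e)"

text \<open>The sign on upward strands makes the columns constant along cups, and makes the cap
  column the increment along the strand at a cap: \<open>y = - x + (x + y)\<close>.\<close>

definition column_at :: "point \<Rightarrow> nat \<Rightarrow> ratfun" where
  "column_at p r = (if up p then - (columns w (fst p) ! snd p) r else (columns w (fst p) ! snd p) r)"

definition over_point :: "nat \<Rightarrow> point" where
  "over_point k = (k, case w ! k of (i, t) \<Rightarrow> if t = Cross Pos then i else Suc i)"

lemma columns_step:
  assumes "k < length w" "w ! k = (i, t)"
  shows "j < i \<Longrightarrow> columns w (Suc k) ! j = columns w k ! j"
    and "columns w (Suc k) ! (i + length (tile_top t) + m) = columns w k ! (i + length (tile_bot t) + m)"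
    and "j < length (tile_top t) \<Longrightarrow> columns w (Suc k) ! (i + j) =
      column_step k t (take (length (tile_bot t)) (drop i (columns w k))) ! j"
proof -
  obtain L1 L2 where L: "lev k = L1 @ tile_bot t @ L2" "i = length L1" using slice_split[OF assms] by metis
  have len: "length (columns w k) = length (lev k)" using columns_level[OF closed] assms(1) by simp
  have ls: "length (column_step k t (take (length (tile_bot t)) (drop i (columns w k)))) = length (tile_top t)"
    by (rule column_step_properties(1)) (simp add: len L)
  show "j < i \<Longrightarrow> columns w (Suc k) ! j = columns w k ! j"
    by (simp add: assms nth_append len L)
  show "columns w (Suc k) ! (i + length (tile_top t) + m) = columns w k ! (i + length (tile_bot t) + m)"
    by (simp add: assms nth_append len L ls[unfolded L] add.assoc)
  show "j < length (tile_top t) \<Longrightarrow> columns w (Suc k) ! (i + j) =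
      column_step k t (take (length (tile_bot t)) (drop i (columns w k))) ! j"
    by (simp add: assms nth_append len L ls[unfolded L])
qed

lemma take_pair: "Suc i < length C \<Longrightarrow> take 2 (drop i C) = [C ! i, C ! Suc i]"
  by (simp add: numeral_2_eq_2 take_Suc_conv_app_nth)

lemma event_at_down: "\<not> up p \<Longrightarrow> is_point p \<Longrightarrow> event_at p = None"
  using point_levels(2)[of p]
  by (cases p; cases "snd (strand_at p)") (auto simp: event_at_def strand_at_def)

lemma event_at_up: "up (k, j) \<Longrightarrow> w ! k = (i, t) \<Longrightarrow> event_at (k, j) =
    (if j < i \<or> i + 2 \<le> j then None
     else case t of
       Cross s \<Rightarrow> Some (if (j = i) \<longleftrightarrow> (s = Pos) then Over k s else Under k s)
     | Pass z d l \<Rightarrow> if fst (strand_at (k, j)) = Alpha then Some (Meet z (pass_sign d l)) else None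
     | _ \<Rightarrow> None)"
  by (cases t) (auto simp: event_at_def strand_at_def)

declare next_point.simps [simp del]

text \<open>Along the orientation the columns obey the recursion encoded in \<open>transfer\<close>,
  with the caps as inhomogeneous terms. Downward strands run against the order of the slices, but
  events occur only on upward strands, so the column is constant there.\<close>

lemma column_at_nx:
  assumes u: "is_point u" "fst (strand_at u) = Alpha"
  shows "column_at (nx u) r = event_weight (event_at u) * column_at u r +
    (case event_at u of Some (Under k s) \<Rightarrow> (1 - event_weight (event_at u)) * column_at (over_point k) r | _ \<Rightarrow> 0) +
    (if up u \<and> \<not> up (nx u) then cap_column w (fst u) r else 0)"
proof (cases "up u")
  case True
  obtain k j where p: "u = (k, j)" by fastforce
  have pt: "k < length w" "j < length (lev k)" using point_levels(1)[OF u(1)] u(1) by (auto simp: p is_point_def)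
  obtain i t where wk: "w ! k = (i, t)" by fastforce
  obtain L1 L2 where L: "lev k = L1 @ tile_bot t @ L2" "lev (Suc k) = L1 @ tile_top t @ L2"
    "i = length L1" "tile_ok t" using slice_split[OF pt(1) wk] by metis
  have len: "length (columns w k) = length (lev k)" using columns_level[OF closed] pt(1) by simp
  have nx: "nx (k, j) = up_move (k, j)" using nx_up[OF True] p by simp
  note nxc = nx_cases(4)[OF u(1) True]
  note ev = event_at_up[OF True[unfolded p] wk, folded p]
  note cs = columns_step[OF pt(1) wk]
  consider "j < i" | m where "j = i + length (tile_bot t) + m" | "i \<le> j" "j < i + length (tile_bot t)"
    using le_Suc_ex by (metis linorder_not_less)
  then show ?thesis
  proof cases
    case 1
    then have "nx (k, j) = (Suc k, j)" unfolding nx by (simp add: wk)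
    moreover have "event_at u = None" using ev 1 by simp
    ultimately show ?thesis using nxc True cs(1)[OF 1] by (simp add: p column_at_def)
  next
    case 2
    then have nx': "nx (k, j) = (Suc k, i + length (tile_top t) + m)" unfolding nx by (simp add: wk Let_def)
    have "event_at u = None" using ev 2 by (cases t) (auto split: if_splits)
    then show ?thesis using nxc True cs(2)[of m] 2 nx' by (simp add: p column_at_def)
  next
    case 3
    show ?thesis
    proof (cases "length (tile_bot t) = 2")
      case False
      then have "tile_bot t = []" using tile_lengths[of t] by auto
      then show ?thesis using 3 by simp
    next
      case b: True
      then have Ct: "take (length (tile_bot t)) (drop i (columns w k)) = [columns w k ! i, columns w k ! Suc i]"
        using len L by (simp add: take_pair)
      have c0: "columns w (Suc k) ! i = column_step k t [columns w k ! i, columns w k ! Suc i] ! 0"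
        and c1: "columns w (Suc k) ! Suc i = column_step k t [columns w k ! i, columns w k ! Suc i] ! 1"
        if "length (tile_top t) = 2"
        using cs(3)[of 0] cs(3)[of 1] that unfolding Ct by simp_all
      have nx2: "nx (k, j) = (Suc k, i + 1 - (j - i))" "up (nx (k, j))" if "length (tile_top t) = 2"
      proof -
        show "nx (k, j) = (Suc k, i + 1 - (j - i))" using 3 b that unfolding nx by (auto simp: wk)
        then show "up (nx (k, j))" using nxc by (auto simp: p)
      qed
      have j: "j = i \<or> j = Suc i" using 3 b by auto
      have up_i: "strand_at (k, i) = tile_bot t ! 0" "strand_at (k, Suc i) = tile_bot t ! 1"
        using L b by (simp_all add: strand_at_def nth_append)
      show ?thesis
      proof (cases t)
        case (Cross s)
        have up': "up (k, i)" "up (k, Suc i)" using up_i by (simp_all add: Cross)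
        show ?thesis
          using j ev nx2 up' c0 c1
          by (cases s) (auto simp: p column_at_def over_point_def wk Cross algebra_simps)
      next
        case (Virt a b)
        show ?thesis using j ev nx2 True c0 c1 by (auto simp: p column_at_def Virt)
      next
        case (Pass z d l)
        show ?thesis using j ev nx2 True c0 c1 u(2) by (auto simp: p column_at_def Pass)
      next
        case (Cup c d)
        then show ?thesis using b by simp
      next
        case (Cap c d)
        have nx': "nx (k, j) = (k, i + 1 - (j - i))" using 3 unfolding nx by (simp add: wk Cap)
        have nxup: "\<not> up (nx (k, j))" using nxc by (auto simp: p nx')
        show ?thesis using j ev nxup True
          by (auto simp: nx' p column_at_def Cap cap_column_def wk)
      qed
    qed
  qed
next
  case False
  obtain k j where p: "u = (Suc k, j)" "k < length w" using point_levels(2)[OF u(1)] by (cases u) auto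
  have pt: "j < length (lev (Suc k))" using u(1) by (auto simp: p is_point_def)
  obtain i t where wk: "w ! k = (i, t)" by fastforce
  obtain L1 L2 where L: "lev k = L1 @ tile_bot t @ L2" "lev (Suc k) = L1 @ tile_top t @ L2"
    "i = length L1" "tile_ok t" using slice_split[OF p(2) wk] by metis
  have len: "length (columns w k) = length (lev k)" using columns_level[OF closed] p(2) by simp
  have nx: "nx (Suc k, j) = down_move (Suc k, j)" using nx_down[OF False u(1)] p by simp
  note nxc = nx_cases(5)[OF u(1) False]
  have ev: "event_at u = None" using event_at_down[OF False u(1)] .
  note cs = columns_step[OF p(2) wk]
  have goal: ?thesis if "column_at (nx u) r = column_at u r"
    using that False ev by simp
  consider "j < i" | m where "j = i + length (tile_top t) + m" | "i \<le> j" "j < i + length (tile_top t)"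
    using le_Suc_ex by (metis linorder_not_less)
  then show ?thesis
  proof cases
    case 1
    then have "nx (Suc k, j) = (k, j)" unfolding nx by (simp add: wk)
    then show ?thesis using nxc False cs(1)[OF 1] by (intro goal) (simp add: p column_at_def)
  next
    case 2
    then have nx': "nx (Suc k, j) = (k, i + length (tile_bot t) + m)" unfolding nx by (simp add: wk Let_def)
    then show ?thesis using nxc False cs(2)[of m] 2 by (intro goal) (simp add: p column_at_def)
  next
    case 3
    then have "length (tile_top t) = 2" using tile_lengths[of t] by auto
    then have j: "j = i \<or> j = Suc i" using 3 by auto
    have st: "strand_at (Suc k, i) = tile_top t ! 0" "strand_at (Suc k, Suc i) = tile_top t ! 1"
      using L \<open>length (tile_top t) = 2\<close> by (simp_all add: strand_at_def nth_append)
    show ?thesis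
    proof (cases t)
      case (Cross s)
      then show ?thesis using j st False by (auto simp: p)
    next
      case (Virt a b)
      have Ct: "take (length (tile_bot t)) (drop i (columns w k)) = [columns w k ! i, columns w k ! Suc i]"
        using take_pair[of i "columns w k"] len L by (simp add: Virt numeral_2_eq_2)
      have nx': "nx (Suc k, j) = (k, i + 1 - (j - i))" using 3 unfolding nx by (simp add: wk Virt)
      have nxup: "\<not> up (nx (Suc k, j))" using nxc by (auto simp: p nx')
      have c0: "columns w (Suc k) ! i = column_step k t [columns w k ! i, columns w k ! Suc i] ! 0"
        and c1: "columns w (Suc k) ! Suc i = column_step k t [columns w k ! i, columns w k ! Suc i] ! 1"
        using cs(3)[of 0] cs(3)[of 1] unfolding Ct by (simp_all add: Virt)
      show ?thesis using j nxup False c0 c1 by (intro goal) (auto simp: nx' p column_at_def Virt)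
    next
      case (Pass z d l)
      then show ?thesis using j st False u(2) by (cases l) (auto simp: p)
    next
      case (Cup c d)
      have nx': "nx (Suc k, j) = (Suc k, i + 1 - (j - i))" using 3 unfolding nx by (simp add: wk Cup)
      have nxup: "up (nx (Suc k, j))" using nxc by (auto simp: p nx')
      have c0: "columns w (Suc k) ! i = column_step k t [] ! 0"
        and c1: "columns w (Suc k) ! Suc i = column_step k t [] ! 1"
        using cs(3)[of 0] cs(3)[of 1] by (simp_all add: Cup)
      show ?thesis using j nxup False c0 c1 by (intro goal) (auto simp: nx' p column_at_def Cup)
    next
      case (Cap c d)
      then show ?thesis using 3 by simp
    qed
  qed
qed

end

section \<open>Elimination of all points except the turning points at cups and caps\<close>

context closed_diagram
begin

abbreviation "cups \<equiv> cup_slices w (length w)"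
abbreviation "caps \<equiv> cap_slices w (length w)"

definition nx_graph :: "(point \<times> point) set" where
  "nx_graph = (\<lambda>u. (u, nx u)) ` set alpha_points"

lemma nx_graph_iff: "(u, p) \<in> nx_graph \<longleftrightarrow> u \<in> set alpha_points \<and> p = nx u"
  by (auto simp: nx_graph_def)

lemma set_alpha_points: "set alpha_points = {p. is_point p \<and> fst (strand_at p) = Alpha}"
  by (auto simp: alpha_points_def set_points)

lemma distinct_alpha_points: "distinct alpha_points"
  by (simp add: alpha_points_def distinct_points)

lemma nx_alpha: "u \<in> set alpha_points \<Longrightarrow> nx u \<in> set alpha_points"
  using nx_cases(1,2) by (simp add: set_alpha_points)

lemma nx_inj: "inj_on nx (set alpha_points)"
proof (rule inj_onI)
  fix u v assume *: "u \<in> set alpha_points" "v \<in> set alpha_points" "nx u = nx v"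
  have "prev_point (nx u) = u" "prev_point (nx v) = v"
    using * nx_cases(3) unfolding set_alpha_points by blast+
  then show "u = v" using *(3) by argo
qed

text \<open>The end through which a strand enters the cup; \<open>cap_up\<close> is the
  corresponding end of a cap. The ends of a cup lie above its slice, at level \<open>Suc k\<close>,
  those of a cap below it, at level \<open>k\<close>.\<close>

definition cup_down :: "nat \<Rightarrow> point" where
  "cup_down k = (Suc k, case w ! k of (i, t) \<Rightarrow> if t = Cup Alpha Up then Suc i else i)"

definition cap_up :: "nat \<Rightarrow> point" where
  "cap_up k = (k, case w ! k of (i, t) \<Rightarrow> if t = Cap Alpha Up then i else Suc i)"

lemma cup_down:
  assumes "k \<in> set cups"
  shows "cup_down k \<in> set alpha_points" "\<not> up (cup_down k)" "up (nx (cup_down k))"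
    "column_at (cup_down k) r = of_bool (r = k)"
proof -
  obtain i d where wk: "w ! k = (i, Cup Alpha d)" and k: "k < length w"
    using assms by (cases "w ! k") (auto simp: cup_slices_def is_cup_def)
  obtain L1 L2 where L: "lev (Suc k) = L1 @ tile_top (Cup Alpha d) @ L2" "i = length L1"
    using slice_split[OF k wk] by metis
  have pt: "is_point (cup_down k)" using L k wk by (auto simp: is_point_def cup_down_def)
  have st: "strand_at (cup_down k) = (Alpha, Dn)"
    using L wk by (cases d) (auto simp: strand_at_def cup_down_def nth_append)
  show "cup_down k \<in> set alpha_points" "\<not> up (cup_down k)" using pt st by (auto simp: set_alpha_points)
  have "fst (nx (cup_down k)) = fst (cup_down k)"
    using nx_down[OF \<open>\<not> up (cup_down k)\<close> pt] by (simp add: cup_down_def wk)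
  then show "up (nx (cup_down k))" using nx_cases(5)[OF pt \<open>\<not> up (cup_down k)\<close>] by auto
  show "column_at (cup_down k) r = of_bool (r = k)"
    using columns_step(3)[OF k wk, of 0] columns_step(3)[OF k wk, of 1] st
    by (cases d) (auto simp: column_at_def cup_down_def wk)
qed

lemma cap_up:
  assumes "k \<in> set caps"
  shows "cap_up k \<in> set alpha_points" "up (cap_up k)" "\<not> up (nx (cap_up k))"
proof -
  obtain i d where wk: "w ! k = (i, Cap Alpha d)" and k: "k < length w"
    using assms by (cases "w ! k") (auto simp: cap_slices_def is_cap_def)
  obtain L1 L2 where L: "lev k = L1 @ tile_bot (Cap Alpha d) @ L2" "i = length L1"
    using slice_split[OF k wk] by metis
  have pt: "is_point (cap_up k)" using L k wk by (auto simp: is_point_def cap_up_def)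
  have st: "strand_at (cap_up k) = (Alpha, Up)"
    using L wk by (cases d) (auto simp: strand_at_def cap_up_def nth_append)
  show "cap_up k \<in> set alpha_points" "up (cap_up k)" using pt st by (auto simp: set_alpha_points)
  have "fst (nx (cap_up k)) = fst (cap_up k)"
    using nx_up[OF \<open>up (cap_up k)\<close>] by (simp add: cap_up_def wk)
  then show "\<not> up (nx (cap_up k))" using nx_cases(4)[OF pt \<open>up (cap_up k)\<close>] by auto
qed

lemma set_cup_down:
  "cup_down ` set cups = {u \<in> set alpha_points. \<not> up u \<and> up (nx u)}"
proof (intro equalityI subsetI)
  fix u assume "u \<in> {u \<in> set alpha_points. \<not> up u \<and> up (nx u)}"
  then have u: "is_point u" "fst (strand_at u) = Alpha" "\<not> up u" "up (nx u)" by (auto simp: set_alpha_points)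
  obtain k where k: "fst u = Suc k" "k < length w" using point_levels(2)[OF u(1)] by auto
  obtain i d where "w ! k = (i, Cup Alpha d)" "snd u = (if d = Up then Suc i else i)"
    using nx_cases(5)[OF u(1,3)] u k by auto
  then have "u = cup_down k" "k \<in> set cups"
    using k by (cases u; auto simp: cup_down_def cup_slices_def is_cup_def)+
  then show "u \<in> cup_down ` set cups" by blast
qed (use cup_down in auto)

lemma set_cap_up:
  "cap_up ` set caps = {u \<in> set alpha_points. up u \<and> \<not> up (nx u)}"
proof (intro equalityI subsetI)
  fix u assume "u \<in> {u \<in> set alpha_points. up u \<and> \<not> up (nx u)}"
  then have u: "is_point u" "fst (strand_at u) = Alpha" "up u" "\<not> up (nx u)" by (auto simp: set_alpha_points)
  have k: "fst u < length w" using point_levels(1)[OF u(1)] .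
  obtain i d where "w ! fst u = (i, Cap Alpha d)" "snd u = (if d = Up then i else Suc i)"
    using nx_cases(4)[OF u(1,3)] u by auto
  then have "u = cap_up (fst u)" "fst u \<in> set caps"
    using k by (cases u; auto simp: cap_up_def cap_slices_def is_cap_def)+
  then show "u \<in> cap_up ` set caps" by blast
qed (use cap_up in auto)

lemma event_over:
  assumes "p \<in> set alpha_points" "event_at p = Some (Over k s)"
  shows "p = over_point k"
proof -
  obtain k' j where p: "p = (k', j)" by fastforce
  have "up p" using assms event_at_down[of p] by (auto simp: set_alpha_points)
  moreover obtain i t where "w ! k' = (i, t)" by fastforce
  ultimately show ?thesis
    using assms(2) event_at_up[of k' j i t] by (auto simp: p over_point_def split: if_splits tile.splits)
qed

lemma event_under:
  assumes "u \<in> set alpha_points" "event_at u = Some (Under k s)"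
  shows "up u" "up (nx u)" "fst u = k" "over_point k \<in> set alpha_points"
    "event_at (over_point k) = Some (Over k s)"
proof -
  obtain k' j where p: "u = (k', j)" by fastforce
  have pt: "is_point u" using assms(1) by (simp add: set_alpha_points)
  show "up u" using assms event_at_down[of u] by (auto simp: set_alpha_points)
  obtain i t where wk: "w ! k' = (i, t)" by fastforce
  have t: "k' = k" "t = Cross s" "j = i \<or> j = Suc i" "(j = i) \<longleftrightarrow> (s \<noteq> Pos)"
    using assms(2) event_at_up[of k' j i t] \<open>up u\<close> wk by (auto simp: p split: if_splits tile.splits)
  show "fst u = k" using t p by simp
  have k: "k < length w" using point_levels(1)[OF pt] t by (simp add: p)
  show "up (nx u)" using nx_cases(4)[OF pt \<open>up u\<close>] wk t by (auto simp: p)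
  obtain L1 L2 where L: "lev k = L1 @ tile_bot t @ L2" "i = length L1"
    using slice_split[OF k] wk t(1) by metis
  have o: "over_point k = (k, if s = Pos then i else Suc i)" using wk t by (auto simp: over_point_def)
  have st: "strand_at (over_point k) = (Alpha, Up)" using L t by (auto simp: o strand_at_def nth_append)
  show "over_point k \<in> set alpha_points"
    using L t k st by (auto simp: set_alpha_points is_point_def o)
  show "event_at (over_point k) = Some (Over k s)"
    using event_at_up[of k "snd (over_point k)" i t] st wk t by (cases s) (auto simp: o)
qed

text \<open>Pairing the column \<open>u\<close> of \<open>transfer\<close> with
  \<open>column_at\<close> compares the two sides of the recursion \<open>column_at_nx\<close>, so
  only the cap term is left. Thus the carried columns solve the linear system from the left, away
  from the caps.\<close>

lemma column_at_transfer:
  assumes u: "u \<in> set alpha_points"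
  shows "(\<Sum>p\<in>set alpha_points. column_at p r * transfer nx_graph event_at p u) =
    (if up u \<and> \<not> up (nx u) then cap_column w (fst u) r else 0)"
proof -
  let ?V = "set alpha_points"
  have "(\<Sum>p\<in>?V. column_at p r * transfer nx_graph event_at p u) =
    (\<Sum>p\<in>?V. if p = nx u then column_at p r else 0) -
    (\<Sum>p\<in>?V. if p = u then event_weight (event_at p) * column_at p r else 0) -
    (\<Sum>p\<in>?V. jump (event_at p) (event_at u) * column_at p r)"
    unfolding sum_subtractf[symmetric]
    using u by (intro sum.cong) (auto simp: transfer_def nx_graph_iff algebra_simps)
  also have "\<dots> = column_at (nx u) r - event_weight (event_at u) * column_at u r -
    (\<Sum>p\<in>?V. jump (event_at p) (event_at u) * column_at p r)"
    using u nx_alpha by simp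
  also have "(\<Sum>p\<in>?V. jump (event_at p) (event_at u) * column_at p r) =
    (case event_at u of Some (Under k s) \<Rightarrow> (1 - event_weight (event_at u)) * column_at (over_point k) r | _ \<Rightarrow> 0)"
  proof (cases "\<exists>k s. event_at u = Some (Under k s)")
    case True
    then obtain k s where e: "event_at u = Some (Under k s)" by blast
    have o: "over_point k \<in> ?V" "event_at (over_point k) = Some (Over k s)" using event_under[OF u e] by auto
    have "(\<Sum>p\<in>?V. jump (event_at p) (event_at u) * column_at p r) =
      (\<Sum>p\<in>?V. if p = over_point k then (1 - event_weight (event_at u)) * column_at p r else 0)"
    proof (rule sum.cong[OF refl])
      fix p assume p: "p \<in> ?V"
      show "jump (event_at p) (event_at u) * column_at p r =
        (if p = over_point k then (1 - event_weight (event_at u)) * column_at p r else 0)"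
      proof (cases "p = over_point k")
        case False
        then have "event_at p \<noteq> Some (Over k s')" for s' using event_over[OF p] by blast
        then have "jump (event_at p) (event_at u) = 0"
          unfolding e by (cases "(event_at p, Some (Under k s))" rule: jump.cases) auto
        then show ?thesis using False by simp
      qed (simp add: o e)
    qed
    then show ?thesis using o(1) e by simp
  next
    case False
    then have "jump a (event_at u) = 0" for a
      by (cases "(a, event_at u)" rule: jump.cases) auto
    then show ?thesis using False by (auto split: option.splits event.splits)
  qed
  also have "column_at (nx u) r - event_weight (event_at u) * column_at u r - \<dots> =
      (if up u \<and> \<not> up (nx u) then cap_column w (fst u) r else 0)"
    using column_at_nx[of u r] u by (simp add: set_alpha_points)
  finally show ?thesis .
qed

text \<open>A Schur complement with multipliers \<open>column_at\<close>: the rows of the ends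
  entering cups and the columns of the ends entering caps survive. Any other column \<open>u\<close>
  has its pivot in the row \<open>\<gamma> u\<close>, the higher of the points \<open>u\<close> and
  \<open>nx u\<close> or, at a cup, the upward one, because columns are carried upwards through the
  slices.\<close>

theorem col_det_transfer:
  "list_det alpha_points alpha_points (transfer nx_graph event_at) \<simeq>
    col_det cups (map (cap_column w) (caps))"
proof -
  let ?V = "set alpha_points" and ?f = "transfer nx_graph event_at"
  define R1 where "R1 = map cup_down cups"
  define C1 where "C1 = map cap_up caps"
  define C2 where "C2 = filter (\<lambda>u. u \<notin> set C1) alpha_points"
  define \<gamma> where "\<gamma> u = (if up (nx u) then nx u else u)" for u
  define h where "h r u = cap_column w (fst u) (fst r - 1)" for r u :: point
  have len: "length caps = length cups" using prismatic_value_col_det(2)[OF closed] .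
  have R1: "set R1 = {u \<in> ?V. \<not> up u \<and> up (nx u)}" by (simp add: R1_def set_cup_down)
  have C1: "set C1 = {u \<in> ?V. up u \<and> \<not> up (nx u)}" by (simp add: C1_def set_cap_up)
  have C2: "set C2 = {u \<in> ?V. up u \<longrightarrow> up (nx u)}" by (auto simp: C2_def C1)
  have dR1: "distinct R1" by (auto simp: R1_def distinct_map cup_slices_def cup_down_def inj_on_def)
  have dC1: "distinct C1" by (auto simp: C1_def distinct_map cap_slices_def cap_up_def inj_on_def)
  have dC2: "distinct C2" by (simp add: C2_def distinct_alpha_points)
  have lev_up: "fst (nx u) = Suc (fst u)" if "u \<in> ?V" "up u" "up (nx u)" for u
    using nx_cases(4)[of u] that by (auto simp: set_alpha_points)
  have lev_down: "fst u = Suc (fst (nx u))" if "u \<in> ?V" "\<not> up u" "\<not> up (nx u)" for u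
    using nx_cases(5)[of u] that by (auto simp: set_alpha_points)
  have inj: "inj_on \<gamma> (set C2)"
    using nx_inj by (auto simp: inj_on_def \<gamma>_def C2)
  have d\<gamma>: "distinct (map \<gamma> C2)" using inj dC2 by (simp add: distinct_map)
  \<comment> \<open>One inclusion and a count suffice, since there are as many \<alpha>-cups as
    \<alpha>-caps.\<close>
  have \<gamma>_img: "\<gamma> ` set C2 = ?V - set R1"
  proof (rule card_subset_eq)
    show "\<gamma> ` set C2 \<subseteq> ?V - set R1" using nx_alpha by (auto simp: \<gamma>_def C2 R1)
    have "card (\<gamma> ` set C2) = length C2" using inj dC2 by (simp add: card_image distinct_card)
    moreover have "card ?V = card (set C1) + card (set C2)"
      by (subst card_Un_disjoint[symmetric]) (auto simp: C1 C2 intro!: arg_cong[of _ _ card])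
    moreover have "card (?V - set R1) = card ?V - card (set R1)"
      by (intro card_Diff_subset) (auto simp: R1)
    ultimately show "card (\<gamma> ` set C2) = card (?V - set R1)"
      using distinct_card[OF dR1] distinct_card[OF dC1] distinct_card[OF dC2] len by (simp add: R1_def C1_def)
  qed simp
  have "list_det alpha_points alpha_points ?f \<simeq> list_det (R1 @ map \<gamma> C2) (C1 @ C2) ?f"
  proof (rule list_det_perm)
    have "distinct (R1 @ map \<gamma> C2)" "set (R1 @ map \<gamma> C2) = ?V"
      using dR1 d\<gamma> \<gamma>_img by (auto simp: R1)
    then show "mset alpha_points = mset (R1 @ map \<gamma> C2)"
      by (subst set_eq_iff_mset_eq_distinct[symmetric]) (use distinct_alpha_points in auto)
    have "distinct (C1 @ C2)" "set (C1 @ C2) = ?V"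
      using dC1 dC2 by (auto simp: C1 C2)
    then show "mset alpha_points = mset (C1 @ C2)"
      by (subst set_eq_iff_mset_eq_distinct[symmetric]) (use distinct_alpha_points in auto)
  qed simp
  \<comment> \<open>A surviving row is labelled \<open>cup_down k\<close>, at level
    \<open>Suc k\<close>, so \<open>fst r - 1\<close> recovers the row name \<open>k\<close>. The
    rank of a column is the level of its pivot.\<close>
  also have "list_det (R1 @ map \<gamma> C2) (C1 @ C2) ?f \<simeq> list_det R1 C1 h"
  proof (rule list_det_reduce[where rank = "\<lambda>u. fst (\<gamma> u)" and G = "\<lambda>r p. column_at p (fst r - 1)"])
    show "length C1 = length R1" by (simp add: C1_def R1_def len)
    have total: "?f r u + (\<Sum>p\<in>\<gamma> ` set C2. column_at p (fst r - 1) * ?f p u) =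
        (if up u \<and> \<not> up (nx u) then cap_column w (fst u) (fst r - 1) else 0)"
      if r: "r \<in> set R1" and u: "u \<in> ?V" for r u
    proof -
      have "column_at p (fst r - 1) = of_bool (p = r)" if "p \<in> set R1" for p
        using that r cup_down(4) by (auto simp: R1_def cup_down_def)
      then have "?f r u = (\<Sum>p\<in>set R1. column_at p (fst r - 1) * ?f p u)"
        using r by (simp add: of_bool_def if_distrib[of "\<lambda>x. x * _"] cong: if_cong)
      moreover have "(\<Sum>p\<in>?V. column_at p (fst r - 1) * ?f p u) =
          (\<Sum>p\<in>?V - set R1. column_at p (fst r - 1) * ?f p u) + (\<Sum>p\<in>set R1. column_at p (fst r - 1) * ?f p u)"
        by (rule sum.subset_diff) (auto simp: R1)
      ultimately show ?thesis using column_at_transfer[OF u, of "fst r - 1"] by (simp only: \<gamma>_img add.commute)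
    qed
    show "?f r u + (\<Sum>p\<in>\<gamma> ` set C2. column_at p (fst r - 1) * ?f p u) = h r u"
      if "r \<in> set R1" "u \<in> set C1" for r u
      using total[OF that(1), of u] that(2) by (simp add: C1 h_def)
    show "?f r u + (\<Sum>p\<in>\<gamma> ` set C2. column_at p (fst r - 1) * ?f p u) = 0"
      if "r \<in> set R1" "u \<in> set C2" for r u
      using total[OF that(1), of u] that(2) by (auto simp: C2)
    have jump0: "jump (event_at p) (event_at u) = 0" if "p \<in> ?V" "u \<in> ?V" "fst p \<noteq> fst u" for p u
      using event_over[OF that(1)] event_under(3)[OF that(2)] that(3)
      by (cases "(event_at p, event_at u)" rule: jump.cases) (auto simp: over_point_def)
    have jump1: "jump (event_at p) (event_at u) = 0" if "u \<in> ?V" "\<not> up u" for p u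
      using event_at_down[of u] that by (simp add: set_alpha_points)
    show "?f (\<gamma> u) u \<simeq> 1" if "u \<in> set C2" for u
    proof (cases "up (nx u)")
      case True
      have "jump (event_at (nx u)) (event_at u) = 0 \<and> nx u \<noteq> u"
      proof (cases "up u")
        case upu: True
        then have "fst (nx u) \<noteq> fst u" using lev_up[of u] that True by (simp add: C2)
        then show ?thesis using jump0[of "nx u" u] nx_alpha that by (auto simp: C2)
      qed (use jump1[of u] that True in \<open>auto simp: C2\<close>)
      then show ?thesis using True that by (auto simp: \<gamma>_def transfer_def nx_graph_iff C2)
    next
      case False
      \<comment> \<open>Here the pivot lies on the diagonal; it is minus the weight of a point
        without event, hence \<open>-1\<close>.\<close>
      then have "\<not> up u" using that by (auto simp: C2)
      then have "fst u = Suc (fst (nx u))" using lev_down[of u] False that by (simp add: C2)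
      then have "nx u \<noteq> u" by auto
      moreover have "event_at u = None" using event_at_down[of u] \<open>\<not> up u\<close> that by (simp add: C2 set_alpha_points)
      ultimately show ?thesis
        using False by (auto simp: \<gamma>_def transfer_def nx_graph_iff eq_sign_def)
    qed
    \<comment> \<open>The column \<open>u\<close> meets the rows \<open>nx u\<close>,
      \<open>u\<close> and possibly an over-point at the level of \<open>u\<close>. Apart from the
      pivot, these lie at a lower level or, at a cup, among the surviving rows.\<close>
    show "?f (\<gamma> v) u = 0"
      if "u \<in> set C2" "v \<in> set C2" "u \<noteq> v" "fst (\<gamma> u) \<le> fst (\<gamma> v)" for u v
    proof -
      have u: "u \<in> ?V" and v: "\<gamma> v \<in> ?V" "\<gamma> v \<notin> set R1" using that \<gamma>_img by (auto simp: C2)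
      have ne: "\<gamma> v \<noteq> \<gamma> u" using that inj by (auto simp: inj_on_def)
      have "\<gamma> v \<noteq> nx u"
      proof
        assume eq: "\<gamma> v = nx u"
        have "\<gamma> u = nx u" if "up (nx u)" using that by (simp add: \<gamma>_def)
        with ne eq have "\<not> up (nx u)" by argo
        then have "\<not> up u" "\<gamma> u = u" using that(1) by (auto simp: C2 \<gamma>_def)
        then show False using lev_down[OF u] \<open>\<not> up (nx u)\<close> that(4) eq by simp
      qed
      moreover have "\<gamma> v \<noteq> u"
      proof
        assume eq: "\<gamma> v = u"
        have "\<gamma> u = u" if "\<not> up (nx u)" using that by (simp add: \<gamma>_def)
        with ne eq have "up (nx u)" by argo
        then have "up u" using v eq by (auto simp: R1)
        then show False using lev_up[OF u] \<open>up (nx u)\<close> that(4) eq by (simp add: \<gamma>_def)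
      qed
      moreover have "jump (event_at (\<gamma> v)) (event_at u) = 0"
      proof (cases "up u")
        case True
        then have "up (nx u)" using that(1) by (auto simp: C2)
        then have "fst (\<gamma> v) \<noteq> fst u" using that(4) lev_up[OF u True] by (simp add: \<gamma>_def)
        then show ?thesis using jump0 u v by blast
      qed (use jump1 u in auto)
      ultimately show ?thesis by (auto simp: transfer_def nx_graph_iff)
    qed
  qed (use dC2 d\<gamma> in auto)
  also have "list_det R1 C1 h = col_det cups (map (cap_column w) caps)"
    unfolding R1_def C1_def col_det_def
    using list_det_map[of caps cups cup_down cap_up h]
      list_det_map[of caps cups "\<lambda>r. r" "cap_column w" "\<lambda>r c. c r"] len
    by (simp add: h_def cup_down_def cap_up_def)
  finally show ?thesis .
qed

end

section \<open>Cyclic words of events\<close>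

text \<open>The successor relation as a set: it does not depend on where the cyclic word is cut, and
  it can be mapped along a renaming of places.\<close>

definition cyclic_pairs :: "'v list \<Rightarrow> ('v \<times> 'v) set" where
  "cyclic_pairs c = set (zip c (rotate1 c))"

definition cycle_graph :: "'v list list \<Rightarrow> ('v \<times> 'v) set" where
  "cycle_graph cs = (\<Union>c\<in>set cs. cyclic_pairs c)"

definition cycle_det :: "'v list list \<Rightarrow> ('v \<Rightarrow> event option) \<Rightarrow> ratfun" where
  "cycle_det cs ev = list_det (concat cs) (concat cs) (transfer (cycle_graph cs) ev)"

lemma cyclic_pairs_nth:
  "(u, p) \<in> cyclic_pairs c \<longleftrightarrow> (\<exists>i<length c. u = c ! i \<and> p = c ! (Suc i mod length c))"
  by (auto simp: cyclic_pairs_def set_zip nth_rotate1)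

lemma cyclic_pairs_nonempty:
  "c \<noteq> [] \<Longrightarrow> cyclic_pairs c = insert (last c, hd c) (set (zip (butlast c) (tl c)))"
proof -
  assume c: "c \<noteq> []"
  have "rotate1 c = tl c @ [hd c]" using c by (cases c) simp_all
  then have "zip c (rotate1 c) = zip (butlast c @ [last c]) (tl c @ [hd c])"
    using c by simp
  also have "\<dots> = zip (butlast c) (tl c) @ [(last c, hd c)]"
    by (subst zip_append) simp_all
  finally show ?thesis by (simp add: cyclic_pairs_def)
qed

lemma cyclic_pairs_rotate: "cyclic_pairs (rotate n c) = cyclic_pairs c"
proof -
  have "cyclic_pairs (rotate1 c) = cyclic_pairs c" for c :: "'a list"
  proof (cases c)
    case (Cons x xs)
    show ?thesis
    proof (cases xs)
      case ys: (Cons y ys)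
      have "zip (rotate1 c) (rotate1 (rotate1 c)) = zip ((y # ys) @ [x]) ((ys @ [x]) @ [y])"
        by (simp add: Cons ys)
      also have "\<dots> = zip (y # ys) (ys @ [x]) @ [(x, y)]"
        by (subst zip_append) simp_all
      finally show ?thesis by (auto simp: cyclic_pairs_def Cons ys)
    qed (simp add: Cons)
  qed simp
  then show ?thesis by (induction n) simp_all
qed

lemma cyclic_pairs_map: "cyclic_pairs (map \<phi> c) = map_prod \<phi> \<phi> ` cyclic_pairs c"
  by (simp add: cyclic_pairs_def rotate1_map zip_map_map map_prod_def case_prod_unfold)

lemma cyclic_pairs_subset: "(u, p) \<in> cyclic_pairs c \<Longrightarrow> u \<in> set c \<and> p \<in> set c"
  by (auto simp: cyclic_pairs_def dest: set_zip_leftD set_zip_rightD)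

lemma cycle_graph_Cons: "cycle_graph (c # cs) = cyclic_pairs c \<union> cycle_graph cs"
  by (simp add: cycle_graph_def)

lemma cycle_graph_subset: "(u, p) \<in> cycle_graph cs \<Longrightarrow> u \<in> set (concat cs) \<and> p \<in> set (concat cs)"
  by (auto simp: cycle_graph_def dest: cyclic_pairs_subset)

lemma cycle_det_map:
  assumes inj: "inj_on \<phi> (set (concat cs))"
  shows "cycle_det (map (map \<phi>) cs) ev = cycle_det cs (ev \<circ> \<phi>)"
proof -
  have graph: "cycle_graph (map (map \<phi>) cs) = map_prod \<phi> \<phi> ` cycle_graph cs"
    by (auto simp: cycle_graph_def cyclic_pairs_map)
  have "(\<phi> u, \<phi> p) \<in> cycle_graph (map (map \<phi>) cs) \<longleftrightarrow> (u, p) \<in> cycle_graph cs"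
    if "u \<in> set (concat cs)" "p \<in> set (concat cs)" for u p
  proof
    assume "(\<phi> u, \<phi> p) \<in> cycle_graph (map (map \<phi>) cs)"
    then obtain u' p' where *: "(u', p') \<in> cycle_graph cs" "\<phi> u' = \<phi> u" "\<phi> p' = \<phi> p" by (auto simp: graph)
    then have "u' = u" "p' = p" using inj that cycle_graph_subset[OF *(1)] by (auto dest: inj_onD)
    then show "(u, p) \<in> cycle_graph cs" using * by simp
  qed (auto simp: graph)
  moreover have "\<phi> p = \<phi> u \<longleftrightarrow> p = u" if "u \<in> set (concat cs)" "p \<in> set (concat cs)" for u p
    using inj that by (auto dest: inj_onD)
  ultimately have tr: "transfer (cycle_graph (map (map \<phi>) cs)) ev (\<phi> p) (\<phi> u) = transfer (cycle_graph cs) (ev \<circ> \<phi>) p u"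
    if "u \<in> set (concat cs)" "p \<in> set (concat cs)" for u p
    using that by (simp add: transfer_def)
  show ?thesis
    unfolding cycle_det_def map_concat[symmetric]
    by (subst list_det_map) (rule refl, rule list_det_cong[OF refl tr])
qed

lemma cycle_det_perm:
  assumes "mset (concat cs) = mset (concat cs')" "cycle_graph cs = cycle_graph cs'"
  shows "cycle_det cs ev \<simeq> cycle_det cs' ev"
  unfolding cycle_det_def assms(2) by (rule list_det_perm[OF assms(1,1)]) simp

text \<open>Places need names of their own, since an event such as \<open>Meet z s\<close> can occur
  several times in a code.\<close>

definition spots :: "'e list list \<Rightarrow> (nat \<times> nat) list list" where
  "spots c = map (\<lambda>i. map (Pair i) [0..<length (c ! i)]) [0..<length c]"

abbreviation at_spot :: "'e list list \<Rightarrow> nat \<times> nat \<Rightarrow> 'e" where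
  "at_spot c \<equiv> \<lambda>(i, p). c ! i ! p"

lemma map_spots: "map (map (at_spot c)) (spots c) = c"
  by (auto simp: spots_def intro!: nth_equalityI)

lemma set_spots: "set (concat (spots c)) = {(i, p). i < length c \<and> p < length (c ! i)}"
  by (auto simp: spots_def)

lemma distinct_spots: "distinct (concat (spots c))"
proof -
  have "distinct (concat (map (\<lambda>i. map (Pair i) [0..<length (c ! i)]) ks))" if "distinct ks" for ks
    using that by (induction ks) (auto simp: distinct_map inj_on_def)
  then show ?thesis by (simp add: spots_def)
qed

definition code_det :: "event option list list \<Rightarrow> ratfun" where
  "code_det c = cycle_det (spots c) (at_spot c)"

lemma spots_map: "spots (map (map f) c) = spots c"
  by (auto simp: spots_def)

lemma cycle_det_eq_code_det:
  assumes "distinct (concat cs)"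
  shows "cycle_det cs ev = code_det (map (map ev) cs)"
proof -
  have inj: "inj_on (at_spot cs) (set (concat (spots cs)))"
  proof -
    have "map (at_spot cs) (concat (spots cs)) = concat cs"
      by (simp add: map_concat map_spots)
    then show ?thesis using assms by (metis distinct_map)
  qed
  have "cycle_det cs ev = cycle_det (map (map (at_spot cs)) (spots cs)) ev" by (simp add: map_spots)
  also have "\<dots> = cycle_det (spots cs) (ev \<circ> at_spot cs)" by (rule cycle_det_map[OF inj])
  also have "\<dots> = cycle_det (spots cs) (at_spot (map (map ev) cs))"
    unfolding cycle_det_def
    by (intro list_det_cong) (auto simp: transfer_def set_spots[unfolded set_concat])
  finally show ?thesis by (simp add: code_det_def spots_map)
qed

lemma transfer_relabel:
  assumes "inj f"
  shows "transfer R (map_option (relabel f) \<circ> ev) = transfer R ev"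
proof -
  have w: "event_weight (map_option (relabel f) e) = event_weight e" for e
    by (cases e rule: event_weight.cases) auto
  have "jump (map_option (relabel f) e) (map_option (relabel f) e') = jump e e'" for e e'
  proof (cases "(e, e')" rule: jump.cases)
    case (1 k s k' s')
    then show ?thesis using w[of "Some (Under k' s')"] inj_eq[OF assms] by simp
  qed auto
  then show ?thesis by (auto simp: transfer_def w fun_eq_iff)
qed

lemma mset_rotate: "mset (rotate n c) = mset c"
  by (metis add.commute append_take_drop_id mset_append rotate_drop_take)

text \<open>Permuting components and rotating words permutes the places but keeps their successor
  relation, and renaming crossings injectively keeps \<open>jump\<close>. The places of
  \<open>oc\<close> are carried along, so that \<open>oc'\<close> reads its events at the same
  places in another order.\<close>

lemma code_det_rotate:
  assumes "mset xs = mset oc" and "list_all2 (\<lambda>u v. \<exists>n. v = rotate n (map (map_option (relabel f)) u)) xs oc'"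
    and "inj f"
  shows "code_det oc \<simeq> code_det oc'"
proof -
  let ?g = "map_option (relabel f)"
  obtain \<pi> where \<pi>: "\<pi> permutes {..<length oc}" "permute_list \<pi> oc = xs"
    using assms(1) by (metis mset_eq_permutation)
  define cs where "cs = permute_list \<pi> (spots oc)"
  have len: "length (spots oc) = length oc" by (simp add: spots_def)
  have cs: "mset cs = mset (spots oc)"
    unfolding cs_def using \<pi>(1) len by (intro mset_permute_list) simp
  have xs: "map (map (at_spot oc)) cs = xs"
    unfolding cs_def using \<pi> len by (simp add: permute_list_map[symmetric] map_spots)
  have "list_all2 (\<lambda>u v. \<exists>n. v = rotate n (map ?g u)) (map (map (at_spot oc)) cs) oc'"
    using assms(2) xs by simp
  then have "\<exists>cs'. list_all2 (\<lambda>c c'. \<exists>n. c' = rotate n c) cs cs' \<and> map (map (?g \<circ> at_spot oc)) cs' = oc'"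
  proof (induction cs arbitrary: oc')
    case (Cons c cs)
    then obtain v vs where oc': "oc' = v # vs" "list_all2 (\<lambda>u v. \<exists>n. v = rotate n (map ?g u)) (map (map (at_spot oc)) cs) vs"
      and "\<exists>n. v = rotate n (map ?g (map (at_spot oc) c))" by (auto simp: list_all2_Cons1)
    then obtain n where "v = map (?g \<circ> at_spot oc) (rotate n c)" by (auto simp: rotate_map)
    moreover obtain cs' where "list_all2 (\<lambda>c c'. \<exists>n. c' = rotate n c) cs cs'" "map (map (?g \<circ> at_spot oc)) cs' = vs"
      using Cons.IH[OF oc'(2)] by blast
    ultimately show ?case by (intro exI[of _ "rotate n c # cs'"]) (auto simp: oc')
  qed simp
  then obtain cs' where cs': "list_all2 (\<lambda>c c'. \<exists>n. c' = rotate n c) cs cs'"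
    "map (map (?g \<circ> at_spot oc)) cs' = oc'" by blast
  have m: "mset (concat cs) = mset (concat cs') \<and> cycle_graph cs = cycle_graph cs'"
    using cs'(1) by (induction rule: list_all2_induct) (auto simp: cycle_graph_Cons cyclic_pairs_rotate mset_rotate)
  have m': "mset (concat (spots oc)) = mset (concat cs)"
    using cs by (metis mset_concat mset_map sum_mset_sum_list)
  have "cycle_graph (spots oc) = cycle_graph cs"
    using cs by (metis cycle_graph_def set_mset_mset)
  then have "code_det oc \<simeq> cycle_det cs' (at_spot oc)"
    unfolding code_det_def using m m' by (intro cycle_det_perm) simp_all
  also have "cycle_det cs' (at_spot oc) = cycle_det cs' (?g \<circ> at_spot oc)"
    by (simp add: cycle_det_def transfer_relabel[OF assms(3)])
  also have "\<dots> = code_det oc'"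
    unfolding cs'(2)[symmetric]
    using distinct_spots[of oc] m m' by (intro cycle_det_eq_code_det) (metis mset_eq_imp_distinct_iff)
  finally show ?thesis .
qed

lemma map_relabel_id [simp]: "map (map_option (relabel id)) u = u"
proof -
  have "relabel id = id"
  proof
    fix e show "relabel id e = id e" by (cases e) simp_all
  qed
  then show ?thesis by (simp add: map_option.id)
qed

lemma relabel_id_rotation: "list_all2 (\<lambda>u v. \<exists>n. v = rotate n (map (map_option (relabel id)) u)) xs xs"
  by (auto simp: list_all2_same intro: exI[of _ 0])

lemma code_det_same_gauss:
  assumes "same_gauss c c'"
  shows "code_det (map (map Some) c) \<simeq> code_det (map (map Some) c')"
proof -
  obtain f xs ys where f: "inj f" and xs: "mset xs = mset c" "mset ys = mset c'"
    "list_all2 (\<lambda>u v. \<exists>n. v = rotate n (map (relabel f) u)) xs ys"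
    using assms by (auto simp: same_gauss_def rel_mset_def)
  have "list_all2 (\<lambda>u v. \<exists>n. v = rotate n (map (map_option (relabel f)) u)) (map (map Some) xs) (map (map Some) ys)"
    using xs(3) by (auto simp: list_all2_map1 list_all2_map2 rotate_map comp_def elim!: list_all2_mono)
  then have "code_det (map (map Some) c) \<simeq> code_det (map (map Some) ys)"
    using xs(1) f by (intro code_det_rotate[of "map (map Some) xs"]) (simp_all add: mset_map)
  \<comment> \<open>The relation \<open>rel_mset\<close> arranges both multisets as lists; for the
    second code only the order of components is adjusted, with the identity as renaming.\<close>
  also have "code_det (map (map Some) ys) \<simeq> code_det (map (map Some) c')"
    using xs(2) by (intro code_det_rotate[of "map (map Some) c'" _ id])
      (simp_all add: mset_map relabel_id_rotation[simplified])
  finally show ?thesis .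
qed

section \<open>Removal of places without events\<close>

lemma list_det_zero_row:
  assumes "r \<in> set rs" "\<And>c. c \<in> set cs \<Longrightarrow> f r c = 0" "length cs = length rs"
  shows "list_det rs cs f = 0"
proof -
  have "list_det rs cs f = col_det rs (map (\<lambda>c r. f r c) cs)"
    using list_det_map[of cs rs "\<lambda>r. r" "\<lambda>c r. f r c" "\<lambda>r c. c r"] assms(3) by (simp add: col_det_def)
  also have "\<dots> = 0" using assms by (intro col_det_zero_row[of r]) auto
  finally show ?thesis .
qed

lemma jump_None [simp]: "jump None e = 0" "jump e None = 0"
proof -
  show "jump None e = 0" by simp
  show "jump e None = 0" by (cases "(e, None :: event option)" rule: jump.cases) auto
qed

text \<open>The row of \<open>v\<close> vanishes: on the diagonal the place is its own successor and
  the weight is \<open>1\<close>, giving \<open>1 - 1\<close>.\<close>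

lemma cycle_det_trivial_component:
  assumes "distinct (concat ([v] # cs))" "ev v = None"
  shows "cycle_det ([v] # cs) ev = 0"
  unfolding cycle_det_def
proof (rule list_det_zero_row[of v])
  fix u
  have "(u, v) \<in> cycle_graph ([v] # cs) \<longleftrightarrow> u = v"
    using assms(1) cycle_graph_subset[of u v cs] by (auto simp: cycle_graph_Cons cyclic_pairs_def)
  then show "transfer (cycle_graph ([v] # cs)) ev v u = 0" using assms(2) by (auto simp: transfer_def)
qed auto

text \<open>The row of \<open>v\<close> has just two entries, \<open>1\<close> at its predecessor
  \<open>u0\<close> and \<open>-1\<close> at \<open>v\<close>. Elimination with the first leaves in
  column \<open>v\<close> the sum of the two columns, which is the column of \<open>u0\<close> once
  \<open>v\<close> has been cut out of the cycle.\<close>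

lemma cycle_det_remove:
  assumes d: "distinct (concat ((v # c) # cs))" and "c \<noteq> []" "ev v = None"
  shows "cycle_det ((v # c) # cs) ev \<simeq> cycle_det (c # cs) ev"
proof -
  define V where "V = concat (c # cs)"
  define u0 where "u0 = last c"
  \<comment> \<open>Column \<open>u0\<close> is consumed by the pivot, so column \<open>v\<close>
    stands in for it.\<close>
  define \<psi> where "\<psi> u = (if u = u0 then v else u)" for u
  define h where "h r u = transfer (cycle_graph (c # cs)) ev r (if u = v then u0 else u)" for r u
  let ?f = "transfer (cycle_graph ((v # c) # cs)) ev"
  let ?T = "set (zip (butlast c) (tl c))"
  have c: "c = butlast c @ [u0]" "c = hd c # tl c" using \<open>c \<noteq> []\<close> by (simp_all add: u0_def)
  have V: "distinct V" "v \<notin> set V" "u0 \<in> set V" using d \<open>c \<noteq> []\<close> by (auto simp: V_def u0_def)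
  have dc: "distinct c" "v \<notin> set c" "v \<notin> set (concat cs)" "set c \<inter> set (concat cs) = {}" using d by auto
  have T: "u \<in> set c \<and> p \<in> set c \<and> u \<noteq> u0 \<and> p \<noteq> hd c" if "(u, p) \<in> ?T" for u p
  proof -
    have "u \<in> set (butlast c)" "p \<in> set (tl c)" using that by (auto dest: set_zip_leftD set_zip_rightD)
    moreover have "distinct (butlast c @ [u0])" "distinct (hd c # tl c)" using dc(1) c by metis+
    ultimately have "u \<noteq> u0" "p \<noteq> hd c" by auto
    moreover have "u \<in> set c" using \<open>u \<in> set (butlast c)\<close> by (rule in_set_butlastD)
    moreover have "p \<in> set c" using \<open>c \<noteq> []\<close> \<open>p \<in> set (tl c)\<close> by (rule list.set_sel(2))
    ultimately show ?thesis by blast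
  qed
  have g: "cycle_graph ((v # c) # cs) = insert (u0, v) (insert (v, hd c) (?T \<union> cycle_graph cs))"
  proof -
    have "zip (butlast (v # c)) (tl (v # c)) = (v, hd c) # zip (butlast c) (tl c)"
      using \<open>c \<noteq> []\<close> by (subst c(2)) (cases c; simp)
    then show ?thesis using \<open>c \<noteq> []\<close> by (simp add: cycle_graph_Cons cyclic_pairs_nonempty u0_def)
  qed
  have g': "cycle_graph (c # cs) = insert (u0, hd c) (?T \<union> cycle_graph cs)"
    using \<open>c \<noteq> []\<close> by (simp add: cycle_graph_Cons cyclic_pairs_nonempty u0_def)
  have mem: "hd c \<in> set c" "u0 \<in> set c" using \<open>c \<noteq> []\<close> by (simp_all add: u0_def)
  have sub: "u \<in> set (concat cs) \<and> p \<in> set (concat cs)" if "(u, p) \<in> cycle_graph cs" for u p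
    using cycle_graph_subset[OF that] .
  have fv: "?f v u = of_bool (u = u0) - of_bool (u = v)" for u
    using dc mem T[of u v] sub[of u v] assms(3) by (auto simp: transfer_def g)
  have fr0: "?f r u0 = - (if r = u0 then event_weight (ev r) else 0) - jump (ev r) (ev u0)" if "r \<in> set V" for r
    using dc mem T[of u0 r] sub[of u0 r] that V by (auto simp: transfer_def g)
  have frv: "?f r v = of_bool (r = hd c)" if "r \<in> set V" for r
    using dc mem T[of v r] sub[of v r] that V assms(3) by (auto simp: transfer_def g)
  have hr0: "h r v = of_bool (r = hd c) - (if r = u0 then event_weight (ev r) else 0) - jump (ev r) (ev u0)"
    if "r \<in> set V" for r
    using dc mem T[of u0 r] sub[of u0 r] that V by (auto simp: h_def transfer_def g')
  have hru: "h r u = ?f r u" if "r \<in> set V" "u \<noteq> v" "u \<noteq> u0" for r u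
    using that V by (auto simp: h_def transfer_def g g')
  have "cycle_det ((v # c) # cs) ev = list_det (v # V) (v # V) ?f"
    by (simp add: cycle_det_def V_def)
  also have "\<dots> \<simeq> list_det (V @ map (\<lambda>_. v) [u0]) (map \<psi> V @ [u0]) ?f"
  proof (rule list_det_perm)
    have inj: "inj_on \<psi> (set V)" using V by (auto simp: inj_on_def \<psi>_def)
    have "distinct (map \<psi> V @ [u0])" using V inj by (auto simp: distinct_map \<psi>_def)
    moreover have "set (map \<psi> V @ [u0]) = set (v # V)" using V(3) by (auto simp: \<psi>_def image_iff)
    ultimately show "mset (v # V) = mset (map \<psi> V @ [u0])"
      by (subst set_eq_iff_mset_eq_distinct[symmetric]) (use V in auto)
  qed simp_all
  also have "\<dots> \<simeq> list_det V (map \<psi> V) h"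
  proof (rule list_det_reduce[where rank = "\<lambda>_. 0" and G = "\<lambda>r p. - ?f r u0"])
    fix r u assume "r \<in> set V" "u \<in> set (map \<psi> V)"
    moreover from this have "u \<noteq> u0" using V by (auto simp: \<psi>_def split: if_splits)
    ultimately show "?f r u + (\<Sum>p\<in>(\<lambda>_. v) ` set [u0]. - ?f r u0 * ?f p u) = h r u"
      using hru[of r u] by (cases "u = v") (simp_all add: fv frv fr0 hr0)
  next
    fix r u assume "r \<in> set V" "u \<in> set [u0]"
    then show "?f r u + (\<Sum>p\<in>(\<lambda>_. v) ` set [u0]. - ?f r u0 * ?f p u) = 0"
      using V by (auto simp: fv)
  qed (use V in \<open>auto simp: fv\<close>)
  also have "list_det V (map \<psi> V) h = list_det V V (transfer (cycle_graph (c # cs)) ev)"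
    using list_det_map[of V V "\<lambda>r. r" \<psi> h] V
    by (auto simp: \<psi>_def h_def intro!: list_det_cong)
  finally show ?thesis by (simp add: cycle_det_def V_def)
qed

lemma code_det_move:
  "code_det (xs @ (a @ b) # ys) \<simeq> code_det ((b @ a) # xs @ ys)"
proof (rule code_det_rotate[of "(a @ b) # xs @ ys" _ id])
  have "rotate (length a) (a @ b) = b @ a" by (rule rotate_append)
  then show "list_all2 (\<lambda>u v. \<exists>n. v = rotate n (map (map_option (relabel id)) u)) ((a @ b) # xs @ ys) ((b @ a) # xs @ ys)"
    using relabel_id_rotation[of "xs @ ys"] by (auto intro!: exI[of _ "length a"])
qed simp_all

abbreviation somes :: "event option list \<Rightarrow> event option list" where
  "somes \<equiv> filter (\<lambda>e. e \<noteq> None)"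

text \<open>By induction on the number of places, a \<open>None\<close> is rotated to the front of
  its word and cut out. A word reduced to a single \<open>None\<close> makes the determinant vanish,
  whereas \<open>code_det\<close> does not see empty words; hence the case distinction.\<close>

lemma code_det_remove_None:
  assumes "[] \<notin> set oc"
  shows "code_det oc \<simeq>
    (if \<exists>u\<in>set oc. \<forall>e\<in>set u. e = None then 0 else code_det (map somes oc))"
  using assms
proof (induction "length (concat oc)" arbitrary: oc rule: less_induct)
  case less
  let ?t = "\<lambda>oc. if \<exists>u\<in>set oc. \<forall>e\<in>set u. e = None then 0 else code_det (map somes oc)"
  show ?case
  proof (cases "\<exists>u\<in>set oc. None \<in> set u")
    case False
    then have "\<forall>u\<in>set oc. \<not> (\<forall>e\<in>set u. e = None)"
      using less.prems by (metis last_in_set)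
    moreover have "map somes oc = oc"
      using False by (intro map_idI filter_True) (auto, metis not_None_eq)
    ultimately show ?thesis by auto
  next
    case True
    then obtain xs ys a b where oc: "oc = xs @ (a @ None # b) # ys"
      by (metis split_list)
    let ?oc1 = "(None # b @ a) # xs @ ys"
    have 1: "code_det oc \<simeq> code_det ?oc1" using code_det_move[of xs a "None # b" ys] by (simp add: oc)
    have m: "code_det ?oc1 = cycle_det (spots ?oc1) (at_spot ?oc1)" by (simp add: code_det_def)
    obtain v c cs where sp: "spots ?oc1 = (v # c) # cs" "map (at_spot ?oc1) c = b @ a" "at_spot ?oc1 v = None"
      "map (map (at_spot ?oc1)) cs = xs @ ys"
      using map_spots[of ?oc1] by (auto simp: map_eq_Cons_conv simp del: split_paired_All split_paired_Ex)
    have d: "distinct (concat ((v # c) # cs))" using distinct_spots[of ?oc1] sp(1) by simp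
    show ?thesis
    proof (cases "b @ a = []")
      case True
      then have "c = []" using sp(2) by simp
      then have "code_det ?oc1 = 0"
        unfolding m sp(1) using d sp(3) cycle_det_trivial_component[of v cs] by simp
      moreover have "?t oc = 0" using True by (auto simp: oc)
      ultimately show ?thesis using 1 by simp
    next
      case False
      then have "code_det ?oc1 \<simeq> cycle_det (c # cs) (at_spot ?oc1)"
        unfolding m sp(1) using d sp(2,3) by (intro cycle_det_remove) auto
      also have "cycle_det (c # cs) (at_spot ?oc1) = code_det ((b @ a) # xs @ ys)"
        using cycle_det_eq_code_det[of "c # cs" "at_spot ?oc1"] d sp by simp
      also have "\<dots> \<simeq> ?t ((b @ a) # xs @ ys)"
        using False less.prems by (intro less.hyps) (auto simp: oc)
      also have "\<dots> \<simeq> ?t oc"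
      proof -
        have "code_det (map somes oc) \<simeq> code_det (map somes ((b @ a) # xs @ ys))"
          using code_det_move[of "map somes xs" "somes a" "somes b"
              "map somes ys"] by (simp add: oc)
        moreover have "(\<exists>u\<in>set oc. \<forall>e\<in>set u. e = None) \<longleftrightarrow> (\<exists>u\<in>set ((b @ a) # xs @ ys). \<forall>e\<in>set u. e = None)"
          by (auto simp: oc)
        ultimately show ?thesis by (simp only: eq_sign_sym eq_sign_refl split: if_split) (auto intro: eq_sign_sym)
      qed
      finally show ?thesis using 1 eq_sign_trans by blast
    qed
  qed
qed

section \<open>Orbits of a permutation of a finite list\<close>

lemma funpow_mem: "(\<And>x. x \<in> S \<Longrightarrow> f x \<in> S) \<Longrightarrow> x \<in> S \<Longrightarrow> (f ^^ n) x \<in> S"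
  by (induction n) auto

lemma funpow_inj_on: "inj_on f S \<Longrightarrow> (\<And>x. x \<in> S \<Longrightarrow> f x \<in> S) \<Longrightarrow> inj_on (f ^^ n) S"
proof (induction n)
  case (Suc n)
  have "(f ^^ n) ` S \<subseteq> S" using funpow_mem[of S f _ n] Suc.prems(2) by blast
  then have "inj_on f ((f ^^ n) ` S)" using Suc.prems(1) inj_on_subset by blast
  moreover have "inj_on (f ^^ n) S" using Suc by blast
  ultimately show ?case unfolding funpow.simps by (intro comp_inj_on)
qed simp

lemma trivial_component_iff:
  "(\<exists>u\<in>set oc. \<forall>e\<in>set u. e = None) \<longleftrightarrow> [] \<in> set (map somes oc)"
  unfolding set_map image_iff eq_commute[of "[]"] filter_empty_conv by blast

text \<open>Abstracts the tracing of components: \<open>cyc\<close> and \<open>bases\<close> have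
  the shape of \<open>component_from\<close> and \<open>base_points\<close>, with
  \<open>\<sigma>\<close> for the successor of a point.\<close>

locale list_permutation =
  fixes P :: "'v list" and \<sigma> :: "'v \<Rightarrow> 'v"
  assumes closed: "x \<in> set P \<Longrightarrow> \<sigma> x \<in> set P" and inj: "inj_on \<sigma> (set P)"
begin

definition cyc :: "'v \<Rightarrow> 'v list" where
  "cyc p = p # takeWhile (\<lambda>r. r \<noteq> p) (map (\<lambda>n. (\<sigma> ^^ n) p) [1..<length P])"

definition bases :: "'v list" where
  "bases = filter (\<lambda>p. find (\<lambda>r. r \<in> set (cyc p)) P = Some p) P"

text \<open>By the pigeonhole principle two iterates among \<open>length P + 1\<close> agree, and
  injectivity moves the coincidence back to \<open>p\<close>. So the iterates listed in
  \<open>cyc\<close> suffice to exhaust the orbit, and \<open>takeWhile\<close> cuts them at the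
  first return, if that is listed at all.\<close>

lemma orbit:
  assumes p: "p \<in> set P"
  obtains m where "0 < m" "(\<sigma> ^^ m) p = p" "cyc p = map (\<lambda>n. (\<sigma> ^^ n) p) [0..<m]" "distinct (cyc p)"
proof -
  have mem: "(\<sigma> ^^ n) p \<in> set P" for n using funpow_mem[of "set P" \<sigma>] closed p by blast
  have cancel: "(\<sigma> ^^ (j - i)) p = p" if "(\<sigma> ^^ i) p = (\<sigma> ^^ j) p" "i \<le> j" for i j
  proof -
    have "(\<sigma> ^^ i) ((\<sigma> ^^ (j - i)) p) = (\<sigma> ^^ i) p"
      using that by (simp add: funpow_add[symmetric, unfolded comp_def, THEN fun_cong])
    then show ?thesis using funpow_inj_on[OF inj closed, of i] mem p by (auto dest: inj_onD)
  qed
  have "\<exists>m. 0 < m \<and> m \<le> length P \<and> (\<sigma> ^^ m) p = p"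
  proof -
    have "\<not> inj_on (\<lambda>n. (\<sigma> ^^ n) p) {..length P}"
    proof
      assume "inj_on (\<lambda>n. (\<sigma> ^^ n) p) {..length P}"
      then have "card {..length P} \<le> card (set P)"
        using mem by (intro card_inj_on_le) auto
      then show False using card_length[of P] by simp
    qed
    then obtain i j where "i \<le> length P" "j \<le> length P" "i \<noteq> j" "(\<sigma> ^^ i) p = (\<sigma> ^^ j) p"
      by (auto simp: inj_on_def)
    then obtain i j where "i < j" "j \<le> length P" "(\<sigma> ^^ i) p = (\<sigma> ^^ j) p"
      by (metis nat_neq_iff)
    then show ?thesis using cancel[of i j] by (intro exI[of _ "j - i"]) auto
  qed
  then have ex: "\<exists>m. 0 < m \<and> m \<le> length P \<and> (\<sigma> ^^ m) p = p" .
  define m where "m = (LEAST m. 0 < m \<and> m \<le> length P \<and> (\<sigma> ^^ m) p = p)"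
  have m: "0 < m" "m \<le> length P" "(\<sigma> ^^ m) p = p"
    using LeastI_ex[OF ex] by (simp_all add: m_def)
  have least: "(\<sigma> ^^ n) p \<noteq> p" if "0 < n" "n < m" for n
    using not_less_Least[of n "\<lambda>m. 0 < m \<and> m \<le> length P \<and> (\<sigma> ^^ m) p = p"] that m(2)
    by (simp add: m_def)
  let ?f = "\<lambda>n. (\<sigma> ^^ n) p"
  have "takeWhile (\<lambda>r. r \<noteq> p) (map ?f [1..<length P]) = map ?f [1..<m]"
  proof -
    have split: "[1..<length P] = [1..<m] @ [m..<length P]"
      using m(1,2) upt_add_eq_append[of 1 m "length P - m"] by simp
    have ne: "x \<noteq> p" if x: "x \<in> set (map ?f [1..<m])" for x
    proof -
      obtain n where "x = ?f n" "1 \<le> n" "n < m" using x by auto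
      then show ?thesis using least[of n] by simp
    qed
    have "takeWhile (\<lambda>r. r \<noteq> p) (map ?f [1..<length P]) =
        map ?f [1..<m] @ takeWhile (\<lambda>r. r \<noteq> p) (map ?f [m..<length P])"
      unfolding split map_append by (rule takeWhile_append2) (rule ne)
    moreover have "takeWhile (\<lambda>r. r \<noteq> p) (map ?f [m..<length P]) = []"
      using m(3) by (cases "m < length P") (simp_all add: upt_conv_Cons)
    ultimately show ?thesis by simp
  qed
  then have cyc: "cyc p = map ?f [0..<m]" using m(1) by (simp add: cyc_def upt_conv_Cons)
  moreover have "distinct (map ?f [0..<m])"
  proof -
    have "?f i \<noteq> ?f j" if "i < j" "j < m" for i j
      using cancel[of i j] least[of "j - i"] that by auto
    then show ?thesis by (auto simp: distinct_map inj_on_def) (metis nat_neq_iff)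
  qed
  ultimately show ?thesis using m that by metis
qed

lemma set_cyc: "p \<in> set P \<Longrightarrow> set (cyc p) = range (\<lambda>n. (\<sigma> ^^ n) p)"
proof -
  assume p: "p \<in> set P"
  obtain m where m: "0 < m" "(\<sigma> ^^ m) p = p" "cyc p = map (\<lambda>n. (\<sigma> ^^ n) p) [0..<m]" using orbit[OF p] .
  have "(\<sigma> ^^ n) p \<in> (\<lambda>n. (\<sigma> ^^ n) p) ` {0..<m}" for n
    using m(1) funpow_mod_eq[OF m(2), of n] by (intro image_eqI[of _ _ "n mod m"]) auto
  then show ?thesis by (auto simp: m(3))
qed

lemma cyc_subset: "p \<in> set P \<Longrightarrow> set (cyc p) \<subseteq> set P"
  using funpow_mem[of "set P" \<sigma>] closed by (auto simp: set_cyc)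

lemma set_cyc_eq:
  assumes p: "p \<in> set P" and q: "q \<in> set (cyc p)"
  shows "set (cyc q) = set (cyc p)"
proof -
  have qP: "q \<in> set P" using cyc_subset[OF p] q by auto
  obtain m where m: "0 < m" "(\<sigma> ^^ m) p = p" "cyc p = map (\<lambda>n. (\<sigma> ^^ n) p) [0..<m]" using orbit[OF p] .
  obtain i where i: "i < m" "q = (\<sigma> ^^ i) p" using q by (auto simp: m(3))
  have p_eq: "p = (\<sigma> ^^ (m - i)) q"
    using m(2) i by (simp add: funpow_add[symmetric, unfolded comp_def, THEN fun_cong])
  have "(\<sigma> ^^ n) q = (\<sigma> ^^ (n + i)) p" for n by (simp add: i(2) funpow_add)
  moreover have "(\<sigma> ^^ n) p = (\<sigma> ^^ (n + (m - i))) q" for n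
    by (subst p_eq) (simp add: funpow_add)
  ultimately have "range (\<lambda>n. (\<sigma> ^^ n) q) = range (\<lambda>n. (\<sigma> ^^ n) p)" by blast
  then show ?thesis unfolding set_cyc[OF p] set_cyc[OF qP] .
qed

lemma cyclic_pairs_cyc:
  assumes p: "p \<in> set P"
  shows "cyclic_pairs (cyc p) = (\<lambda>u. (u, \<sigma> u)) ` set (cyc p)"
proof -
  obtain m where m: "0 < m" "(\<sigma> ^^ m) p = p" "cyc p = map (\<lambda>n. (\<sigma> ^^ n) p) [0..<m]" using orbit[OF p] .
  have "cyc p ! (Suc i mod m) = \<sigma> ((\<sigma> ^^ i) p)" for i
    using m(1) funpow_mod_eq[OF m(2), of "Suc i"] by (simp add: m(3))
  then have succ: "cyc p ! (Suc i mod length (cyc p)) = \<sigma> (cyc p ! i)" if "i < length (cyc p)" for i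
    using that by (simp add: m(3))
  have "(u, v) \<in> cyclic_pairs (cyc p) \<longleftrightarrow> u \<in> set (cyc p) \<and> v = \<sigma> u" for u v
    unfolding cyclic_pairs_nth in_set_conv_nth using succ by metis
  then show ?thesis by auto
qed

lemma base_of:
  assumes q: "q \<in> set P"
  obtains b where "b \<in> set bases" "q \<in> set (cyc b)"
proof -
  have "q \<in> set (cyc q)" by (simp add: cyc_def)
  then obtain b where b: "find (\<lambda>r. r \<in> set (cyc q)) P = Some b"
    using q by (metis find_None_iff not_Some_eq)
  then have "b \<in> set P" "b \<in> set (cyc q)" by (auto simp: find_Some_iff)
  then have eq: "set (cyc b) = set (cyc q)" using set_cyc_eq[OF q] by blast
  then have "b \<in> set bases" using b \<open>b \<in> set P\<close> by (simp add: bases_def)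
  then show ?thesis using that eq \<open>q \<in> set (cyc q)\<close> by blast
qed

text \<open>If the orbits meet they coincide, and both base points are the first element of
  \<open>P\<close> in the common orbit.\<close>

lemma bases_disjoint:
  assumes "b \<in> set bases" "b' \<in> set bases" "b \<noteq> b'"
  shows "set (cyc b) \<inter> set (cyc b') = {}"
proof (rule ccontr)
  assume "set (cyc b) \<inter> set (cyc b') \<noteq> {}"
  then obtain x where "x \<in> set (cyc b)" "x \<in> set (cyc b')" by blast
  then have "set (cyc b) = set (cyc b')"
    using set_cyc_eq assms(1,2) unfolding bases_def by (metis (no_types, lifting) filter_is_subset subsetD)
  then show False using assms by (auto simp: bases_def)
qed

lemma distinct_cycles:
  assumes "distinct bs" "set bs \<subseteq> set bases"
  shows "distinct (concat (map cyc bs))"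
proof (rule distinct_concat)
  have P: "b \<in> set P" if "b \<in> set bs" for b using that assms(2) by (auto simp: bases_def)
  have ne: "b \<in> set (cyc b)" for b by (simp add: cyc_def)
  show "distinct (map cyc bs)"
    using assms bases_disjoint ne by (fastforce simp: distinct_map inj_on_def)
  show "distinct c" if "c \<in> set (map cyc bs)" for c
    using that P orbit by (metis (no_types, lifting) image_iff set_map)
  show "set c \<inter> set c' = {}" if c: "c \<in> set (map cyc bs)" "c' \<in> set (map cyc bs)" "c \<noteq> c'" for c c'
  proof -
    obtain b b' where "c = cyc b" "c' = cyc b'" "b \<in> set bases" "b' \<in> set bases"
      using c assms(2) by auto
    then show ?thesis using c(3) bases_disjoint by metis
  qed
qed

end

section \<open>The components of a planar diagram\<close>

context closed_diagram
begin

sublocale perm: list_permutation "points [] w" nx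
proof
  show "nx x \<in> set (points [] w)" if "x \<in> set (points [] w)" for x
    using that nx_cases(1) by (simp add: set_points)
  show "inj_on nx (set (points [] w))"
  proof (rule inj_onI)
    fix u v assume *: "u \<in> set (points [] w)" "v \<in> set (points [] w)" "nx u = nx v"
    have "prev_point (nx u) = u" "prev_point (nx v) = v"
      using * nx_cases(3) unfolding set_points by blast+
    then show "u = v" using *(3) by argo
  qed
qed

abbreviation "alpha_bases \<equiv> base_points_of Alpha [] id w"
abbreviation "components \<equiv> map (component_from [] id w) alpha_bases"

lemma component_from_cyc: "component_from [] id w = perm.cyc"
  by (simp add: component_from_def perm.cyc_def fun_eq_iff)

lemma alpha_bases: "alpha_bases = filter (\<lambda>p. fst (strand_at p) = Alpha) perm.bases"
  by (auto simp: base_points_of_def base_points_def perm.bases_def component_from_cyc strand_at_def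
      case_prod_unfold)

lemma colour_cyc:
  assumes "p \<in> set (points [] w)" "q \<in> set (perm.cyc p)"
  shows "fst (strand_at q) = fst (strand_at p)"
proof -
  have "fst (strand_at ((nx ^^ n) p)) = fst (strand_at p) \<and> is_point ((nx ^^ n) p)" for n
    using nx_cases(1,2) assms(1) by (induction n) (auto simp: set_points)
  then show ?thesis using assms by (auto simp: perm.set_cyc)
qed

lemma distinct_components: "distinct (concat components)"
  unfolding component_from_cyc alpha_bases
  by (rule perm.distinct_cycles) (auto simp: perm.bases_def distinct_points)

lemma set_components: "set (concat components) = set alpha_points"
proof -
  have "q \<in> set (concat components) \<longleftrightarrow> q \<in> set alpha_points" for q
  proof
    assume "q \<in> set (concat components)"
    then obtain p where p: "p \<in> set perm.bases" "fst (strand_at p) = Alpha" "q \<in> set (perm.cyc p)"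
      by (auto simp: component_from_cyc alpha_bases)
    then have "p \<in> set (points [] w)" by (simp add: perm.bases_def)
    then show "q \<in> set alpha_points"
      using p colour_cyc[of p q] perm.cyc_subset[of p] by (auto simp: alpha_points_def)
  next
    assume "q \<in> set alpha_points"
    then have q: "q \<in> set (points [] w)" "fst (strand_at q) = Alpha" by (auto simp: alpha_points_def)
    obtain b where b: "b \<in> set perm.bases" "q \<in> set (perm.cyc b)" using perm.base_of[OF q(1)] .
    then have "fst (strand_at b) = Alpha" using colour_cyc[of b q] q(2) by (simp add: perm.bases_def)
    then show "q \<in> set (concat components)"
      using b by (cases b) (auto simp: component_from_cyc alpha_bases)
  qed
  then show ?thesis by blast
qed

lemma cycle_graph_components: "cycle_graph components = nx_graph"
proof -
  have "cycle_graph components = (\<Union>p\<in>set alpha_bases. (\<lambda>u. (u, nx u)) ` set (component_from [] id w p))"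
    unfolding cycle_graph_def component_from_cyc
    by (auto simp: perm.cyclic_pairs_cyc alpha_bases perm.bases_def)
  also have "\<dots> = (\<lambda>u. (u, nx u)) ` set (concat components)" by auto
  finally show ?thesis unfolding set_components nx_graph_def .
qed

lemma passage_event_at: "passage [] (\<lambda>_. []) w p = (case event_at p of None \<Rightarrow> [] | Some e \<Rightarrow> [e])"
  by (cases p) (auto simp: event_at_def split: dir.splits prod.splits tile.splits)

lemma planar_code_components: "planar_code w = map (\<lambda>c. concat (map (passage [] (\<lambda>_. []) w) c)) components"
  by (simp add: planar_code_def gauss_code_def comp_def)

text \<open>Read along the orientation, the points of a component spell its code, with
  \<open>None\<close> at the points without event. A component with no event at all becomes an empty
  word, and then the determinant vanishes.\<close>

theorem points_planar_code:
  "list_det alpha_points alpha_points (transfer nx_graph event_at) \<simeq>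
    (if [] \<in> set (planar_code w) then 0 else code_det (map (map Some) (planar_code w)))"
proof -
  let ?oc = "map (map event_at) components"
  have some: "map Some (concat (map (passage [] (\<lambda>_. []) w) c)) = somes (map event_at c)" for c
    by (induction c) (auto simp: passage_event_at split: option.splits)
  have oc: "map (map Some) (planar_code w) = map somes ?oc"
    unfolding planar_code_components by (simp add: some comp_def)
  have "(\<exists>u\<in>set ?oc. \<forall>e\<in>set u. e = None) \<longleftrightarrow> [] \<in> set (map somes ?oc)"
    by (rule trivial_component_iff)
  also have "\<dots> \<longleftrightarrow> [] \<in> set (planar_code w)"
    unfolding oc[symmetric] set_map image_iff by simp
  finally have empty: "(\<exists>u\<in>set ?oc. \<forall>e\<in>set u. e = None) \<longleftrightarrow> [] \<in> set (planar_code w)" .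
  have "list_det alpha_points alpha_points (transfer nx_graph event_at) \<simeq> cycle_det components event_at"
    unfolding cycle_det_def cycle_graph_components
  proof (rule list_det_perm)
    show "mset alpha_points = mset (concat components)"
      by (subst set_eq_iff_mset_eq_distinct[symmetric])
         (use distinct_components distinct_alpha_points set_components in auto)
    then show "mset alpha_points = mset (concat components)" .
  qed simp
  also have "cycle_det components event_at = code_det ?oc"
    by (rule cycle_det_eq_code_det[OF distinct_components])
  also have "\<dots> \<simeq> (if \<exists>u\<in>set ?oc. \<forall>e\<in>set u. e = None then 0 else code_det (map somes ?oc))"
    by (rule code_det_remove_None) (auto simp: component_from_def)
  finally show ?thesis unfolding empty oc .
qed

text \<open>Crossings are named by slices, and a slice has a single over-point. Equality of Gauss
  diagrams will carry this property to the surface code.\<close>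

lemma planar_code_over_unique:
  assumes "Under k s \<in> set (concat (planar_code w))"
  shows "length (filter (\<lambda>e. \<exists>s. e = Over k s) (concat (planar_code w))) = 1"
proof -
  let ?ps = "concat components"
  have code: "concat (planar_code w) = concat (map (passage [] (\<lambda>_. []) w) ?ps)"
  proof -
    have "concat (map (\<lambda>c. concat (map f c)) cs) = concat (map f (concat cs))"
      for f :: "point \<Rightarrow> event list" and cs by (induction cs) simp_all
    then show ?thesis unfolding planar_code_components .
  qed
  obtain u where u: "u \<in> set alpha_points" "event_at u = Some (Under k s)"
  proof -
    have "\<exists>u\<in>set ?ps. Under k s \<in> set (passage [] (\<lambda>_. []) w u)"
      using assms unfolding code set_concat[of "map _ _"] set_map by blast
    then obtain u where "u \<in> set ?ps" "Under k s \<in> set (passage [] (\<lambda>_. []) w u)" by blast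
    then show ?thesis
      using that unfolding set_components passage_event_at by (auto split: option.splits)
  qed
  have "length (filter (\<lambda>e. \<exists>s. e = Over k s) (concat (map (passage [] (\<lambda>_. []) w) ps))) =
      length (filter (\<lambda>p. \<exists>s. event_at p = Some (Over k s)) ps)" for ps
    by (induction ps) (auto simp: passage_event_at split: option.splits)
  then have "length (filter (\<lambda>e. \<exists>s. e = Over k s) (concat (planar_code w))) =
      length (filter (\<lambda>p. \<exists>s. event_at p = Some (Over k s)) ?ps)"
    unfolding code .
  also have "\<dots> = card (set (filter (\<lambda>p. \<exists>s. event_at p = Some (Over k s)) ?ps))"
    by (rule distinct_card[symmetric]) (rule distinct_filter[OF distinct_components])
  also have "set (filter (\<lambda>p. \<exists>s. event_at p = Some (Over k s)) ?ps) = {over_point k}"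
    unfolding set_filter set_components using event_over[of _ k] event_under(4,5)[OF u] by blast
  finally show ?thesis by simp
qed

end

section \<open>Fox derivatives in the field of fractions\<close>

definition monomial_eval :: "(var \<Rightarrow> ratfun) \<Rightarrow> (var \<Rightarrow>\<^sub>0 int) \<Rightarrow> ratfun" where
  "monomial_eval \<sigma> m = (\<Prod>v\<in>Poly_Mapping.keys m. \<sigma> v powi Poly_Mapping.lookup m v)"

lemma monomial_eval_superset:
  assumes "finite S" "Poly_Mapping.keys m \<subseteq> S"
  shows "monomial_eval \<sigma> m = (\<Prod>v\<in>S. \<sigma> v powi Poly_Mapping.lookup m v)"
  unfolding monomial_eval_def using assms
  by (intro prod.mono_neutral_left) (auto simp: in_keys_iff)

lemma laurent_eval_superset:
  assumes "finite S" "Poly_Mapping.keys p \<subseteq> S"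
  shows "laurent_eval \<sigma> p = (\<Sum>m\<in>S. of_int (Poly_Mapping.lookup p m) * monomial_eval \<sigma> m)"
  unfolding laurent_eval_def monomial_eval_def[symmetric] using assms
  by (intro sum.mono_neutral_left) (auto simp: in_keys_iff)

lemma laurent_eval_add: "laurent_eval \<sigma> (p + q) = laurent_eval \<sigma> p + laurent_eval \<sigma> q"
proof -
  let ?S = "Poly_Mapping.keys p \<union> Poly_Mapping.keys q"
  have "Poly_Mapping.keys (p + q) \<subseteq> ?S" by (rule keys_add)
  then show ?thesis
    by (simp add: laurent_eval_superset[of ?S] lookup_add algebra_simps sum.distrib)
qed

lemma laurent_eval_uminus: "laurent_eval \<sigma> (- p) = - laurent_eval \<sigma> p"
  by (simp add: laurent_eval_superset[of "Poly_Mapping.keys p"] sum_negf)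

lemma laurent_eval_diff: "laurent_eval \<sigma> (p - q) = laurent_eval \<sigma> p - laurent_eval \<sigma> q"
  using laurent_eval_add[of \<sigma> p "- q"] by (simp add: laurent_eval_uminus)

lemma laurent_eval_single: "laurent_eval \<sigma> (Poly_Mapping.single m c) = of_int c * monomial_eval \<sigma> m"
  by (simp add: laurent_eval_superset[of "{m}"])

lemma laurent_eval_0 [simp]: "laurent_eval \<sigma> 0 = 0"
  by (simp add: laurent_eval_def)

lemma monomial_eval_0 [simp]: "monomial_eval \<sigma> 0 = 1"
  by (simp add: monomial_eval_def)

lemma monomial_eval_single: "monomial_eval \<sigma> (Poly_Mapping.single v k) = \<sigma> v powi k"
  by (simp add: monomial_eval_superset[of "{v}"])

lemma monomial_eval_add:
  assumes "\<And>v. \<sigma> v \<noteq> 0"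
  shows "monomial_eval \<sigma> (m + n) = monomial_eval \<sigma> m * monomial_eval \<sigma> n"
proof -
  let ?S = "Poly_Mapping.keys m \<union> Poly_Mapping.keys n"
  have "Poly_Mapping.keys (m + n) \<subseteq> ?S" by (rule keys_add)
  then show ?thesis
    by (simp add: monomial_eval_superset[of ?S] lookup_add power_int_add assms prod.distrib)
qed

text \<open>Group elements generate the group ring under subtraction, so additive identities need
  only be checked on monomials.\<close>

lemma laurent_induct [case_names zero single diff]:
  fixes p :: "'k \<Rightarrow>\<^sub>0 int"
  assumes "P 0" "\<And>m. P (Poly_Mapping.single m 1)" "\<And>p q. P p \<Longrightarrow> P q \<Longrightarrow> P (p - q)"
  shows "P p"
  using subset_UNIV by (rule frag_induction[where S = UNIV]) (use assms in auto)

lemma laurent_eval_mult: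
  assumes "\<And>v. \<sigma> v \<noteq> 0"
  shows "laurent_eval \<sigma> (p * q) = laurent_eval \<sigma> p * laurent_eval \<sigma> q"
proof (induction p rule: laurent_induct)
  case (single m)
  show ?case
    by (induction q rule: laurent_induct)
      (simp_all add: mult_single laurent_eval_single monomial_eval_add[OF assms] right_diff_distrib laurent_eval_diff)
qed (simp_all add: left_diff_distrib laurent_eval_diff)

lemma laurent_eval_1 [simp]: "laurent_eval \<sigma> 1 = 1"
  using laurent_eval_single[of \<sigma> 0 1] by simp

lemma laurent_eval_det:
  assumes "\<And>v. \<sigma> v \<noteq> 0"
  shows "laurent_eval \<sigma> (det (mat n n f)) = det (mat n n (\<lambda>ij. laurent_eval \<sigma> (f ij)))"
proof -
  interpret comm_ring_hom "laurent_eval \<sigma>"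
    by unfold_locales (simp_all add: laurent_eval_add laurent_eval_mult[OF assms])
  have "map_mat (laurent_eval \<sigma>) (mat n n f) = mat n n (\<lambda>ij. laurent_eval \<sigma> (f ij))"
    by (intro eq_matI) auto
  then show ?thesis by (metis hom_det)
qed

section \<open>Fox calculus after the change of variables\<close>

definition csw_subst :: "var \<Rightarrow> ratfun" where
  "csw_subst = case_var (qq powi (- 2)) (\<lambda>z. inverse (indet (VC z)))"

lemma csw_subst_nonzero [simp]: "csw_subst v \<noteq> 0"
  by (cases v) (simp_all add: csw_subst_def)

definition word_eval :: "word \<Rightarrow> ratfun" where
  "word_eval u = monomial_eval csw_subst (word_exponent u)"

text \<open>Fox derivative, abelianisation and substitution in one map to the field, where words act
  as invertible scalars.\<close>

definition fox_eval :: "nat \<times> nat \<Rightarrow> word \<Rightarrow> ratfun" where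
  "fox_eval a u = laurent_eval csw_subst (phi (fox (Arc a) u))"

lemma word_eval_Nil [simp]: "word_eval [] = 1"
  by (simp add: word_eval_def)

lemma word_eval_Cons: "word_eval ((h, s) # u) =
    (if s = Pos then csw_subst (gen_var h) else inverse (csw_subst (gen_var h))) * word_eval u"
  by (simp add: word_eval_def monomial_eval_add monomial_eval_single power_int_minus)

lemma word_eval_append: "word_eval (u @ v) = word_eval u * word_eval v"
  by (induction u) (auto simp: word_eval_Cons)

lemma word_eval_nonzero [simp]: "word_eval u \<noteq> 0"
  by (induction u) (auto simp: word_eval_Cons split: if_splits)

lemma inv_word_Cons: "inv_word ((h, s) # u) = inv_word u @ [(h, flip s)]"
  by (simp add: inv_word_def)

lemma inv_word_append: "inv_word (u @ v) = inv_word v @ inv_word u"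
  by (simp add: inv_word_def)

lemma inv_word_Nil [simp]: "inv_word [] = []"
  by (simp add: inv_word_def)

lemma word_eval_inv: "word_eval (inv_word u) = inverse (word_eval u)"
proof (induction u)
  case (Cons l u)
  obtain h s where "l = (h, s)" by fastforce
  then show ?case using Cons by (cases s) (simp_all add: inv_word_Cons word_eval_append word_eval_Cons)
qed simp

lemma phi_eval_extend:
  "laurent_eval csw_subst (phi (frag_extend (\<lambda>v. frag_of ((h, s) # v)) F)) =
    (if s = Pos then csw_subst (gen_var h) else inverse (csw_subst (gen_var h))) * laurent_eval csw_subst (phi F)"
proof (induction F rule: laurent_induct)
  case (single u)
  have "laurent_eval csw_subst (phi (frag_of v)) = word_eval v" for v
    by (simp add: phi_def word_eval_def laurent_eval_single)
  then show ?case by (simp add: word_eval_Cons)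
qed (simp_all add: phi_def frag_extend_diff laurent_eval_diff right_diff_distrib)

lemma fox_eval_Nil [simp]: "fox_eval a [] = 0"
  by (simp add: fox_eval_def phi_def)

lemma fox_eval_Cons: "fox_eval a ((h, s) # u) =
    (if s = Pos then of_bool (h = Arc a) + csw_subst (gen_var h) * fox_eval a u
     else inverse (csw_subst (gen_var h)) * (fox_eval a u - of_bool (h = Arc a)))"
proof -
  have one: "laurent_eval csw_subst (phi (frag_of v)) = word_eval v" for v
    by (simp add: phi_def word_eval_def laurent_eval_single)
  have add: "phi (p + q) = phi p + phi q" "phi (- p) = - phi p" "phi 0 = 0" for p q
    by (simp_all add: phi_def frag_extend_add frag_extend_minus)
  show ?thesis
    by (cases s) (auto simp: fox_eval_def add laurent_eval_add laurent_eval_uminus phi_eval_extend one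
        word_eval_Cons algebra_simps)
qed

lemma fox_eval_append: "fox_eval a (u @ v) = fox_eval a u + word_eval u * fox_eval a v"
proof (induction u)
  case (Cons l u)
  obtain h s where "l = (h, s)" by fastforce
  then show ?case using Cons by (auto simp: fox_eval_Cons word_eval_Cons algebra_simps)
qed simp

text \<open>Differentiate \<open>inv_word u @ u\<close>. Words are not reduced, so this is not the
  empty word; its derivative is shown to vanish by cancelling the innermost pair of letters.\<close>

lemma fox_eval_inv: "fox_eval a (inv_word u) = - inverse (word_eval u) * fox_eval a u"
proof -
  have cancel: "word_eval (inv_word u) * word_eval u = 1" by (simp add: word_eval_inv)
  have "fox_eval a (inv_word u @ u) = 0"
  proof (induction u)
    case (Cons l u)
    obtain h s where l: "l = (h, s)" by fastforce
    have "inv_word (l # u) @ l # u = inv_word u @ [(h, flip s), (h, s)] @ u" by (simp add: l inv_word_Cons)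
    then have "fox_eval a (inv_word (l # u) @ l # u) = fox_eval a (inv_word u @ u)"
      by (cases s) (simp_all only: fox_eval_append, auto simp: fox_eval_Cons word_eval_Cons word_eval_append algebra_simps)
    then show ?case using Cons by simp
  qed simp
  then show ?thesis by (simp add: fox_eval_append word_eval_inv eq_neg_iff_add_eq_0)
qed

section \<open>The CSW matrix\<close>

definition spot_list :: "'e list list \<Rightarrow> (nat \<times> nat) list" where
  "spot_list c = concat (spots c)"

lemma set_spot_list: "set (spot_list c) = {(i, p). i < length c \<and> p < length (c ! i)}"
  unfolding spot_list_def by (rule set_spots)

lemma distinct_spot_list: "distinct (spot_list c)"
  unfolding spot_list_def by (rule distinct_spots)

lemma map_spot_list: "map (at_spot c) (spot_list c) = concat c"
  by (simp add: spot_list_def map_concat map_spots)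

abbreviation deck_weight :: "event \<Rightarrow> ratfun" where
  "deck_weight e \<equiv> word_eval (inv_word (deck_word e))"

text \<open>The argument lists events backwards from a spot, as \<open>arc_back\<close> does; the
  value is that of \<open>\<delta>\<^sup>-\<^sup>1\<close> in \<open>local_arc\<close>.\<close>

definition arc_weight :: "event list \<Rightarrow> ratfun" where
  "arc_weight b = word_eval (inv_word (concat (map deck_word (rev b))))"

lemma arc_weight_Nil [simp]: "arc_weight [] = 1"
  by (simp add: arc_weight_def)

lemma arc_weight_Cons: "arc_weight (e # b) = deck_weight e * arc_weight b"
  by (simp add: arc_weight_def inv_word_append word_eval_append)

text \<open>Here the conventions meet: covering transformations enter through
  \<open>\<delta>\<^sup>-\<^sup>1\<close>, the substitution inverts the curve variables, and both
  \<open>deck_word\<close> and \<open>zh_event\<close> exchange a curve with its dual. The signs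
  work out to the factor of the coloured strand on an occupied \<alpha>-strand.\<close>

lemma deck_weight: "\<not> is_under e \<Longrightarrow> deck_weight e = event_weight (Some (zh_event e))"
proof (cases e rule: deck_word.cases)
  case (1 i s)
  then show ?thesis
    by (cases s) (simp_all add: inv_word_def word_eval_Cons csw_subst_def pass_factor_def)
next
  case (2 i s)
  then show ?thesis
    by (cases s) (simp_all add: inv_word_def word_eval_Cons csw_subst_def pass_factor_def)
qed simp_all

lemma fox_eval_deck: "fox_eval a (concat (map deck_word b)) = 0"
proof (induction b)
  case (Cons e b)
  have "fox_eval a (deck_word e) = 0" by (cases e rule: deck_word.cases) (simp_all add: fox_eval_Cons)
  then show ?case using Cons by (simp add: fox_eval_append)
qed simp

definition arc_start :: "code \<Rightarrow> nat \<times> nat \<Rightarrow> nat \<times> nat" where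
  "arc_start c = (\<lambda>(i, p). (i, (p + length (c ! i) - length (arc_back (c ! i) p)) mod length (c ! i)))"

definition arc_entry :: "code \<Rightarrow> nat \<times> nat \<Rightarrow> nat \<times> nat \<Rightarrow> ratfun" where
  "arc_entry c a = (\<lambda>(i, p). of_bool (a = arc_start c (i, p)) * arc_weight (arc_back (c ! i) p))"

text \<open>No arc occurs in \<open>\<delta>\<close>, so only the middle letter of the conjugate
  contributes, with factor \<open>\<delta>\<^sup>-\<^sup>1\<close>. In the commutative ring the
  conjugation itself disappears and \<open>t\<close> remains.\<close>

lemma local_arc_eval:
  "fox_eval a (local_arc c x) = arc_entry c a x" "word_eval (local_arc c x) = qq powi (- 2)"
proof -
  obtain i p where x: "x = (i, p)" by fastforce
  define \<delta> where "\<delta> = concat (map deck_word (rev (arc_back (c ! i) p)))"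
  have l: "local_arc c x = inv_word \<delta> @ [(Arc (arc_start c x), Pos)] @ \<delta>"
    by (simp add: x \<delta>_def Let_def arc_start_def)
  have \<delta>: "fox_eval a \<delta> = 0" by (simp add: \<delta>_def fox_eval_deck)
  have "fox_eval a (local_arc c x) = inverse (word_eval \<delta>) * of_bool (arc_start c x = a)"
    unfolding l by (simp add: fox_eval_append fox_eval_Cons fox_eval_inv \<delta> word_eval_inv)
  moreover have "arc_weight (arc_back (c ! i) p) = inverse (word_eval \<delta>)"
    by (simp add: arc_weight_def word_eval_inv \<delta>_def)
  moreover have "(arc_start c x = a) = (a = arc_start c x)" by (rule eq_commute)
  ultimately show "fox_eval a (local_arc c x) = arc_entry c a x"
    by (simp add: arc_entry_def x)
  show "word_eval (local_arc c x) = qq powi (- 2)"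
    unfolding l by (simp add: word_eval_append word_eval_Cons word_eval_inv csw_subst_def)
qed

text \<open>All local arcs have the value \<open>t\<close>, so the relator differentiates to
  \<open>w a + (1 - w) b - d\<close>, where \<open>w\<close> is \<open>t\<^sup>-\<^sup>1\<close> at
  a positive crossing and \<open>t\<close> at a negative one. Up to sign this is the relation in
  \<open>transfer\<close>.\<close>

lemma fox_eval_wirtinger:
  assumes "c ! i ! p = Under k s"
  shows "fox_eval a (wirtinger c i p) =
    event_weight (Some (Under k s)) * arc_entry c a (i, p) +
    (1 - event_weight (Some (Under k s))) * arc_entry c a (over_spot c k) -
    arc_entry c a (i, Suc p mod length (c ! i))"
proof -
  have "inverse (qq powi (- 2)) = qq powi 2" by (simp add: power_int_minus)
  then show ?thesis
    by (cases s) (simp_all add: wirtinger_def assms Let_def fox_eval_append fox_eval_inv word_eval_append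
        word_eval_inv local_arc_eval field_simps power2_eq_square power_int_minus del: local_arc.simps)
qed

lemma fox_eval_closing: "fox_eval a (closing c i) = arc_entry c a (i, length (c ! i)) - arc_entry c a (i, 0)"
  by (simp add: closing_def fox_eval_append fox_eval_inv local_arc_eval del: local_arc.simps)

lemma unders_empty: "unders u = [] \<longleftrightarrow> (\<forall>e\<in>set u. \<not> is_under e)"
  by (auto simp: unders_def filter_empty_conv all_set_conv_all_nth)

lemma arc_back_step:
  assumes "p < length u" "unders u \<noteq> []"
  shows "arc_back u (Suc p mod length u) = (if is_under (u ! p) then [] else u ! p # arc_back u p)"
proof -
  have "rotate p u \<noteq> []" using assms(1) by auto
  then obtain x ys where xys: "rotate p u = x # ys" by (cases "rotate p u") auto
  have "u \<noteq> []" using assms(1) by auto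
  then have x: "x = u ! p" using hd_rotate_conv_nth[of u p] assms(1) xys by simp
  have "rotate (Suc p mod length u) u = rotate1 (rotate p u)"
    by (metis rotate_conv_mod rotate_Suc)
  then have "rev (rotate (Suc p mod length u) u) = x # rev ys" by (simp add: xys)
  \<comment> \<open>The backward search meets an under-passage before it has gone once round, so the
    event \<open>x\<close> at its far end does not matter.\<close>
  moreover have "takeWhile (\<lambda>e. \<not> is_under e) (rev ys @ [x]) = takeWhile (\<lambda>e. \<not> is_under e) (rev ys)"
    if "\<not> is_under x"
  proof -
    obtain e where "e \<in> set u" "is_under e" using assms(2) by (auto simp: unders_empty)
    then have "e \<in> set (rev ys)" using that xys by (metis set_ConsD set_rev set_rotate)
    then show ?thesis using \<open>is_under e\<close> by (intro takeWhile_append1[of e]) auto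
  qed
  ultimately show ?thesis using assms(2) by (simp add: arc_back_def xys x)
qed

lemma length_arc_back:
  assumes "p < length u"
  shows "length (arc_back u p) < length u"
proof (cases "unders u = []")
  case False
  have shorter: "length (takeWhile P xs) < length xs" if "\<exists>x\<in>set xs. \<not> P x" for P and xs :: "event list"
    using that by (induction xs) auto
  have "\<exists>e\<in>set (rev (rotate p u)). \<not> \<not> is_under e" using False by (simp add: unders_empty)
  then have "length (takeWhile (\<lambda>e. \<not> is_under e) (rev (rotate p u))) < length (rev (rotate p u))"
    by (rule shorter)
  then show ?thesis using False by (simp add: arc_back_def)
qed (use assms in \<open>simp add: arc_back_def\<close>)

definition next_spot :: "code \<Rightarrow> nat \<times> nat \<Rightarrow> nat \<times> nat" where
  "next_spot c = (\<lambda>(i, p). (i, Suc p mod length (c ! i)))"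

text \<open>The last place of an arc. Each such place yields one relator, and its successor is where
  the next arc starts.\<close>

definition arc_end :: "code \<Rightarrow> nat \<times> nat \<Rightarrow> bool" where
  "arc_end c = (\<lambda>(i, p). if unders (c ! i) = [] then Suc p = length (c ! i) else is_under (c ! i ! p))"

abbreviation arc_length :: "code \<Rightarrow> nat \<times> nat \<Rightarrow> nat" where
  "arc_length c \<equiv> \<lambda>(i, p). length (arc_back (c ! i) p)"

lemma arc_entry_end:
  assumes "u \<in> set (spot_list c)" "arc_end c u"
  shows "arc_entry c a (next_spot c u) = of_bool (a = next_spot c u)"
proof -
  obtain i p where u: "u = (i, p)" by fastforce
  have p: "p < length (c ! i)" using assms(1) by (simp add: u set_spot_list)
  have "arc_back (c ! i) (Suc p mod length (c ! i)) = []"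
    using assms(2) arc_back_step[OF p] by (auto simp: u arc_end_def arc_back_def split: if_splits)
  then show ?thesis by (simp add: u arc_entry_def arc_start_def next_spot_def)
qed

text \<open>Inside an arc the derivative only picks up the weight of each event, as
  \<open>transfer\<close> prescribes away from under-passages. The growing distance from the start
  will be the rank of the elimination.\<close>

lemma arc_entry_step:
  assumes "u \<in> set (spot_list c)" "\<not> arc_end c u"
  shows "arc_entry c a (next_spot c u) = event_weight (Some (zh_event (at_spot c u))) * arc_entry c a u"
    and "arc_length c (next_spot c u) = Suc (arc_length c u)"
    and "\<not> is_under (at_spot c u)"
proof -
  obtain i p where u: "u = (i, p)" by fastforce
  have p: "p < length (c ! i)" using assms(1) by (simp add: u set_spot_list)
  let ?n = "length (c ! i)" and ?b = "arc_back (c ! i) p"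
  show nu: "\<not> is_under (at_spot c u)"
    using assms(2) p by (auto simp: u arc_end_def unders_empty split: if_splits)
  have b: "arc_back (c ! i) (Suc p mod ?n) = c ! i ! p # ?b"
  proof (cases "unders (c ! i) = []")
    case True
    then have "Suc p < ?n" using assms(2) p by (simp add: u arc_end_def)
    then show ?thesis using True by (simp add: arc_back_def take_Suc_conv_app_nth)
  next
    case False
    then show ?thesis using arc_back_step[OF p] nu by (simp add: u)
  qed
  have len: "length ?b < ?n" using length_arc_back[OF p] .
  \<comment> \<open>Position and distance both grow by one, so the start of the arc stays the same,
    also across the cut of the word.\<close>
  have start: "(Suc p mod ?n + ?n - Suc (length ?b)) mod ?n = (p + ?n - length ?b) mod ?n"
  proof (cases "Suc p = ?n")
    case True
    then have "p + ?n - length ?b = (?n - Suc (length ?b)) + ?n" using len by simp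
    then show ?thesis using True by (metis add.left_neutral mod_add_self2 mod_self)
  qed (use p in simp)
  show "arc_length c (next_spot c u) = Suc (arc_length c u)" by (simp add: u next_spot_def b)
  show "arc_entry c a (next_spot c u) = event_weight (Some (zh_event (at_spot c u))) * arc_entry c a u"
    using nu deck_weight[of "c ! i ! p"]
    by (simp add: u arc_entry_def next_spot_def arc_start_def b start arc_weight_Cons mult_ac)
qed

lemma next_spot_mem: "u \<in> set (spot_list c) \<Longrightarrow> next_spot c u \<in> set (spot_list c)"
  by (auto simp: set_spot_list next_spot_def intro!: mod_less_divisor)

lemma next_spot_inj: "inj_on (next_spot c) (set (spot_list c))"
proof (rule inj_onI)
  fix u v assume *: "u \<in> set (spot_list c)" "v \<in> set (spot_list c)" "next_spot c u = next_spot c v"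
  obtain i p j q where "u = (i, p)" "v = (j, q)" by fastforce
  then show "u = v" using * by (auto simp: set_spot_list next_spot_def mod_Suc split: if_splits)
qed

lemma cycle_graph_spots:
  "(u, p) \<in> cycle_graph (spots c) \<longleftrightarrow> u \<in> set (spot_list c) \<and> p = next_spot c u"
proof -
  have pairs: "(u, p) \<in> cyclic_pairs (map (Pair i) [0..<n]) \<longleftrightarrow> (\<exists>j<n. u = (i, j) \<and> p = (i, Suc j mod n))"
    for i n :: nat
  proof -
    have "map (Pair i) [0..<n] ! (Suc j mod n) = (i, Suc j mod n)" if "j < n" for j
      using that mod_less_divisor[of n "Suc j"] by simp
    then show ?thesis unfolding cyclic_pairs_nth by auto
  qed
  have "(u, p) \<in> cycle_graph (spots c) \<longleftrightarrow>
      (\<exists>i<length c. (u, p) \<in> cyclic_pairs (map (Pair i) [0..<length (c ! i)]))"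
    by (auto simp: cycle_graph_def spots_def)
  then show ?thesis unfolding pairs by (cases u) (auto simp: set_spot_list next_spot_def)
qed

text \<open>Makes the definite description in \<open>over_spot\<close> meaningful for every crossing
  passed under.\<close>

definition well_matched :: "code \<Rightarrow> bool" where
  "well_matched c \<longleftrightarrow> (\<forall>k s. Under k s \<in> set (concat c) \<longrightarrow>
    length (filter (\<lambda>e. \<exists>s. e = Over k s) (concat c)) = 1)"

lemma over_spot_unique:
  assumes "well_matched c" "Under k s \<in> set (concat c)"
  shows "over_spot c k \<in> set (spot_list c)" "\<exists>s. at_spot c (over_spot c k) = Over k s"
    "\<And>x s. x \<in> set (spot_list c) \<Longrightarrow> at_spot c x = Over k s \<Longrightarrow> x = over_spot c k"
proof -
  let ?V = "spot_list c" and ?P = "\<lambda>x. \<exists>s. at_spot c x = Over k s"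
  have code: "concat c = map (at_spot c) ?V" by (simp add: map_spot_list)
  have "length (filter ?P ?V) = 1"
    using assms unfolding well_matched_def by (subst (asm) (2) code) (auto simp: filter_map comp_def)
  then obtain x where x: "filter ?P ?V = [x]" by (auto simp: length_Suc_conv)
  have iff: "y \<in> set ?V \<and> ?P y \<longleftrightarrow> y = x" for y
    using arg_cong[OF x, of set] by auto
  have "over_spot c k = x"
  proof -
    have "(\<lambda>(i, p). i < length c \<and> p < length (c ! i) \<and> (\<exists>s. c ! i ! p = Over k s)) = (\<lambda>y. y = x)"
      using iff by (auto simp: set_spot_list fun_eq_iff)
    then show ?thesis unfolding over_spot_def by simp
  qed
  then show "over_spot c k \<in> set ?V" "?P (over_spot c k)" using iff[of x] by simp_all
  show "y = over_spot c k" if "y \<in> set ?V" "at_spot c y = Over k s" for y s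
    using iff[of y] that \<open>over_spot c k = x\<close> by blast
qed

definition arc_ends :: "code \<Rightarrow> (nat \<times> nat) list" where
  "arc_ends c = concat (map (\<lambda>i. if unders (c ! i) = [] then [(i, length (c ! i) - 1)]
     else map (Pair i) (unders (c ! i))) [0..<length c])"

definition arc_relator :: "code \<Rightarrow> nat \<times> nat \<Rightarrow> word" where
  "arc_relator c = (\<lambda>(i, p). if unders (c ! i) = [] then closing c i else wirtinger c i p)"

lemma relator_list: "relator_list c = map (arc_relator c) (arc_ends c)"
  unfolding relator_list_def arc_ends_def map_concat
  by (auto simp: arc_relator_def intro!: arg_cong[of _ _ concat])

text \<open>An arc starts right after the end of its predecessor, so the columns of the Fox matrix
  are labelled by the successors of the places that label its rows. The arc of an empty word belongs
  to no place, hence the premise.\<close>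

lemma arc_list:
  assumes "[] \<notin> set c"
  shows "arc_list c = map (next_spot c) (arc_ends c)"
proof -
  have "c ! i \<noteq> []" if "i < length c" for i using assms nth_mem[OF that] by metis
  then show ?thesis
    unfolding arc_list_def arc_ends_def map_concat
    by (auto simp: next_spot_def intro!: arg_cong[of _ _ concat])
qed

lemma length_arc_list: "length (arc_list c) = length (relator_list c)"
  unfolding arc_list_def relator_list_def length_concat map_map comp_def
  by (intro arg_cong[of _ _ sum_list] map_cong) auto

lemma set_arc_ends:
  assumes "[] \<notin> set c"
  shows "set (arc_ends c) = {u \<in> set (spot_list c). arc_end c u}"
proof -
  have "c ! i \<noteq> []" if "i < length c" for i using assms nth_mem[OF that] by metis
  then show ?thesis
    by (auto simp: arc_ends_def set_spot_list arc_end_def unders_def split: if_splits)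
qed

lemma distinct_arc_ends: "distinct (arc_ends c)"
proof -
  have "distinct (concat (map (\<lambda>i. if unders (c ! i) = [] then [(i, length (c ! i) - 1)]
     else map (Pair i) (unders (c ! i))) ks))" if "distinct ks" for ks
    using that
  proof (induction ks)
    case (Cons k ks)
    have "distinct (unders (c ! k))" by (simp add: unders_def)
    then show ?case using Cons by (auto simp: distinct_map inj_on_def split: if_splits)
  qed simp
  then show ?thesis by (simp add: arc_ends_def)
qed

lemma list_det_neg: "list_det rs cs (\<lambda>r c. - f r c) \<simeq> list_det rs cs f"
proof -
  let ?n = "length rs"
  let ?A = "mat ?n ?n (\<lambda>(i, j). f (rs ! i) (cs ! j))"
  have "mat ?n ?n (\<lambda>(i, j). - f (rs ! i) (cs ! j)) = (- 1) \<cdot>\<^sub>m ?A" by (intro eq_matI) auto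
  then have "list_det rs cs (\<lambda>r c. - f r c) = (- 1) ^ ?n * list_det rs cs f"
    by (simp add: list_det_def)
  then show ?thesis by (cases "even ?n") (auto simp: eq_sign_def)
qed

lemma csw_eval_list_det:
  "laurent_eval csw_subst (csw_of_code c) =
    list_det (relator_list c) (arc_list c) (\<lambda>r a. fox_eval a r)"
  unfolding csw_of_code_def Let_def laurent_eval_det[of csw_subst, OF csw_subst_nonzero] list_det_def length_arc_list
  by (intro arg_cong[of _ _ det] eq_matI) (auto simp: fox_eval_def)

text \<open>The places inside arcs are eliminated with multipliers \<open>arc_entry\<close>: the
  rows at starts of arcs and the columns at ends survive, and a pivot joins an inner place to its
  successor. What remains is, up to sign and transposition, the Fox matrix. For an empty word the
  relator \<open>closing\<close> has zero derivatives, so the polynomial vanishes.\<close>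

theorem csw_eval_code_det:
  assumes wm: "well_matched c"
  shows "laurent_eval csw_subst (csw_of_code c) \<simeq>
    (if [] \<in> set c then 0 else code_det (map (map Some) (zh_code c)))"
proof (cases "[] \<in> set c")
  case True
  then obtain i where i: "i < length c" "c ! i = []" by (auto simp: in_set_conv_nth)
  then have "closing c i \<in> set (relator_list c)"
    by (auto simp: relator_list_def unders_def intro!: bexI[of _ i])
  moreover have "fox_eval a (closing c i) = 0" for a by (simp add: fox_eval_closing i)
  ultimately have "list_det (relator_list c) (arc_list c) (\<lambda>r a. fox_eval a r) = 0"
    by (intro list_det_zero_row) (auto simp: length_arc_list)
  then show ?thesis using True by (simp add: csw_eval_list_det)
next
  case False
  let ?V = "spot_list c" and ?\<sigma> = "next_spot c"
  define ev where "ev = (\<lambda>x. Some (zh_event (at_spot c x)))"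
  let ?f = "transfer (cycle_graph (spots c)) ev"
  define Ls where "Ls = arc_ends c"
  define C2 where "C2 = filter (\<lambda>u. \<not> arc_end c u) ?V"
  define h where "h a u = - fox_eval a (arc_relator c u)" for a u
  have Ls: "set Ls = {u \<in> set ?V. arc_end c u}" "distinct Ls"
    using set_arc_ends[OF False] distinct_arc_ends by (simp_all add: Ls_def)
  have C2: "set C2 = {u \<in> set ?V. \<not> arc_end c u}" "distinct C2"
    by (auto simp: C2_def distinct_spot_list)
  have not_under: "jump e (ev u) = 0" if "u \<in> set C2" for u e
    using arc_entry_step(3)[of u c] that
    by (cases "(e, ev u)" rule: jump.cases; cases "at_spot c u" rule: zh_event.cases) (auto simp: ev_def C2)
  have total: "(\<Sum>p\<in>set ?V. arc_entry c a p * ?f p u) =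
      arc_entry c a (?\<sigma> u) - event_weight (ev u) * arc_entry c a u - (\<Sum>p\<in>set ?V. jump (ev p) (ev u) * arc_entry c a p)"
    if u: "u \<in> set ?V" for a u
  proof -
    have "(\<Sum>p\<in>set ?V. arc_entry c a p * ?f p u) =
      (\<Sum>p\<in>set ?V. if p = ?\<sigma> u then arc_entry c a p else 0) -
      (\<Sum>p\<in>set ?V. if p = u then event_weight (ev p) * arc_entry c a p else 0) -
      (\<Sum>p\<in>set ?V. jump (ev p) (ev u) * arc_entry c a p)"
      unfolding sum_subtractf[symmetric]
      using u by (intro sum.cong) (auto simp: transfer_def cycle_graph_spots algebra_simps)
    then show ?thesis using u next_spot_mem[OF u] by simp
  qed
  have sum_C2: "(\<Sum>p\<in>set ?V. arc_entry c a p * ?f p u) = 0" if "u \<in> set C2" for a u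
    using total[of u a] arc_entry_step(1)[of u c a] not_under[OF that] that
    by (simp add: C2 ev_def)
  have sum_Ls: "(\<Sum>p\<in>set ?V. arc_entry c a p * ?f p u) = h a u" if "u \<in> set Ls" for a u
  proof -
    obtain i p where ip: "u = (i, p)" by fastforce
    have u: "u \<in> set ?V" "arc_end c u" using that Ls by auto
    then have p: "i < length c" "p < length (c ! i)" by (auto simp: ip set_spot_list)
    show ?thesis
    proof (cases "unders (c ! i) = []")
      case True
      then have len: "length (c ! i) = Suc p" using u(2) by (simp add: ip arc_end_def)
      have nu: "\<not> is_under (c ! i ! p)" using True p by (auto simp: unders_empty)
      then have "jump e (ev u) = 0" for e
        by (cases "(e, ev u)" rule: jump.cases; cases "c ! i ! p" rule: zh_event.cases) (auto simp: ev_def ip)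
      \<comment> \<open>The position \<open>length (c ! i)\<close> is the end of the full turn and
        not the spot \<open>0\<close>: there the arc carries the whole translation along the
        component.\<close>
      moreover have "arc_entry c a (i, length (c ! i)) = event_weight (ev u) * arc_entry c a u"
      proof -
        have "arc_back (c ! i) (length (c ! i)) = c ! i ! p # arc_back (c ! i) p"
          unfolding arc_back_def len take_Suc_conv_app_nth[OF p(2)] using True by simp
        moreover have "length (arc_back (c ! i) p) = p" using True len by (simp add: arc_back_def)
        ultimately show ?thesis
          using deck_weight[OF nu] len by (simp add: arc_entry_def arc_start_def arc_weight_Cons ip ev_def)
      qed
      ultimately show ?thesis
        using total[OF u(1), of a] True
        by (simp add: h_def arc_relator_def ip fox_eval_closing next_spot_def len)
    next
      case False
      then have "is_under (c ! i ! p)" using u(2) by (simp add: ip arc_end_def)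
      then obtain k s where ks: "c ! i ! p = Under k s" by (cases "c ! i ! p") auto
      have in_c: "Under k s \<in> set (concat c)" using p ks by (metis UN_I nth_mem set_concat)
      note over = over_spot_unique[OF wm in_c]
      obtain s' where s': "at_spot c (over_spot c k) = Over k s'" using over(2) by blast
      have "jump (ev x) (ev u) * arc_entry c a x =
          (if x = over_spot c k then (1 - event_weight (ev u)) * arc_entry c a x else 0)" if "x \<in> set ?V" for x
      proof (cases "x = over_spot c k")
        case True
        then show ?thesis using s' ks by (simp add: ev_def ip)
      next
        case False
        then have "at_spot c x \<noteq> Over k s''" for s'' using over(3)[OF that] by blast
        then have "jump (ev x) (ev u) = 0"
          by (cases "at_spot c x" rule: zh_event.cases) (auto simp: ev_def ip ks)
        then show ?thesis using False by simp
      qed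
      then have "(\<Sum>x\<in>set ?V. jump (ev x) (ev u) * arc_entry c a x) =
          (\<Sum>x\<in>set ?V. if x = over_spot c k then (1 - event_weight (ev u)) * arc_entry c a x else 0)"
        by (rule sum.cong[OF refl])
      also have "\<dots> = (1 - event_weight (ev u)) * arc_entry c a (over_spot c k)"
        using over(1) by simp
      finally show ?thesis
        using total[OF u(1), of a] False ks
        by (simp add: h_def arc_relator_def ip fox_eval_wirtinger next_spot_def ev_def)
    qed
  qed
  have inj: "inj_on ?\<sigma> (set ?V)" by (rule next_spot_inj)
  have VC: "set (Ls @ C2) = set ?V" "distinct (Ls @ C2)"
    using Ls C2 by auto
  have \<sigma>V: "?\<sigma> ` set ?V = set ?V"
    by (rule card_subset_eq) (use next_spot_mem inj in \<open>auto simp: card_image\<close>)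
  have "code_det (map (map Some) (zh_code c)) = cycle_det (spots c) ev"
  proof -
    have "map (map ev) (spots c) = map (map (Some \<circ> zh_event)) (map (map (at_spot c)) (spots c))"
      by (simp add: ev_def comp_def)
    then show ?thesis
      using cycle_det_eq_code_det[OF distinct_spots, of c ev] by (simp only: map_spots zh_code_def) (simp add: comp_def)
  qed
  also have "\<dots> = list_det ?V ?V ?f" by (simp add: cycle_det_def spot_list_def)
  also have "\<dots> \<simeq> list_det (map ?\<sigma> Ls @ map ?\<sigma> C2) (Ls @ C2) ?f"
  proof (rule list_det_perm)
    have "inj_on ?\<sigma> (set (Ls @ C2))" using inj VC(1) by simp
    then have "distinct (map ?\<sigma> (Ls @ C2))" using VC(2) by (simp only: distinct_map)
    moreover have "set (map ?\<sigma> (Ls @ C2)) = set ?V" using \<sigma>V VC(1) by (simp only: set_map)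
    ultimately show "mset ?V = mset (map ?\<sigma> Ls @ map ?\<sigma> C2)"
      by (subst set_eq_iff_mset_eq_distinct[symmetric]) (simp_all only: distinct_spot_list map_append)
    show "mset ?V = mset (Ls @ C2)"
      by (subst set_eq_iff_mset_eq_distinct[symmetric]) (simp_all only: distinct_spot_list VC)
  qed simp
  also have "\<dots> \<simeq> list_det (map ?\<sigma> Ls) Ls h"
  proof (rule list_det_reduce[where rank = "arc_length c" and G = "arc_entry c"])
    have disj: "?\<sigma> ` set Ls \<inter> ?\<sigma> ` set C2 = {}"
      using inj Ls(1) C2(1) by (auto dest: inj_onD)
    have V: "set ?V = ?\<sigma> ` set Ls \<union> ?\<sigma> ` set C2"
      using \<sigma>V VC(1) by (metis image_Un set_append)
    have all: "?f a u + (\<Sum>p\<in>?\<sigma> ` set C2. arc_entry c a p * ?f p u) = (\<Sum>p\<in>set ?V. arc_entry c a p * ?f p u)"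
      if a: "a \<in> set (map ?\<sigma> Ls)" for a u
    proof -
      have "arc_entry c a p = of_bool (a = p)" if p: "p \<in> ?\<sigma> ` set Ls" for p
      proof -
        obtain v where "p = ?\<sigma> v" "v \<in> set ?V" "arc_end c v" using p unfolding Ls(1) by blast
        then show ?thesis using arc_entry_end[of v c a] by simp
      qed
      then have "(\<Sum>p\<in>?\<sigma> ` set Ls. arc_entry c a p * ?f p u) = ?f a u"
        using a by (simp add: of_bool_def if_distrib[of "\<lambda>x. x * _"] cong: if_cong)
      then show ?thesis unfolding V by (subst sum.union_disjoint) (use disj in auto)
    qed
    show "?f a u + (\<Sum>p\<in>?\<sigma> ` set C2. arc_entry c a p * ?f p u) = h a u"
      if "a \<in> set (map ?\<sigma> Ls)" "u \<in> set Ls" for a u using all[OF that(1)] sum_Ls[OF that(2)] by metis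
    show "?f a u + (\<Sum>p\<in>?\<sigma> ` set C2. arc_entry c a p * ?f p u) = 0"
      if "a \<in> set (map ?\<sigma> Ls)" "u \<in> set C2" for a u using all[OF that(1)] sum_C2[OF that(2)] by metis
    show "distinct C2" by (rule C2)
    show "distinct (map ?\<sigma> C2)"
      using inj C2 by (auto simp: distinct_map intro: inj_on_subset)
    have rank: "arc_length c (?\<sigma> u) = Suc (arc_length c u)" if "u \<in> set C2" for u
      using arc_entry_step(2)[of u c] that C2(1) by simp
    show "?f (?\<sigma> u) u \<simeq> 1" if "u \<in> set C2" for u
    proof -
      have "?\<sigma> u \<noteq> u" using rank[OF that] by auto
      then show ?thesis using that not_under[OF that] C2(1)
        by (simp add: transfer_def cycle_graph_spots)
    qed
    show "?f (?\<sigma> v) u = 0"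
      if "u \<in> set C2" "v \<in> set C2" "u \<noteq> v" "arc_length c u \<le> arc_length c v" for u v
    proof -
      have "?\<sigma> v \<noteq> u" using rank[OF that(2)] that(4) by auto
      moreover have "?\<sigma> v \<noteq> ?\<sigma> u" using that inj C2(1) by (auto dest: inj_onD)
      ultimately show ?thesis using not_under[OF that(1)]
        by (simp add: transfer_def cycle_graph_spots)
    qed
  qed simp
  \<comment> \<open>In the Fox matrix relators label rows, in \<open>transfer\<close> their places
    label columns.\<close>
  also have "list_det (map ?\<sigma> Ls) Ls h = list_det Ls (map ?\<sigma> Ls) (\<lambda>u a. h a u)"
    by (rule list_det_swap) simp
  also have "\<dots> \<simeq> list_det Ls (map ?\<sigma> Ls) (\<lambda>u a. fox_eval a (arc_relator c u))"
    unfolding h_def by (rule list_det_neg)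
  also have "\<dots> = laurent_eval csw_subst (csw_of_code c)"
    using list_det_map[of "map ?\<sigma> Ls" Ls "arc_relator c" "\<lambda>a. a" "\<lambda>r a. fox_eval a r"]
    by (simp add: csw_eval_list_det relator_list arc_list[OF False] Ls_def)
  finally show ?thesis using False eq_sign_sym by simp
qed

section \<open>Comparison of the two invariants\<close>

text \<open>Equal Gauss diagrams have the same events up to an injective renaming of crossings, and
  \<open>zh_event\<close> leaves crossings alone; so the count of over-passages with a given name
  can be taken in either code.\<close>

lemma well_matched_same_gauss:
  assumes "same_gauss (zh_code c) c'" "well_matched c'"
  shows "well_matched c"
  unfolding well_matched_def
proof (intro allI impI)
  fix k s assume under: "Under k s \<in> set (concat c)"
  obtain f xs ys where f: "inj f" and xs: "mset xs = mset (zh_code c)" "mset ys = mset c'"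
    "list_all2 (\<lambda>u v. \<exists>n. v = rotate n (map (relabel f) u)) xs ys"
    using assms(1) by (auto simp: same_gauss_def rel_mset_def)
  have concat_mset: "mset (concat us) = mset (concat vs)" if "mset us = mset vs" for us vs :: code
    using that by (metis mset_concat mset_map sum_mset_sum_list)
  have "mset (concat ys) = image_mset (relabel f) (mset (concat xs))"
    using xs(3) by (induction rule: list_all2_induct) (auto simp: mset_rotate mset_map)
  moreover have "concat (zh_code c) = map zh_event (concat c)" by (simp add: zh_code_def map_concat)
  ultimately have m: "mset (concat c') = mset (map (relabel f \<circ> zh_event) (concat c))"
    using concat_mset[OF xs(1)] concat_mset[OF xs(2)] by (simp add: mset_map multiset.map_comp)
  have "relabel f (zh_event (Under k s)) \<in> set (concat c')"
    using under m by (metis comp_apply image_eqI list.set_map set_mset_mset)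
  then have "Under (f k) s \<in> set (concat c')" by (simp only: zh_event.simps relabel.simps)
  then have "length (filter (\<lambda>e. \<exists>s. e = Over (f k) s) (concat c')) = 1"
    using assms(2) unfolding well_matched_def by blast
  moreover have "length (filter (\<lambda>e. \<exists>s. e = Over (f k) s) (concat c')) =
      length (filter (\<lambda>e. \<exists>s. e = Over (f k) s) (map (relabel f \<circ> zh_event) (concat c)))"
    using m by (metis mset_filter size_mset)
  moreover have "(\<exists>s. (relabel f \<circ> zh_event) e = Over (f k) s) \<longleftrightarrow> (\<exists>s. e = Over k s)" for e
    using inj_eq[OF f] by (cases e rule: zh_event.cases) auto
  ultimately show "length (filter (\<lambda>e. \<exists>s. e = Over k s) (concat c)) = 1"
    by (simp add: filter_map comp_def)
qed

lemma empty_component_same_gauss: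
  assumes "same_gauss c c'"
  shows "[] \<in> set c \<longleftrightarrow> [] \<in> set c'"
proof -
  obtain f xs ys where xs: "mset xs = mset c" "mset ys = mset c'"
    "list_all2 (\<lambda>u v. \<exists>n. v = rotate n (map (relabel f) u)) xs ys"
    using assms by (auto simp: same_gauss_def rel_mset_def)
  have "[] \<in> set xs \<longleftrightarrow> [] \<in> set ys"
    using xs(3) by (induction rule: list_all2_induct) (auto simp: eq_commute[of "[]"])
  then show ?thesis using xs(1,2) by (metis set_mset_mset)
qed

theorem csw_eval_prismatic_value:
  assumes "zh_diagram g D Z"
  shows "\<exists>c. q_unit c \<and> laurent_eval csw_subst (csw_polynomial g D) = c * prismatic_value Z"
proof -
  let ?c = "surface_code g D"
  have Z: "tangle [] Z []" and gauss: "same_gauss (zh_code ?c) (planar_code Z)"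
    using assms by (auto simp: zh_diagram_def)
  interpret closed_diagram Z by unfold_locales (rule Z)
  have "well_matched (planar_code Z)"
    unfolding well_matched_def using planar_code_over_unique by blast
  then have wm: "well_matched ?c" using well_matched_same_gauss[OF gauss] by blast
  have empty: "[] \<in> set ?c \<longleftrightarrow> [] \<in> set (planar_code Z)"
    using empty_component_same_gauss[OF gauss] by (auto simp: zh_code_def)
  have "laurent_eval csw_subst (csw_polynomial g D) \<simeq>
      (if [] \<in> set ?c then 0 else code_det (map (map Some) (zh_code ?c)))"
    unfolding csw_polynomial_def by (rule csw_eval_code_det[OF wm])
  also have "\<dots> \<simeq> (if [] \<in> set (planar_code Z) then 0 else code_det (map (map Some) (planar_code Z)))"
    using code_det_same_gauss[OF gauss] by (simp add: empty)
  also have "\<dots> \<simeq> list_det alpha_points alpha_points (transfer nx_graph event_at)"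
    by (rule eq_sign_sym[OF points_planar_code])
  also have "\<dots> \<simeq> col_det cups (map (cap_column Z) caps)"
    by (rule col_det_transfer)
  finally have csw: "laurent_eval csw_subst (csw_polynomial g D) \<simeq>
      col_det cups (map (cap_column Z) caps)" (is "?x \<simeq> ?d") .
  obtain c where c: "q_unit c" "prismatic_value Z = c * ?d"
    using prismatic_value_col_det(1)[OF Z] by blast
  have d: "?d = inverse c * prismatic_value Z" using c q_unit_nonzero[OF c(1)] by (simp add: mult.assoc[symmetric])
  show ?thesis
  proof (cases "?x = ?d")
    case True
    then show ?thesis using d q_unit_inverse[OF c(1)] by auto
  next
    case False
    then have "?x = - inverse c * prismatic_value Z" using csw d by (simp add: eq_sign_def)
    then show ?thesis using q_unit_uminus[OF q_unit_inverse[OF c(1)]] by blast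
  qed
qed

lemma q_unit_laurent:
  assumes "q_unit c"
  obtains u v where "u \<in> laurent_ring g" "v \<in> laurent_ring g" "u * v = 1" "laurent_eval indet u = c"
proof -
  obtain k where "c \<simeq> qq powi k" using assms by (auto simp: q_unit_def)
  then have "\<exists>\<epsilon>::int. \<epsilon> * \<epsilon> = 1 \<and> c = of_int \<epsilon> * qq powi k"
    unfolding eq_sign_def by (auto intro: exI[of _ 1] exI[of _ "- 1"])
  then obtain \<epsilon> :: int where \<epsilon>: "\<epsilon> * \<epsilon> = 1" "c = of_int \<epsilon> * qq powi k" by blast
  \<comment> \<open>The sign is its own inverse, so the same coefficient serves for the unit and for
    its inverse.\<close>
  let ?m = "\<lambda>k. Poly_Mapping.single (Poly_Mapping.single VZ k) \<epsilon> :: laurent"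
  have "?m k \<in> laurent_ring g" for k by (auto simp: laurent_ring_def)
  moreover have "?m k * ?m (- k) = 1"
    by (simp add: mult_single \<epsilon>(1) single_add[symmetric])
  moreover have "laurent_eval indet (?m k) = c"
    by (simp add: laurent_eval_single monomial_eval_single \<epsilon>(2))
  ultimately show ?thesis using that by blast
qed

theorem theorem5p3p1:
  fixes g :: nat and D :: surface_diagram and Z :: "slice list"
  assumes "g \<ge> 1"
    and "surface_link_diagram g D"
    and "zh_diagram g D Z"
  shows "\<exists>u\<in>laurent_ring g. (\<exists>v\<in>laurent_ring g. u * v = 1) \<and>
    laurent_eval (case_var (qq powi (- 2)) (\<lambda>z. inverse (indet (VC z)))) (csw_polynomial g D) =
    laurent_eval indet u * prismatic_value Z"
proof -
  obtain c where c: "q_unit c" "laurent_eval csw_subst (csw_polynomial g D) = c * prismatic_value Z"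
    using csw_eval_prismatic_value[OF assms(3)] by blast
  obtain u v where "u \<in> laurent_ring g" "v \<in> laurent_ring g" "u * v = 1" "laurent_eval indet u = c"
    using q_unit_laurent[OF c(1)] .
  then show ?thesis using c(2) unfolding csw_subst_def by blast
qed

end
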